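(* Let $\mathsf{NQ.L}$ be any properly closed nested calculus. Then the rule $$\dfrac{\mathcal S\{X;\Gamma\Rightarrow\Delta,A\}\qquad \mathcal S\{X;A,\Gamma\Rightarrow\Delta\}}{\mathcal S\{X;\Gamma\Rightarrow\Delta\}}\;(Cut)$$ (for every one-hole context $\mathcal S\{\cdot\}$, signature $X$, multisets of formulas $\Gamma,\Delta$ and formula $A$) is admissible in $\mathsf{NQ.L}$, and so is the rule $$\dfrac{\mathcal S\{X;\Gamma\Rightarrow\Delta,\Box A\}\{Y_i;\Pi_i\Rightarrow\Sigma_i\}_{i=1}^n\qquad \mathcal S\{X;\Box A,\Gamma\Rightarrow\Delta\}\{Y_i;\Box A,\Pi_i\Rightarrow\Sigma_i\}_{i=1}^n}{\mathcal S\{X;\Gamma\Rightarrow\Delta\}\{Y_i;\Pi_i\Rightarrow\Sigma_i\}_{i=1}^n}\;(\mathsf L\text{-}Cut)$$ where $\mathcal S\{\cdot\}\{\cdot\}^n$ is a context with $n+1$ holes, $n\ge 0$, subject to the side conditions: if $\mathbf 4,\mathbf 5\notin\mathsf L$, then $n=0$; if $\mathbf 4\in\mathsf L$ and $\mathbf 5\notin\mathsf L$, then the context has the form $\mathcal S'\{X';\Gamma'\Rightarrow\Delta',\{\cdot\},\{\mathcal S_1\{\cdot\}^n\}\}$, i.e. each of the last $n$ holes is located at the node of the first hole or at a descendant of it; if $\mathbf 5\in\mathsf L$ and $\mathbf 4\notin\mathsf L$, then the first hole has depth at least $1$; if $\mathbf 4,\mathbf 5\in\mathsf L$, there is no rest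riction.
   Context: **Language.** Fix, for each $n$, an at most countable set of $n$-ary predicates $R^n_i$, and a denumerable set of variables. Formulas of $\mathcal L$: $A::=R_i^n(x_1,\dots,x_n)\mid x_1=x_2\mid\bot\mid A\supset A\mid\forall xA\mid\Box A$. Atomic formulas are those of shape $R_i^n(x_1,\dots,x_n)$ or $x_1=x_2$. Other connectives, $\exists$ and $\Diamond$ are defined as usual. $A(y/x)$ is capture-avoiding substitution (renaming bound variables if needed). **Axiom sets.** A frame is $\langle\mathcal W,\mathcal R,\mathcal D\rangle$ with $\mathcal W\neq\varnothing$, $\mathcal R\subseteq\mathcal W^2$, and $\mathcal D$ assigning to each $w\in\mathcal W$ a possibly empty set $\mathcal D_w$, with $\mathcal D_v\ne\varnothing$ for some $v$. Axiom names correspond to frame properties: $\mathbf D$: $\mathcal R$ serial; $\mathbf T$: reflexive; $\mathbf B$: symmetric; $\mathbf 4$: transitive; $\mathbf 5$: Euclidean ($w\mathcal Rv$ and $w\mathcal Ru$ imply $v\mathcal Ru$); $\mathbf{CBF}$: $w\mathcal Rv$ implies $\mathcal D_w\subseteq\mathcal D_v$; $\mathbf{BF}$: $w\mathcal Rv$ implies $\mathcal D_w\supseteq\mathcal D_v$; $\mathbf{UI}$: $\mathcal D_w=\mathcal D_v$ for all $w,v$. For $\mathsf L\subseteq\{\mathbf D,\mathbf T,\mathbf B,\mathbf 4,\mathbf 5,\mathbf{CBF},\mathbf{BF},\mathbf{UI}\}$, a $\mathsf{Q.L}$-frame is a frame with the properties of all members of $\mathsf L$. $\mathsf L$ is properly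 closed iff for every $Z\in\{\mathbf 4,\mathbf 5,\mathbf{CBF},\mathbf{BF}\}$, if all $\mathsf{Q.L}$-frames have the property of $Z$, then $Z\in\mathsf L$. **Nested sequents.** A sequent is $X;\Gamma\Rightarrow\Delta$ with $X$ (the signature) a finite multiset of variables and $\Gamma,\Delta$ finite multisets of formulas (an omitted signature is empty). A nested sequent is $X;\Gamma\Rightarrow\Delta,[\mathcal S_1],\dots,[\mathcal S_n]$ with $\mathcal S_i$ nested sequents: a finite tree of sequents with root $X;\Gamma\Rightarrow\Delta$ and the $\mathcal S_i$ as immediate subtrees (order irrelevant). A context $\mathcal S\{\cdot\}\cdots\{\cdot\}$ is a nested sequent with finitely many holes, each located at some node, in arbitrary relative positions (several holes may be at one node). Plugging $Y;\Pi\Rightarrow\Sigma,[\mathcal S'_1],\dots,[\mathcal S_k']$ into a hole at a node adds $Y,\Pi,\Sigma$ to the signature, antecedent, succedent of that node (multiset union) and adds the $\mathcal S'_j$ as further children; plugging $\emptyset$ removes the hole. The depth of a hole is the distance of its node from the root. $\{\mathcal S_i\}_{i=1}^n$ abbreviates plugging $\mathcal S_1,\dots,\mathcal S_n$ into $n$ holes. When a bracketed component $[Y;\Pi\Rightarrow\Sigma]$ is displayed in both premiss and conclusion of a rule (or is moved or merged by it), that node may have further children, which stay attached to it (to the resulting node, in case of merging); components displayed as newly created are leaves. **Rules** (premisses / conclusion). $\mathsf{NQ.K}$ consists of: - Initial sequents $\mathcal S\{X;P,\Gamma\Rightarrow\Delta,P\}$, $P$ atomic; and $L\bot$: $\mathcal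 S\{X;\bot,\Gamma\Rightarrow\Delta\}$ (no premisses). - $L{\supset}$: $\mathcal S\{X;\Gamma\Rightarrow\Delta,A\}$ and $\mathcal S\{X;B,\Gamma\Rightarrow\Delta\}$ / $\mathcal S\{X;A\supset B,\Gamma\Rightarrow\Delta\}$. $R{\supset}$: $\mathcal S\{X;A,\Gamma\Rightarrow\Delta,B\}$ / $\mathcal S\{X;\Gamma\Rightarrow\Delta,A\supset B\}$. - $L\forall$: $\mathcal S\{X,z;A(z/x),\forall xA,\Gamma\Rightarrow\Delta\}$ / $\mathcal S\{X,z;\forall xA,\Gamma\Rightarrow\Delta\}$. $R\forall$: $\mathcal S\{X,y;\Gamma\Rightarrow\Delta,A(y/x)\}$ / $\mathcal S\{X;\Gamma\Rightarrow\Delta,\forall xA\}$, $y$ (the eigenvariable) fresh, i.e. not occurring in the conclusion. - $L\Box$: $\mathcal S\{X;\Box A,\Gamma\Rightarrow\Delta,[Y;A,\Pi\Rightarrow\Sigma]\}$ / $\mathcal S\{X;\Box A,\Gamma\Rightarrow\Delta,[Y;\Pi\Rightarrow\Sigma]\}$. $R\Box$: $\mathcal S\{X;\Gamma\Rightarrow\Delta,[\emptyset;\Rightarrow A]\}$ / $\mathcal S\{X;\Gamma\Rightarrow\Delta,\Box A\}$. - $Ref$: $\mathcal S\{X;x=x,\Gamma\Rightarrow\Delta\}$ / $\mathcal S\{X;\Gamma\Rightarrow\Delta\}$. $Repl$ ($P$ atomic): $\mathcal S\{X;P(y/z),x=y,P(x/z),\Gamma\Rightarrow\Delta\}$ / $\mathcal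 S\{X;x=y,P(x/z),\Gamma\Rightarrow\Delta\}$. $Repl_X$: $\mathcal S\{X,x,y;x=y,\Gamma\Rightarrow\Delta\}$ / $\mathcal S\{X,x;x=y,\Gamma\Rightarrow\Delta\}$. $Rig$: $\mathcal S\{X;x=y,\Gamma\Rightarrow\Delta\}\{Y;x=y,\Pi\Rightarrow\Sigma\}$ / $\mathcal S\{X;x=y,\Gamma\Rightarrow\Delta\}\{Y;\Pi\Rightarrow\Sigma\}$. $\mathsf{NQ.L}$ adds the rule of each member of $\mathsf L$: - $R_D$ ($\mathbf D$): $\mathcal S\{X;\Gamma\Rightarrow\Delta,[\emptyset;\Rightarrow]\}$ / $\mathcal S\{X;\Gamma\Rightarrow\Delta\}$. $R_T$ ($\mathbf T$): $\mathcal S\{X;A,\Box A,\Gamma\Rightarrow\Delta\}$ / $\mathcal S\{X;\Box A,\Gamma\Rightarrow\Delta\}$. $R_B$ ($\mathbf B$): $\mathcal S\{X;A,\Gamma\Rightarrow\Delta,[Y;\Box A,\Pi\Rightarrow\Sigma]\}$ / $\mathcal S\{X;\Gamma\Rightarrow\Delta,[Y;\Box A,\Pi\Rightarrow\Sigma]\}$. $R_4$ ($\mathbf 4$): $\mathcal S\{X;\Box A,\Gamma\Rightarrow\Delta,[Y;\Box A,\Pi\Rightarrow\Sigma]\}$ / $\mathcal S\{X;\Box A,\Gamma\Rightarrow\Delta,[Y;\Pi\Rightarrow\Sigma]\}$. $R_5$ ($\mathbf 5$): $\mathcal S\{X;\Box A,\Gamma\Rightarrow\Delta\}\{Y;\Box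 A,\Pi\Rightarrow\Sigma\}$ / $\mathcal S\{X;\Box A,\Gamma\Rightarrow\Delta\}\{Y;\Pi\Rightarrow\Sigma\}$, first hole of depth $\ge1$. - $R_{cbf}$ ($\mathbf{CBF}$): $\mathcal S\{X,x;\Gamma\Rightarrow\Delta,[Y,x;\Pi\Rightarrow\Sigma]\}$ / $\mathcal S\{X,x;\Gamma\Rightarrow\Delta,[Y;\Pi\Rightarrow\Sigma]\}$. $R_{bf}$ ($\mathbf{BF}$): $\mathcal S\{X,x;\Gamma\Rightarrow\Delta,[Y,x;\Pi\Rightarrow\Sigma]\}$ / $\mathcal S\{X;\Gamma\Rightarrow\Delta,[Y,x;\Pi\Rightarrow\Sigma]\}$. $R_{ui}$ ($\mathbf{UI}$): $\mathcal S\{X,x;\Gamma\Rightarrow\Delta\}$ / $\mathcal S\{X;\Gamma\Rightarrow\Delta\}$. - $R_{5dom}$: $\mathcal S\{X,x;\Gamma\Rightarrow\Delta\}\{Y,x;\Pi\Rightarrow\Sigma\}$ / $\mathcal S\{X,x;\Gamma\Rightarrow\Delta\}\{Y;\Pi\Rightarrow\Sigma\}$, both holes of depth $\ge1$; it is a rule of $\mathsf{NQ.L}$ iff $\mathbf 5\in\mathsf L$ and $\{\mathbf{CBF},\mathbf{BF}\}\cap\mathsf L\ne\emptyset$. $\mathsf{NQ.L}$ is properly closed iff $\mathsf L$ is properly closed and $R_{5dom}$ is included exactly as just stated. **Derivations.** An $\mathsf{NQ.L}$-derivation of $\mathcal S$ is a finite tree of nested sequents with root $\mathcal S$, built by the rules,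 with leaves initial sequents (or instances of $L\bot$). Only derivations of pure sequents are considered: no variable occurs both free and bound, and eigenvariables are pairwise distinct. Height is the number of nodes on a longest branch. $\mathsf{NQ.L}\vdash\mathcal S$ ($\mathcal S$ is derivable) iff $\mathcal S$ or an alphabetical variant (bound renaming) of it has a derivation. A rule is admissible if whenever its premisses are derivable so is its conclusion; it is height-preserving admissible if whenever its premisses are derivable with height at most $n$, so is its conclusion. *)

theory Defs
  imports "HOL-Library.Multiset" "HOL-Library.Countable_Set"
begin

type_synonym var = nat

text \<open>The predicate symbol \<open>R\<^sup>n\<^sub>i\<close> applied to \<open>x\<^sub>1, \<dots>, x\<^sub>n\<close> is represented by
  \<open>Pred i [x\<^sub>1, \<dots>, x\<^sub>n]\<close>: the arity is the length of the argument list, so that symbols of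
  different arities are always different.\<close>

datatype 'p fm =
    Pred 'p "var list"
  | Eql var var
  | Falsum
  | Imp "'p fm" "'p fm"
  | Forall var "'p fm"
  | Box "'p fm"

text \<open>\<open>PS n\<close> is the set of indices of the \<open>n\<close>-ary predicates of the language.\<close>

primrec wff :: "(nat \<Rightarrow> 'p set) \<Rightarrow> 'p fm \<Rightarrow> bool" where
  "wff PS (Pred i xs) \<longleftrightarrow> i \<in> PS (length xs)"
| "wff PS (Eql x y) \<longleftrightarrow> True"
| "wff PS Falsum \<longleftrightarrow> True"
| "wff PS (Imp A B) \<longleftrightarrow> wff PS A \<and> wff PS B"
| "wff PS (Forall x A) \<longleftrightarrow> wff PS A"
| "wff PS (Box A) \<longleftrightarrow> wff PS A"

primrec atomic :: "'p fm \<Rightarrow> bool" where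
  "atomic (Pred i xs) \<longleftrightarrow> True"
| "atomic (Eql x y) \<longleftrightarrow> True"
| "atomic Falsum \<longleftrightarrow> False"
| "atomic (Imp A B) \<longleftrightarrow> False"
| "atomic (Forall x A) \<longleftrightarrow> False"
| "atomic (Box A) \<longleftrightarrow> False"

primrec fv :: "'p fm \<Rightarrow> var set" where
  "fv (Pred i xs) = set xs"
| "fv (Eql x y) = {x, y}"
| "fv Falsum = {}"
| "fv (Imp A B) = fv A \<union> fv B"
| "fv (Forall x A) = fv A - {x}"
| "fv (Box A) = fv A"

primrec bv :: "'p fm \<Rightarrow> var set" where
  "bv (Pred i xs) = {}"
| "bv (Eql x y) = {}"
| "bv Falsum = {}"
| "bv (Imp A B) = bv A \<union> bv B"
| "bv (Forall x A) = insert x (bv A)"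
| "bv (Box A) = bv A"

text \<open>Simultaneous capture-avoiding substitution of \<open>f x\<close> for every free \<open>x\<close>; a bound variable
  is renamed only if it would capture a substituted variable.\<close>

primrec ssubst :: "'p fm \<Rightarrow> (var \<Rightarrow> var) \<Rightarrow> 'p fm" where
  "ssubst (Pred i xs) f = Pred i (map f xs)"
| "ssubst (Eql x y) f = Eql (f x) (f y)"
| "ssubst Falsum f = Falsum"
| "ssubst (Imp A B) f = Imp (ssubst A f) (ssubst B f)"
| "ssubst (Forall x A) f =
     (let N = f ` (fv A - {x});
          x' = (if x \<in> N then LEAST z. z \<notin> N else x)
      in Forall x' (ssubst A (f(x := x'))))"
| "ssubst (Box A) f = Box (ssubst A f)"

abbreviation subst1 :: "'p fm \<Rightarrow> var \<Rightarrow> var \<Rightarrow> 'p fm"  ("_\<langle>_'/_\<rangle>" [1000, 0, 0] 1000) where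
  "A\<langle>y/x\<rangle> \<equiv> ssubst A (id(x := y))"

inductive alpha :: "'p fm \<Rightarrow> 'p fm \<Rightarrow> bool" where
  rename: "y \<notin> fv A \<union> bv A \<Longrightarrow> alpha (Forall x A) (Forall y (A\<langle>y/x\<rangle>))"
| refl: "alpha A A"
| sym: "alpha A B \<Longrightarrow> alpha B A"
| trans: "alpha A B \<Longrightarrow> alpha B C \<Longrightarrow> alpha A C"
| Imp: "alpha A A' \<Longrightarrow> alpha B B' \<Longrightarrow> alpha (Imp A B) (Imp A' B')"
| Forall: "alpha A A' \<Longrightarrow> alpha (Forall x A) (Forall x A')"
| Box: "alpha A A' \<Longrightarrow> alpha (Box A) (Box A')"

datatype ax = AxD | AxT | AxB | Ax4 | Ax5 | AxCBF | AxBF | AxUI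

definition frame :: "'w set \<Rightarrow> ('w \<times> 'w) set \<Rightarrow> ('w \<Rightarrow> 'd set) \<Rightarrow> bool" where
  "frame W R D \<longleftrightarrow> W \<noteq> {} \<and> R \<subseteq> W \<times> W \<and> (\<exists>v\<in>W. D v \<noteq> {})"

primrec has_property :: "ax \<Rightarrow> 'w set \<Rightarrow> ('w \<times> 'w) set \<Rightarrow> ('w \<Rightarrow> 'd set) \<Rightarrow> bool" where
  "has_property AxD W R D \<longleftrightarrow> (\<forall>w\<in>W. \<exists>v\<in>W. (w, v) \<in> R)"
| "has_property AxT W R D \<longleftrightarrow> (\<forall>w\<in>W. (w, w) \<in> R)"
| "has_property AxB W R D \<longleftrightarrow> sym R"
| "has_property Ax4 W R D \<longleftrightarrow> trans R"
| "has_property Ax5 W R D \<longleftrightarrow> (\<forall>w v u. (w, v) \<in> R \<longrightarrow> (w, u) \<in> R \<longrightarrow> (v, u) \<in> R)"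
| "has_property AxCBF W R D \<longleftrightarrow> (\<forall>(w, v)\<in>R. D w \<subseteq> D v)"
| "has_property AxBF W R D \<longleftrightarrow> (\<forall>(w, v)\<in>R. D v \<subseteq> D w)"
| "has_property AxUI W R D \<longleftrightarrow> (\<forall>w\<in>W. \<forall>v\<in>W. D w = D v)"

definition QL_frame :: "ax set \<Rightarrow> 'w set \<Rightarrow> ('w \<times> 'w) set \<Rightarrow> ('w \<Rightarrow> 'd set) \<Rightarrow> bool" where
  "QL_frame L W R D \<longleftrightarrow> frame W R D \<and> (\<forall>Z\<in>L. has_property Z W R D)"

text \<open>HOL cannot quantify over the types of worlds and objects inside a formula, so they are
  parameters. All the frame properties are first order, so by Loewenheim-Skolem every pair of
  infinite types gives the notion for frames of arbitrary size. For smaller types the condition is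
  only stronger, since fewer frames have to be considered.\<close>

definition properly_closed :: "'w itself \<Rightarrow> 'd itself \<Rightarrow> ax set \<Rightarrow> bool" where
  "properly_closed _ _ L \<longleftrightarrow>
     (\<forall>Z\<in>{Ax4, Ax5, AxCBF, AxBF}.
        (\<forall>(W :: 'w set) R (D :: 'w \<Rightarrow> 'd set). QL_frame L W R D \<longrightarrow> has_property Z W R D)
        \<longrightarrow> Z \<in> L)"

text \<open>\<open>NS X \<Gamma> \<Delta> K\<close> is the nested sequent \<open>X; \<Gamma> \<Rightarrow> \<Delta>, [S\<^sub>1], \<dots>, [S\<^sub>n]\<close> where \<open>K\<close> is the multiset of
  the \<open>S\<^sub>i\<close>.\<close>

datatype (sigvars: 'v, fms: 'f) nseq =
  NS "'v multiset" "'f multiset" "'f multiset" "('v, 'f) nseq multiset"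

type_synonym 'p nsequent = "(var, 'p fm) nseq"

text \<open>The sum of two nested sequents is their merge at the root.\<close>

instantiation nseq :: (type, type) comm_monoid_add
begin

definition zero_nseq :: "('a, 'b) nseq" where
  "0 = NS {#} {#} {#} {#}"

fun plus_nseq :: "('a, 'b) nseq \<Rightarrow> ('a, 'b) nseq \<Rightarrow> ('a, 'b) nseq" where
  "NS X \<Gamma> \<Delta> K + NS Y \<Pi> \<Sigma> M = NS (X + Y) (\<Gamma> + \<Pi>) (\<Delta> + \<Sigma>) (K + M)"

instance
proof
  fix a b c :: "('a, 'b) nseq"
  show "a + b + c = a + (b + c)"
    by (cases a; cases b; cases c) (simp add: ac_simps)
  show "a + b = b + a"
    by (cases a; cases b) (simp add: ac_simps)
  show "0 + a = a"
    by (cases a) (simp add: zero_nseq_def)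
qed

end

definition free_vars :: "'p nsequent \<Rightarrow> var set" where
  "free_vars S = sigvars S \<union> (\<Union>A\<in>fms S. fv A)"

definition bound_vars :: "'p nsequent \<Rightarrow> var set" where
  "bound_vars S = (\<Union>A\<in>fms S. bv A)"

definition pure :: "'p nsequent \<Rightarrow> bool" where
  "pure S \<longleftrightarrow> free_vars S \<inter> bound_vars S = {}"

definition wf_nsequent :: "(nat \<Rightarrow> 'p set) \<Rightarrow> 'p nsequent \<Rightarrow> bool" where
  "wf_nsequent PS S \<longleftrightarrow> (\<forall>A\<in>fms S. wff PS A)"

text \<open>The relator compares the signatures for equality and the formulas up to \<^const>\<open>alpha\<close>.\<close>

definition alphabetical_variant :: "'p nsequent \<Rightarrow> 'p nsequent \<Rightarrow> bool" where
  "alphabetical_variant = rel_nseq (=) alpha"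

text \<open>Each node of a context also carries the multiset of the holes located at it. Holes are
  identified by natural numbers; a context with \<open>n\<close> holes has exactly the holes
  \<open>0, \<dots>, n - 1\<close>.\<close>

datatype 'p ctx =
  Ctx "var multiset" "'p fm multiset" "'p fm multiset"
    (holes_here: "nat multiset") (subctxs: "'p ctx multiset")

primrec holes :: "'p ctx \<Rightarrow> nat multiset" where
  "holes (Ctx X \<Gamma> \<Delta> H K) = H + \<Sum>\<^sub># (image_mset holes K)"

definition has_holes :: "'p ctx \<Rightarrow> nat \<Rightarrow> bool" where
  "has_holes C n \<longleftrightarrow> holes C = mset [0..<n]"

text \<open>\<open>plug C [S\<^sub>0, \<dots>, S\<^sub>n]\<close> plugs \<open>S\<^sub>i\<close> into hole \<open>i\<close>.\<close>

primrec plug :: "'p ctx \<Rightarrow> 'p nsequent list \<Rightarrow> 'p nsequent" where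
  "plug (Ctx X \<Gamma> \<Delta> H K) Ss =
     NS X \<Gamma> \<Delta> (image_mset (\<lambda>C. plug C Ss) K) + (\<Sum>h\<in>#H. Ss ! h)"

text \<open>\<open>node_at C d N\<close>: the subtree \<open>N\<close> of \<open>C\<close> is rooted at a node at distance \<open>d\<close> from the root.\<close>

inductive node_at :: "'p ctx \<Rightarrow> nat \<Rightarrow> 'p ctx \<Rightarrow> bool" where
  root: "node_at C 0 C"
| child: "C' \<in># subctxs C \<Longrightarrow> node_at C' d N \<Longrightarrow> node_at C (Suc d) N"

definition hole_depth_ge1 :: "'p ctx \<Rightarrow> nat \<Rightarrow> bool" where
  "hole_depth_ge1 C h \<longleftrightarrow> (\<exists>d N. node_at C d N \<and> h \<in># holes_here N \<and> d \<ge> 1)"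

definition hole_at_or_below :: "'p ctx \<Rightarrow> nat \<Rightarrow> nat \<Rightarrow> bool" where
  "hole_at_or_below C h k \<longleftrightarrow> (\<exists>d N. node_at C d N \<and> h \<in># holes_here N \<and> k \<in># holes N)"

text \<open>\<open>rule_inst L Ps ys S\<close>: there is an instance of a rule of \<open>NQ.L\<close> with premisses \<open>Ps\<close> and
  conclusion \<open>S\<close>, where \<open>ys\<close> lists its eigenvariables. The multisets \<open>K\<close> contain the further
  children of a displayed component; the further children of a node with a hole are in the
  context.\<close>

inductive rule_inst ::
  "ax set \<Rightarrow> 'p nsequent list \<Rightarrow> var list \<Rightarrow> 'p nsequent \<Rightarrow> bool" for L :: "ax set" where
  Init: "has_holes C 1 \<Longrightarrow> atomic P \<Longrightarrow>
    rule_inst L [] [] (plug C [NS X (add_mset P \<Gamma>) (add_mset P \<Delta>) {#}])"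
| LBot: "has_holes C 1 \<Longrightarrow>
    rule_inst L [] [] (plug C [NS X (add_mset Falsum \<Gamma>) \<Delta> {#}])"
| LImp: "has_holes C 1 \<Longrightarrow>
    rule_inst L
      [plug C [NS X \<Gamma> (add_mset A \<Delta>) {#}], plug C [NS X (add_mset B \<Gamma>) \<Delta> {#}]] []
      (plug C [NS X (add_mset (Imp A B) \<Gamma>) \<Delta> {#}])"
| RImp: "has_holes C 1 \<Longrightarrow>
    rule_inst L
      [plug C [NS X (add_mset A \<Gamma>) (add_mset B \<Delta>) {#}]] []
      (plug C [NS X \<Gamma> (add_mset (Imp A B) \<Delta>) {#}])"
| LForall: "has_holes C 1 \<Longrightarrow>
    rule_inst L
      [plug C [NS (add_mset z X) (add_mset (A\<langle>z/x\<rangle>) (add_mset (Forall x A) \<Gamma>)) \<Delta> {#}]] []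
      (plug C [NS (add_mset z X) (add_mset (Forall x A) \<Gamma>) \<Delta> {#}])"
| RForall: "has_holes C 1 \<Longrightarrow> S = plug C [NS X \<Gamma> (add_mset (Forall x A) \<Delta>) {#}] \<Longrightarrow>
    y \<notin> free_vars S \<union> bound_vars S \<Longrightarrow>
    rule_inst L
      [plug C [NS (add_mset y X) \<Gamma> (add_mset (A\<langle>y/x\<rangle>) \<Delta>) {#}]] [y]
      S"
| LBox: "has_holes C 1 \<Longrightarrow>
    rule_inst L
      [plug C [NS X (add_mset (Box A) \<Gamma>) \<Delta> {# NS Y (add_mset A \<Pi>) \<Sigma> K #}]] []
      (plug C [NS X (add_mset (Box A) \<Gamma>) \<Delta> {# NS Y \<Pi> \<Sigma> K #}])"
| RBox: "has_holes C 1 \<Longrightarrow>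
    rule_inst L
      [plug C [NS X \<Gamma> \<Delta> {# NS {#} {#} {#A#} {#} #}]] []
      (plug C [NS X \<Gamma> (add_mset (Box A) \<Delta>) {#}])"
| Ref: "has_holes C 1 \<Longrightarrow>
    rule_inst L
      [plug C [NS X (add_mset (Eql x x) \<Gamma>) \<Delta> {#}]] []
      (plug C [NS X \<Gamma> \<Delta> {#}])"
| Repl: "has_holes C 1 \<Longrightarrow> atomic P \<Longrightarrow>
    rule_inst L
      [plug C [NS X (add_mset (P\<langle>y/z\<rangle>) (add_mset (Eql x y) (add_mset (P\<langle>x/z\<rangle>) \<Gamma>))) \<Delta> {#}]] []
      (plug C [NS X (add_mset (Eql x y) (add_mset (P\<langle>x/z\<rangle>) \<Gamma>)) \<Delta> {#}])"
| ReplX: "has_holes C 1 \<Longrightarrow>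
    rule_inst L
      [plug C [NS (add_mset x (add_mset y X)) (add_mset (Eql x y) \<Gamma>) \<Delta> {#}]] []
      (plug C [NS (add_mset x X) (add_mset (Eql x y) \<Gamma>) \<Delta> {#}])"
| Rig: "has_holes C 2 \<Longrightarrow>
    rule_inst L
      [plug C [NS X (add_mset (Eql x y) \<Gamma>) \<Delta> {#}, NS Y (add_mset (Eql x y) \<Pi>) \<Sigma> {#}]] []
      (plug C [NS X (add_mset (Eql x y) \<Gamma>) \<Delta> {#}, NS Y \<Pi> \<Sigma> {#}])"
| RD: "AxD \<in> L \<Longrightarrow> has_holes C 1 \<Longrightarrow>
    rule_inst L
      [plug C [NS X \<Gamma> \<Delta> {# NS {#} {#} {#} {#} #}]] []
      (plug C [NS X \<Gamma> \<Delta> {#}])"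
| RT: "AxT \<in> L \<Longrightarrow> has_holes C 1 \<Longrightarrow>
    rule_inst L
      [plug C [NS X (add_mset A (add_mset (Box A) \<Gamma>)) \<Delta> {#}]] []
      (plug C [NS X (add_mset (Box A) \<Gamma>) \<Delta> {#}])"
| RB: "AxB \<in> L \<Longrightarrow> has_holes C 1 \<Longrightarrow>
    rule_inst L
      [plug C [NS X (add_mset A \<Gamma>) \<Delta> {# NS Y (add_mset (Box A) \<Pi>) \<Sigma> K #}]] []
      (plug C [NS X \<Gamma> \<Delta> {# NS Y (add_mset (Box A) \<Pi>) \<Sigma> K #}])"
| R4: "Ax4 \<in> L \<Longrightarrow> has_holes C 1 \<Longrightarrow>
    rule_inst L
      [plug C [NS X (add_mset (Box A) \<Gamma>) \<Delta> {# NS Y (add_mset (Box A) \<Pi>) \<Sigma> K #}]] []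
      (plug C [NS X (add_mset (Box A) \<Gamma>) \<Delta> {# NS Y \<Pi> \<Sigma> K #}])"
| R5: "Ax5 \<in> L \<Longrightarrow> has_holes C 2 \<Longrightarrow> hole_depth_ge1 C 0 \<Longrightarrow>
    rule_inst L
      [plug C [NS X (add_mset (Box A) \<Gamma>) \<Delta> {#}, NS Y (add_mset (Box A) \<Pi>) \<Sigma> {#}]] []
      (plug C [NS X (add_mset (Box A) \<Gamma>) \<Delta> {#}, NS Y \<Pi> \<Sigma> {#}])"
| Rcbf: "AxCBF \<in> L \<Longrightarrow> has_holes C 1 \<Longrightarrow>
    rule_inst L
      [plug C [NS (add_mset x X) \<Gamma> \<Delta> {# NS (add_mset x Y) \<Pi> \<Sigma> K #}]] []
      (plug C [NS (add_mset x X) \<Gamma> \<Delta> {# NS Y \<Pi> \<Sigma> K #}])"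
| Rbf: "AxBF \<in> L \<Longrightarrow> has_holes C 1 \<Longrightarrow>
    rule_inst L
      [plug C [NS (add_mset x X) \<Gamma> \<Delta> {# NS (add_mset x Y) \<Pi> \<Sigma> K #}]] []
      (plug C [NS X \<Gamma> \<Delta> {# NS (add_mset x Y) \<Pi> \<Sigma> K #}])"
| Rui: "AxUI \<in> L \<Longrightarrow> has_holes C 1 \<Longrightarrow>
    rule_inst L
      [plug C [NS (add_mset x X) \<Gamma> \<Delta> {#}]] []
      (plug C [NS X \<Gamma> \<Delta> {#}])"
| R5dom: "Ax5 \<in> L \<Longrightarrow> {AxCBF, AxBF} \<inter> L \<noteq> {} \<Longrightarrow>
    has_holes C 2 \<Longrightarrow> hole_depth_ge1 C 0 \<Longrightarrow> hole_depth_ge1 C 1 \<Longrightarrow>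
    rule_inst L
      [plug C [NS (add_mset x X) \<Gamma> \<Delta> {#}, NS (add_mset x Y) \<Pi> \<Sigma> {#}]] []
      (plug C [NS (add_mset x X) \<Gamma> \<Delta> {#}, NS Y \<Pi> \<Sigma> {#}])"

text \<open>\<open>derivation PS L ys S\<close>: there is a derivation of \<open>S\<close> in which every nested sequent is pure and
  \<open>ys\<close> lists the eigenvariables of all its inferences, with repetitions.\<close>

inductive derivation ::
  "(nat \<Rightarrow> 'p set) \<Rightarrow> ax set \<Rightarrow> var list \<Rightarrow> 'p nsequent \<Rightarrow> bool"
  for PS :: "nat \<Rightarrow> 'p set" and L :: "ax set" where
  step: "rule_inst L Ps ys S \<Longrightarrow> wf_nsequent PS S \<Longrightarrow> pure S \<Longrightarrow>
    list_all2 (derivation PS L) yss Ps \<Longrightarrow> derivation PS L (ys @ concat yss) S"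

definition derivable :: "(nat \<Rightarrow> 'p set) \<Rightarrow> ax set \<Rightarrow> 'p nsequent \<Rightarrow> bool" where
  "derivable PS L S \<longleftrightarrow>
     (\<exists>S' ys. alphabetical_variant S S' \<and> derivation PS L ys S' \<and> distinct ys)"

text \<open>A rule is represented by the set of its instances (premisses, conclusion).\<close>

definition admissible ::
  "(nat \<Rightarrow> 'p set) \<Rightarrow> ax set \<Rightarrow> ('p nsequent list \<times> 'p nsequent) set \<Rightarrow> bool" where
  "admissible PS L \<rho> \<longleftrightarrow>
     (\<forall>(Ps, S)\<in>\<rho>. (\<forall>P\<in>set Ps. derivable PS L P) \<longrightarrow> derivable PS L S)"

definition Cut :: "('p nsequent list \<times> 'p nsequent) set" where
  "Cut = {([plug C [NS X \<Gamma> (add_mset A \<Delta>) {#}], plug C [NS X (add_mset A \<Gamma>) \<Delta> {#}]],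
           plug C [NS X \<Gamma> \<Delta> {#}]) | C X \<Gamma> \<Delta> A. has_holes C 1}"

definition LCut_side :: "ax set \<Rightarrow> nat \<Rightarrow> 'p ctx \<Rightarrow> bool" where
  "LCut_side L n C \<longleftrightarrow>
     (Ax4 \<notin> L \<and> Ax5 \<notin> L \<longrightarrow> n = 0) \<and>
     (Ax4 \<in> L \<and> Ax5 \<notin> L \<longrightarrow> (\<forall>i\<in>{1..n}. hole_at_or_below C 0 i)) \<and>
     (Ax5 \<in> L \<and> Ax4 \<notin> L \<longrightarrow> hole_depth_ge1 C 0)"

definition LCut :: "ax set \<Rightarrow> ('p nsequent list \<times> 'p nsequent) set" where
  "LCut L =
     {([plug C (NS X \<Gamma> (add_mset (Box A) \<Delta>) {#} #
                map (\<lambda>i. NS (Y i) (\<Pi> i) (\<Sigma> i) {#}) [1..<Suc n]),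
        plug C (NS X (add_mset (Box A) \<Gamma>) \<Delta> {#} #
                map (\<lambda>i. NS (Y i) (add_mset (Box A) (\<Pi> i)) (\<Sigma> i) {#}) [1..<Suc n])],
       plug C (NS X \<Gamma> \<Delta> {#} # map (\<lambda>i. NS (Y i) (\<Pi> i) (\<Sigma> i) {#}) [1..<Suc n]))
      | C X \<Gamma> \<Delta> A n Y \<Pi> \<Sigma>. has_holes C (Suc n) \<and> LCut_side L n C}"

end

theory Submission
  imports Defs
begin

text \<open>Both cuts preserve validity in the Kripke models of the logic, so it suffices that the cut-free
  calculus is sound and complete. For completeness, an underivable nested sequent is extended fairly
  and without end by backward rule applications; in the limit it is an infinite tree, whose nodes
  are the worlds of a countermodel. Its accessibility relation is defined canonically, from the boxed
  formulas and the signatures at the nodes, rather than as a closure of the tree order. Proper closure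
  makes this relation a frame relation for the logic which contains the tree order.

  Equality is interpreted by a congruence. The distinctness of eigenvariables is no obstacle to the
  search: each branch keeps an infinite supply of variables which is split at two-premiss rules.\<close>

subsection \<open>Formulas\<close>

text \<open>Accessibility is read off from the labels so that truth of boxed formulas and the domain
  axioms hold by definition. A closure of the tree order would force boxes to be followed along
  every path that some combination of axioms creates; with the canonical relation the combinations
  matter only for the tree order being contained in it and for the Euclidean property. Purity has to
  survive every backward step. The finite set \<open>F\<close> of bound variables of the starting
  sequent is fixed once and for all, and only variables outside \<open>F\<close> are substituted, so
  instantiation never renames a bound variable. The variables outside \<open>F\<close> also form the
  outer domain of the countermodel. A free variable need not lie in the domain of any world, as it
  may be missing from every signature; under \<open>AxUI\<close> every domain is the whole outer
  domain. The rules for implication and the right rules consume their principal formula, so the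
  labels do not grow monotonically. The limit collects whatever occurs at some stage, and a consumed
  formula is accounted for by its decomposition.\<close>

lemma finite_fv [simp]: "finite (fv A)"
  by (induction A) auto

lemma finite_bv [simp]: "finite (bv A)"
  by (induction A) auto

text \<open>Instances of a quantified formula are not subformulas, so the truth lemma needs an
  induction measure that substitution leaves unchanged.\<close>

primrec fm_depth :: "'p fm \<Rightarrow> nat" where
  "fm_depth (Pred i xs) = 0"
| "fm_depth (Eql x y) = 0"
| "fm_depth Falsum = 0"
| "fm_depth (Imp A B) = Suc (max (fm_depth A) (fm_depth B))"
| "fm_depth (Forall x A) = Suc (fm_depth A)"
| "fm_depth (Box A) = Suc (fm_depth A)"

lemma fm_depth_ssubst [simp]: "fm_depth (ssubst A f) = fm_depth A"
  by (induction A arbitrary: f) (auto simp: Let_def)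

lemma wff_ssubst [simp]: "wff PS (ssubst A f) \<longleftrightarrow> wff PS A"
  by (induction A arbitrary: f) (auto simp: Let_def)

text \<open>Names the variable that \<open>ssubst\<close> chooses inside its \<open>let\<close>, so
  that substitution under a quantifier becomes a plain rewriting rule and freshness of the choice
  can be stated separately.\<close>

definition bound_name :: "(var \<Rightarrow> var) \<Rightarrow> var \<Rightarrow> 'p fm \<Rightarrow> var" where
  "bound_name f x A = (if x \<in> f ` (fv A - {x}) then LEAST z. z \<notin> f ` (fv A - {x}) else x)"

lemma ssubst_Forall:
  "ssubst (Forall x A) f = Forall (bound_name f x A) (ssubst A (f(x := bound_name f x A)))"
  by (simp add: bound_name_def Let_def)

lemma bound_name_notin: "bound_name f x A \<notin> f ` (fv A - {x})"
proof -
  have "\<exists>z. z \<notin> f ` (fv A - {x})"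
    by (meson ex_new_if_finite finite_Diff finite_fv finite_imageI infinite_UNIV_nat)
  then show ?thesis
    unfolding bound_name_def using LeastI_ex[of "\<lambda>z. z \<notin> f ` (fv A - {x})"] by auto
qed

lemma fv_ssubst [simp]: "fv (ssubst A f) = f ` fv A"
proof (induction A arbitrary: f)
  case (Forall x A)
  have "fv (ssubst (Forall x A) f) = f(x := bound_name f x A) ` fv A - {bound_name f x A}"
    using Forall by (simp only: ssubst_Forall fv.simps)
  also have "\<dots> = f ` (fv A - {x})"
  proof -
    have "f v \<noteq> bound_name f x A" if "v \<in> fv A" "v \<noteq> x" for v
      using bound_name_notin[of f x A] that by (metis DiffI image_eqI singletonD)
    then show ?thesis
      by (auto simp: image_iff)
  qed
  finally show ?case by simp
qed auto

text \<open>The hypothesis excludes capture, so no bound variable is ever renamed. This is what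
  keeps the bound variables of the search inside a fixed finite set.\<close>

lemma bv_ssubst:
  "(\<And>v. f v = v \<or> f v \<notin> bv A) \<Longrightarrow> bv (ssubst A f) = bv A"
proof (induction A arbitrary: f)
  case (Forall x A)
  have "x \<notin> f ` (fv A - {x})"
  proof
    assume "x \<in> f ` (fv A - {x})"
    then obtain v where "f v = x" "v \<noteq> x"
      by auto
    then show False
      using Forall.prems[of v] by simp
  qed
  then have "bound_name f x A = x"
    by (simp add: bound_name_def)
  moreover have "bv (ssubst A (f(x := x))) = bv A"
    by (rule Forall.IH) (use Forall.prems in auto)
  ultimately show ?case
    by (simp add: ssubst_Forall del: ssubst.simps)
qed auto

lemma bv_subst1: "y \<notin> bv A \<Longrightarrow> bv (A\<langle>y/x\<rangle>) = bv A"
  by (rule bv_ssubst) auto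

lemma alpha_fv: "alpha A B \<Longrightarrow> fv A = fv B"
  by (induction rule: alpha.induct) auto

lemma alpha_wff: "alpha A B \<Longrightarrow> wff PS A = wff PS B"
  by (induction rule: alpha.induct) auto

text \<open>Renaming proceeds from the inside out: a quantifier gets its new name only after its
  body has been made to avoid \<open>F\<close>. The new variable also avoids the variables of the
  body, which is the side condition of \<open>alpha.rename\<close>.\<close>

lemma alpha_avoiding:
  assumes "finite F"
  shows "\<exists>B. alpha A B \<and> bv B \<inter> F = {}"
proof (induction A)
  case (Pred i xs)
  show ?case by (rule exI[of _ "Pred i xs"]) (simp add: alpha.refl)
next
  case (Eql x y)
  show ?case by (rule exI[of _ "Eql x y"]) (simp add: alpha.refl)
next
  case Falsum
  show ?case by (rule exI[of _ "Falsum"]) (simp add: alpha.refl)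
next
  case (Imp A B)
  then obtain A' B' where "alpha A A'" "alpha B B'" "bv A' \<inter> F = {}" "bv B' \<inter> F = {}"
    by blast
  then show ?case
    by (intro exI[of _ "Imp A' B'"]) (auto intro: alpha.Imp)
next
  case (Box A)
  then obtain A' where "alpha A A'" "bv A' \<inter> F = {}"
    by blast
  then show ?case
    by (intro exI[of _ "Box A'"]) (auto intro: alpha.Box)
next
  case (Forall x A)
  then obtain A' where A': "alpha A A'" "bv A' \<inter> F = {}"
    by blast
  have "finite (F \<union> fv A' \<union> bv A')"
    using assms by simp
  then obtain y where y: "y \<notin> F \<union> fv A' \<union> bv A'"
    using ex_new_if_finite[OF infinite_UNIV_nat] by meson
  have "alpha (Forall x A) (Forall y (A'\<langle>y/x\<rangle>))"
    using alpha.trans[OF alpha.Forall[OF A'(1)] alpha.rename] y by auto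
  moreover have "bv (Forall y (A'\<langle>y/x\<rangle>)) \<inter> F = {}"
    using A' y by (auto simp: bv_subst1)
  ultimately show ?case by blast
qed

instance fm :: (countable) countable
  by countable_datatype

text \<open>The type of predicate indices may be uncountable. Only indices from the countable union
  of the \<open>PS n\<close> occur in a well-formed formula, and numbering these maps the formulas
  injectively into the countable type \<open>nat fm\<close>.\<close>

lemma countable_wff:
  assumes "\<And>n. countable (PS n)"
  shows "countable {A. wff PS A}"
proof -
  let ?P = "\<Union>n. PS n"
  let ?h = "map_fm (to_nat_on ?P) :: 'a fm \<Rightarrow> nat fm"
  have inj: "inj_on (to_nat_on ?P) ?P"
    using assms by (intro inj_on_to_nat_on) auto
  have set: "set_fm A \<subseteq> ?P" if "wff PS A" for A
    using that by (induction A) auto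
  have "inj_on ?h {A. wff PS A}"
  proof (rule inj_onI)
    fix A B
    assume A: "A \<in> {A. wff PS A}" and B: "B \<in> {A. wff PS A}" and eq: "?h A = ?h B"
    show "A = B"
    proof (rule fm.inj_map_strong[OF _ eq])
      fix i j
      assume i: "i \<in> set_fm A" and j: "j \<in> set_fm B" and ij: "to_nat_on ?P i = to_nat_on ?P j"
      have "i \<in> ?P" "j \<in> ?P"
        using A B i j set[of A] set[of B] unfolding mem_Collect_eq by (meson subsetD)+
      then show "i = j"
        using inj_onD[OF inj ij] by simp
    qed
  qed
  moreover have "countable (?h ` {A. wff PS A})"
    by (rule countableI_type)
  ultimately show ?thesis
    by (metis countable_image_inj_on)
qed

subsection \<open>Nested sequents\<close>

lemma plus_nseq_simps [simp]:
  "sigvars (S + T) = sigvars S \<union> sigvars T"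
  "fms (S + T) = fms S \<union> fms T"
  "sigvars (0 :: ('v, 'f) nseq) = {}"
  "fms (0 :: ('v, 'f) nseq) = {}"
  by (cases S; cases T; auto simp: zero_nseq_def)+

lemma sigvars_sum_mset: "sigvars (\<Sum>h\<in>#H. f h) = (\<Union>h\<in>set_mset H. sigvars (f h))"
  by (induction H) auto

lemma fms_sum_mset: "fms (\<Sum>h\<in>#H. f h) = (\<Union>h\<in>set_mset H. fms (f h))"
  by (induction H) auto


lemma finite_sigvars [simp]: "finite (sigvars S)"
  by (induction S) auto

lemma finite_fms [simp]: "finite (fms S)"
  by (induction S) auto

text \<open>Serves to inherit well-formedness: the conclusion of a cut has no formulas beyond those
  of a premiss.\<close>

lemma fms_plug_mono:
  assumes "\<And>h. h \<in># holes C \<Longrightarrow> fms (Ss ! h) \<subseteq> fms (Ts ! h)"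
  shows "fms (plug C Ss) \<subseteq> fms (plug C Ts)"
  using assms
proof (induction C)
  case (Ctx X \<Gamma> \<Delta> H K)
  have "fms (plug k Ss) \<subseteq> fms (plug k Ts)" if "k \<in># K" for k
    using that by (intro Ctx.IH Ctx.prems) auto
  then have "(\<Union>k\<in>set_mset K. fms (plug k Ss)) \<subseteq> (\<Union>k\<in>set_mset K. fms (plug k Ts))"
    by (rule UN_mono[OF order_refl])
  moreover have "(\<Union>h\<in>set_mset H. fms (Ss ! h)) \<subseteq> (\<Union>h\<in>set_mset H. fms (Ts ! h))"
    by (rule UN_mono) (use Ctx.prems in auto)
  ultimately show ?case
    unfolding plug.simps plus_nseq_simps fms_sum_mset nseq.set
    by (intro Un_mono order_refl) (simp_all add: image_image)
qed

lemma has_holes_1: "has_holes C 1 \<longleftrightarrow> holes C = {#0#}"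
  by (simp add: has_holes_def)

lemma has_holes_2: "has_holes C 2 \<longleftrightarrow> holes C = {#0, 1#}"
  by (simp add: has_holes_def numeral_2_eq_2)

lemma zero_in_holes: "has_holes C 1 \<Longrightarrow> 0 \<in># holes C"
  unfolding has_holes_1 by simp

lemma set_mset_holes: "has_holes C n \<Longrightarrow> set_mset (holes C) = {..<n}"
  by (auto simp: has_holes_def)

lemma count_holes: "has_holes C n \<Longrightarrow> count (holes C) h \<le> 1"
  using distinct_count_atmost_1[of "[0..<n]"] by (simp add: has_holes_def)

lemma free_vars_plug: "h \<in># holes C \<Longrightarrow> free_vars (Ss ! h) \<subseteq> free_vars (plug C Ss)"
proof (induction C)
  case (Ctx X \<Gamma> \<Delta> H K)
  show ?case
  proof (cases "h \<in># H")
    case True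
    then show ?thesis
      by (auto simp: free_vars_def sigvars_sum_mset fms_sum_mset)
  next
    case False
    then obtain k where k: "k \<in># K" "h \<in># holes k"
      using Ctx.prems by auto
    have "free_vars (plug k Ss) \<subseteq> free_vars (plug (Ctx X \<Gamma> \<Delta> H K) Ss)"
      using k(1) by (auto simp: free_vars_def)
    then show ?thesis
      using Ctx.IH[OF k] by blast
  qed
qed

lemma conversep_alpha: "alpha\<inverse>\<inverse> = alpha"
  unfolding fun_eq_iff conversep_iff by (meson alpha.sym)

lemma alphabetical_variant_sym: "alphabetical_variant S T \<Longrightarrow> alphabetical_variant T S"
  using nseq.rel_flip[of "(=)" alpha T S]
  unfolding alphabetical_variant_def conversep_alpha conversep_eq by simp

lemma alphabetical_variant_wf:
  assumes "alphabetical_variant S S'" "wf_nsequent PS S'"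
  shows "wf_nsequent PS S"
proof -
  have "rel_set alpha (fms S) (fms S')"
    using assms(1) unfolding alphabetical_variant_def
    using nseq.set_transfer(2)[of "(=)" alpha] by (auto simp: rel_fun_def)
  then show ?thesis
    using assms(2) alpha_wff unfolding wf_nsequent_def rel_set_def by blast
qed

text \<open>A bound renaming chosen formula by formula suffices, since it leaves the free variables
  of the whole nested sequent unchanged.\<close>

lemma pure_variant_exists:
  fixes S :: "'p nsequent"
  obtains S' where "alphabetical_variant S S'" "pure S'"
proof -
  have fin: "finite (free_vars S)"
    by (simp add: free_vars_def)
  define r where "r A = (SOME B. alpha A B \<and> bv B \<inter> free_vars S = {})" for A :: "'p fm"
  have r: "alpha A (r A)" "bv (r A) \<inter> free_vars S = {}" for A
    using someI_ex[OF alpha_avoiding[OF fin, of A]] unfolding r_def by auto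
  let ?S' = "map_nseq id r S"
  have "alphabetical_variant S ?S'"
    unfolding alphabetical_variant_def nseq.rel_map
    by (rule nseq.rel_refl_strong) (use r in auto)
  moreover have "free_vars ?S' = free_vars S"
    using r(1)[THEN alpha_fv] by (auto simp: free_vars_def nseq.set_map)
  then have "pure ?S'"
    using r(2) by (fastforce simp: pure_def bound_vars_def nseq.set_map)
  ultimately show ?thesis ..
qed

subsection \<open>Semantics\<close>

locale interp =
  fixes R :: "'w \<Rightarrow> 'w \<Rightarrow> bool"
    and D :: "'w \<Rightarrow> 'd set"
    and E :: "'d \<Rightarrow> 'd \<Rightarrow> bool"
    and I :: "'w \<Rightarrow> 'p \<Rightarrow> 'd list \<Rightarrow> bool"
begin

primrec sat :: "'p fm \<Rightarrow> (var \<Rightarrow> 'd) \<Rightarrow> 'w \<Rightarrow> bool" where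
  "sat (Pred i xs) g w \<longleftrightarrow> I w i (map g xs)"
| "sat (Eql x y) g w \<longleftrightarrow> E (g x) (g y)"
| "sat Falsum g w \<longleftrightarrow> False"
| "sat (Imp A B) g w \<longleftrightarrow> (sat A g w \<longrightarrow> sat B g w)"
| "sat (Forall x A) g w \<longleftrightarrow> (\<forall>d\<in>D w. sat A (g(x := d)) w)"
| "sat (Box A) g w \<longleftrightarrow> (\<forall>v. R w v \<longrightarrow> sat A g v)"

text \<open>A refutation sends nodes to worlds and children to successors; this is falsity of the
  usual formula reading, in which a bracket is a box. The multiset of predicates
  \<open>image_mset refutes K\<close> gives the primitive recursion access to the children.\<close>

primrec refutes :: "'p nsequent \<Rightarrow> (var \<Rightarrow> 'd) \<Rightarrow> 'w \<Rightarrow> bool" where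
  "refutes (NS X \<Gamma> \<Delta> K) = (\<lambda>g w. (\<forall>x\<in>#X. g x \<in> D w) \<and> (\<forall>A\<in>#\<Gamma>. sat A g w) \<and>
     (\<forall>A\<in>#\<Delta>. \<not> sat A g w) \<and> (\<forall>f\<in>#image_mset refutes K. \<exists>v. R w v \<and> f g v))"

text \<open>\<open>\<omega> h\<close> is the world of the node of hole \<open>h\<close>.\<close>

primrec crefutes :: "'p ctx \<Rightarrow> (var \<Rightarrow> 'd) \<Rightarrow> (nat \<Rightarrow> 'w) \<Rightarrow> 'w \<Rightarrow> bool" where
  "crefutes (Ctx X \<Gamma> \<Delta> H K) = (\<lambda>g \<omega> w. (\<forall>x\<in>#X. g x \<in> D w) \<and> (\<forall>A\<in>#\<Gamma>. sat A g w) \<and>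
     (\<forall>A\<in>#\<Delta>. \<not> sat A g w) \<and> (\<forall>h\<in>#H. \<omega> h = w) \<and>
     (\<forall>f\<in>#image_mset crefutes K. \<exists>v. R w v \<and> f g \<omega> v))"

lemma sat_cong:
  "(\<And>x. x \<in> fv A \<Longrightarrow> g x = h x) \<Longrightarrow> sat A g w = sat A h w"
proof (induction A arbitrary: g h w)
  case (Pred i xs)
  then have "map g xs = map h xs" by simp
  then show ?case by (simp only: sat.simps)
next
  case (Imp A B)
  then show ?case by (metis UnCI fv.simps(4) sat.simps(4))
next
  case (Forall x A)
  have "sat A (g(x := d)) w = sat A (h(x := d)) w" for d
    by (rule Forall.IH) (use Forall.prems in auto)
  then show ?case by simp
next
  case (Box A)
  then show ?case by (metis fv.simps(6) sat.simps(6))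
qed auto

lemma sat_ssubst: "sat (ssubst A f) g w = sat A (g \<circ> f) w"
proof (induction A arbitrary: f g w)
  case (Forall x A)
  let ?z = "bound_name f x A"
  have "sat (ssubst A (f(x := ?z))) (g(?z := d)) w = sat A ((g \<circ> f)(x := d)) w" for d
    unfolding Forall.IH
  proof (rule sat_cong)
    fix v
    assume "v \<in> fv A"
    then have "v \<noteq> x \<Longrightarrow> f v \<noteq> ?z"
      using bound_name_notin[of f x A] by (metis DiffI image_eqI singletonD)
    then show "(g(?z := d) \<circ> f(x := ?z)) v = ((g \<circ> f)(x := d)) v"
      by auto
  qed
  then show ?case
    by (simp only: ssubst_Forall sat.simps)
qed (auto simp: comp_def)

lemma sat_alpha: "alpha A B \<Longrightarrow> sat A g w = sat B g w"
proof (induction arbitrary: g w rule: alpha.induct)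
  case (rename y A x)
  have "sat A (g(y := d) \<circ> id(x := y)) w = sat A (g(x := d)) w" for d
    by (rule sat_cong) (use rename in auto)
  then show ?case
    by (simp add: sat_ssubst)
qed auto

lemma refutes_alpha:
  assumes "alphabetical_variant S T" "refutes T g w"
  shows "refutes S g w"
  using assms unfolding alphabetical_variant_def
proof (induction S arbitrary: T w)
  case (NS X \<Gamma> \<Delta> K)
  obtain \<Gamma>' \<Delta>' K' where T: "T = NS X \<Gamma>' \<Delta>' K'"
    and rel: "rel_mset alpha \<Gamma> \<Gamma>'" "rel_mset alpha \<Delta> \<Delta>'"
      "rel_mset (rel_nseq (=) alpha) K K'"
    using NS.prems(1) by (cases T) (auto simp: multiset.rel_eq)
  have elem: "\<exists>b\<in>#N. Q a b" if "rel_mset Q M N" "a \<in># M" for Q M N and a :: 'x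
    using that multiset.set_transfer[of Q] by (auto simp: rel_fun_def rel_set_def)
  have "sat A g w" if "A \<in># \<Gamma>" for A
    using elem[OF rel(1) that] NS.prems(2) T sat_alpha by auto
  moreover have "\<not> sat A g w" if "A \<in># \<Delta>" for A
    using elem[OF rel(2) that] NS.prems(2) T sat_alpha by auto
  moreover have "\<exists>v. R w v \<and> refutes k g v" if k: "k \<in># K" for k
  proof -
    obtain k' where "k' \<in># K'" "rel_nseq (=) alpha k k'"
      using elem[OF rel(3) k] by blast
    moreover from this(1) obtain v where "R w v" "refutes k' g v"
      using NS.prems(2) T by auto
    ultimately show ?thesis
      using NS.IH[OF k] by blast
  qed
  ultimately show ?case
    using NS.prems(2) T by simp
qed

lemma refutes_plus [simp]: "refutes (S + T) g w \<longleftrightarrow> refutes S g w \<and> refutes T g w"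
  by (cases S; cases T) auto

lemma refutes_zero [simp]: "refutes 0 g w"
  by (simp add: zero_nseq_def)

lemma refutes_sum_mset [simp]:
  "refutes (\<Sum>h\<in>#H. f h) g w \<longleftrightarrow> (\<forall>h\<in>#H. refutes (f h) g w)"
  by (induction H) auto

text \<open>Only the worlds of holes that occur in the context matter; this allows the hole
  assignments found for different children to be glued.\<close>

lemma crefutes_cong_holes:
  "(\<And>h. h \<in># holes C \<Longrightarrow> \<omega> h = \<omega>' h) \<Longrightarrow> crefutes C g \<omega> w \<Longrightarrow> crefutes C g \<omega>' w"
proof (induction C arbitrary: w)
  case (Ctx X \<Gamma> \<Delta> H K)
  have "\<exists>v. R w v \<and> crefutes k g \<omega>' v" if k: "k \<in># K" for k
  proof -
    obtain v where "R w v" "crefutes k g \<omega> v"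
      using Ctx.prems(2) k by auto
    moreover have "\<omega> h = \<omega>' h" if "h \<in># holes k" for h
      using Ctx.prems(1) that \<open>k \<in># K\<close> by auto
    ultimately show ?thesis
      using Ctx.IH[OF k] by blast
  qed
  moreover have "\<omega>' h = w" if "h \<in># H" for h
    using Ctx.prems that by (auto dest: sym)
  ultimately show ?case
    using Ctx.prems(2) by auto
qed

lemma crefutes_cong_vars:
  "(\<And>x. x \<in> free_vars (plug C Ss) \<Longrightarrow> g x = g' x) \<Longrightarrow> crefutes C g \<omega> w \<Longrightarrow> crefutes C g' \<omega> w"
proof (induction C arbitrary: w)
  case (Ctx X \<Gamma> \<Delta> H K)
  have "sat A g w = sat A g' w" if "A \<in># \<Gamma> + \<Delta>" for A
    by (rule sat_cong, rule Ctx.prems(1)) (use that in \<open>auto simp: free_vars_def\<close>)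
  moreover have "g x = g' x" if "x \<in># X" for x
    by (rule Ctx.prems(1)) (use that in \<open>auto simp: free_vars_def\<close>)
  moreover have "\<exists>v. R w v \<and> crefutes k g' \<omega> v" if k: "k \<in># K" for k
  proof -
    obtain v where "R w v" "crefutes k g \<omega> v"
      using Ctx.prems(2) k by auto
    moreover have "g x = g' x" if "x \<in> free_vars (plug k Ss)" for x
      by (rule Ctx.prems(1)) (use that \<open>k \<in># K\<close> in \<open>auto simp: free_vars_def\<close>)
    ultimately show ?thesis
      using Ctx.IH[OF k] by blast
  qed
  ultimately show ?case
    using Ctx.prems(2) by simp
qed

text \<open>Reduces later arguments about contexts to the worlds of the holes. A hole that occurred
  twice could need two different worlds, hence the bound on the multiplicities.\<close>

lemma refutes_plug:
  "(\<And>h. count (holes C) h \<le> 1) \<Longrightarrow>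
    refutes (plug C Ss) g w \<longleftrightarrow>
      (\<exists>\<omega>. crefutes C g \<omega> w \<and> (\<forall>h\<in>#holes C. refutes (Ss ! h) g (\<omega> h)))"
proof (induction C arbitrary: w)
  case (Ctx X \<Gamma> \<Delta> H K)
  let ?S = "\<Sum>\<^sub># (image_mset holes K)"
  have K: "holes k \<subseteq># ?S" if "k \<in># K" for k
    using that by (metis image_mset_add_mset insert_DiffM mset_subset_eq_add_left sum_mset.insert)
  have cnt: "count H h + count ?S h \<le> 1" for h
    using Ctx.prems[of h] by simp
  have IH: "refutes (plug k Ss) g v \<longleftrightarrow>
      (\<exists>\<omega>. crefutes k g \<omega> v \<and> (\<forall>h\<in>#holes k. refutes (Ss ! h) g (\<omega> h)))" if "k \<in># K" for k v
    by (rule Ctx.IH[OF that])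
      (meson K[OF that] cnt le_add2 le_trans mset_subset_eq_count)
  \<comment> \<open>By the multiplicity bound a hole lies either at the root or in a single child;
    this fact and the next one say so.\<close>
  have disj: "h \<notin># H" if "k \<in># K" "h \<in># holes k" for k h
  proof -
    have "count ?S h \<ge> 1"
      using mset_subset_eqD[OF K that(2)] that(1) by (simp add: Suc_leI)
    then have "count H h = 0"
      using cnt[of h] by linarith
    then show ?thesis
      by (simp add: not_in_iff)
  qed
  have uniq: "k = k'" if k: "k \<in># K" "k' \<in># K" and h: "h \<in># holes k" "h \<in># holes k'" for k k' h
  proof (rule ccontr)
    assume "k \<noteq> k'"
    then obtain M where "K = add_mset k (add_mset k' M)"
      using k by (metis insert_DiffM insert_noteq_member)
    then have "count ?S h \<ge> count (holes k) h + count (holes k') h"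
      by simp
    moreover have "count (holes k) h \<ge> 1" "count (holes k') h \<ge> 1"
      using h by (simp_all add: Suc_leI)
    ultimately show False
      using cnt[of h] by linarith
  qed
  show ?case (is "?L \<longleftrightarrow> ?R")
  proof
    assume L: ?L
    have "\<forall>k\<in>#K. \<exists>v \<omega>. R w v \<and> crefutes k g \<omega> v \<and> (\<forall>h\<in>#holes k. refutes (Ss ! h) g (\<omega> h))"
      using L IH by fastforce
    then obtain v \<omega> where *: "\<And>k. k \<in># K \<Longrightarrow>
        R w (v k) \<and> crefutes k g (\<omega> k) (v k) \<and> (\<forall>h\<in>#holes k. refutes (Ss ! h) g (\<omega> k h))"
      by metis
    \<comment> \<open>Glues the assignments of the children: each hole below the root takes its
      world from the child that contains it.\<close>
    define \<omega>' where "\<omega>' h = (if h \<in># H then w else \<omega> (SOME k. k \<in># K \<and> h \<in># holes k) h)" for h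
    have \<omega>': "\<omega>' h = \<omega> k h" if "k \<in># K" "h \<in># holes k" for k h
    proof -
      have "(SOME k. k \<in># K \<and> h \<in># holes k) = k"
        by (rule some_equality) (use that uniq in auto)
      then show ?thesis
        using disj that by (simp add: \<omega>'_def)
    qed
    have "crefutes k g \<omega>' (v k)" if "k \<in># K" for k
      using crefutes_cong_holes[of k "\<omega> k" \<omega>'] \<omega>'[OF that] *[OF that] by metis
    moreover have "\<omega>' h = w" if "h \<in># H" for h
      using that by (simp add: \<omega>'_def)
    ultimately have "crefutes (Ctx X \<Gamma> \<Delta> H K) g \<omega>' w"
      using L * by auto
    moreover have "refutes (Ss ! h) g (\<omega>' h)" if h: "h \<in># holes (Ctx X \<Gamma> \<Delta> H K)" for h
    proof (cases "h \<in># H")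
      case True
      then show ?thesis using L by (simp add: \<omega>'_def)
    next
      case False
      then obtain k where k: "k \<in># K" "h \<in># holes k"
        using h by auto
      then show ?thesis using *[OF k(1)] \<omega>'[OF k] by auto
    qed
    ultimately show ?R by blast
  next
    assume ?R
    then obtain \<omega> where \<omega>: "crefutes (Ctx X \<Gamma> \<Delta> H K) g \<omega> w"
      "\<forall>h\<in>#H + ?S. refutes (Ss ! h) g (\<omega> h)"
      by auto
    have "\<exists>v. R w v \<and> refutes (plug k Ss) g v" if k: "k \<in># K" for k
    proof -
      have "\<forall>h\<in>#holes k. refutes (Ss ! h) g (\<omega> h)"
        using \<omega>(2) k by auto
      moreover obtain v where "R w v" "crefutes k g \<omega> v"
        using \<omega>(1) k by auto
      ultimately show ?thesis
        using IH[OF k] by blast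
    qed
    then show ?L
      using \<omega> by auto
  qed
qed

lemma refutes_plug1:
  "has_holes C 1 \<Longrightarrow> refutes (plug C [S]) g w \<longleftrightarrow> (\<exists>\<omega>. crefutes C g \<omega> w \<and> refutes S g (\<omega> 0))"
  by (subst refutes_plug) (use count_holes[of C 1] has_holes_1[of C] in auto)

lemma refutes_plug2:
  "has_holes C 2 \<Longrightarrow> refutes (plug C [S, T]) g w \<longleftrightarrow>
     (\<exists>\<omega>. crefutes C g \<omega> w \<and> refutes S g (\<omega> 0) \<and> refutes T g (\<omega> 1))"
  by (subst refutes_plug) (use count_holes[of C 2] has_holes_2[of C] in auto)

lemma crefutes_node_at:
  "node_at C d N \<Longrightarrow> crefutes C g \<omega> w \<Longrightarrow> \<exists>v. (R ^^ d) w v \<and> crefutes N g \<omega> v"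
proof (induction arbitrary: w rule: node_at.induct)
  case (root C)
  then show ?case by auto
next
  case (child C' C d N)
  obtain v where "R w v" "crefutes C' g \<omega> v"
    using child.hyps(1) child.prems by (cases C) auto
  then show ?case
    using child.IH relpowp_Suc_I2 by metis
qed

lemma crefutes_holes_here: "crefutes C g \<omega> w \<Longrightarrow> h \<in># holes_here C \<Longrightarrow> \<omega> h = w"
  by (cases C) auto

lemma crefutes_holes: "crefutes C g \<omega> w \<Longrightarrow> h \<in># holes C \<Longrightarrow> R\<^sup>*\<^sup>* w (\<omega> h)"
proof (induction C arbitrary: w)
  case (Ctx X \<Gamma> \<Delta> H K)
  show ?case
  proof (cases "h \<in># H")
    case True
    then show ?thesis using Ctx.prems by auto
  next
    case False
    then obtain k where k: "k \<in># K" "h \<in># holes k"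
      using Ctx.prems(2) by auto
    obtain v where "R w v" "crefutes k g \<omega> v"
      using Ctx.prems(1) k by auto
    then show ?thesis
      using Ctx.IH[OF k(1) _ k(2)] by (meson converse_rtranclp_into_rtranclp)
  qed
qed

lemma crefutes_depth_ge1:
  assumes "hole_depth_ge1 C h" "crefutes C g \<omega> w"
  shows "R\<^sup>+\<^sup>+ w (\<omega> h)"
proof -
  obtain d N where d: "node_at C d N" "h \<in># holes_here N" "d \<ge> 1"
    using assms(1) unfolding hole_depth_ge1_def by blast
  then obtain v where "(R ^^ d) w v" "crefutes N g \<omega> v"
    using crefutes_node_at assms(2) by blast
  then show ?thesis
    using d crefutes_holes_here by (metis One_nat_def Suc_le_lessD tranclp_power)
qed

lemma crefutes_at_or_below:
  assumes "hole_at_or_below C h k" "crefutes C g \<omega> w"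
  shows "R\<^sup>*\<^sup>* (\<omega> h) (\<omega> k)"
proof -
  obtain d N where d: "node_at C d N" "h \<in># holes_here N" "k \<in># holes N"
    using assms(1) unfolding hole_at_or_below_def by blast
  then obtain v where "crefutes N g \<omega> v"
    using crefutes_node_at assms(2) by blast
  then show ?thesis
    using d crefutes_holes_here crefutes_holes by metis
qed

end

section \<open>Soundness of the rules and of both cuts\<close>

locale model = interp R D E I
  for R :: "'w \<Rightarrow> 'w \<Rightarrow> bool"
    and D :: "'w \<Rightarrow> 'd set"
    and E :: "'d \<Rightarrow> 'd \<Rightarrow> bool"
    and I :: "'w \<Rightarrow> 'p \<Rightarrow> 'd list \<Rightarrow> bool" +
  fixes L :: "ax set" and W :: "'w set" and U :: "'d set"
  assumes R_W: "R w v \<Longrightarrow> w \<in> W \<and> v \<in> W"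
    and D_U: "w \<in> W \<Longrightarrow> D w \<subseteq> U"
    and E_refl: "d \<in> U \<Longrightarrow> E d d"
    and E_sym: "E d e \<Longrightarrow> E e d"
    and E_trans: "E d e \<Longrightarrow> E e e' \<Longrightarrow> E d e'"
    and I_cong: "w \<in> W \<Longrightarrow> list_all2 E ds es \<Longrightarrow> I w i ds \<Longrightarrow> I w i es"
    and D_cong: "w \<in> W \<Longrightarrow> E d e \<Longrightarrow> d \<in> D w \<Longrightarrow> e \<in> D w"
    and model_D: "AxD \<in> L \<Longrightarrow> w \<in> W \<Longrightarrow> \<exists>v. R w v"
    and model_T: "AxT \<in> L \<Longrightarrow> w \<in> W \<Longrightarrow> R w w"
    and model_B: "AxB \<in> L \<Longrightarrow> R w v \<Longrightarrow> R v w"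
    and model_4: "Ax4 \<in> L \<Longrightarrow> R w v \<Longrightarrow> R v u \<Longrightarrow> R w u"
    and model_5: "Ax5 \<in> L \<Longrightarrow> R w v \<Longrightarrow> R w u \<Longrightarrow> R v u"
    and model_CBF: "AxCBF \<in> L \<Longrightarrow> R w v \<Longrightarrow> D w \<subseteq> D v"
    and model_BF: "AxBF \<in> L \<Longrightarrow> R w v \<Longrightarrow> D v \<subseteq> D w"
    and model_UI: "AxUI \<in> L \<Longrightarrow> w \<in> W \<Longrightarrow> D w = U"
begin

lemma rtranclp_W: "R\<^sup>*\<^sup>* w v \<Longrightarrow> w \<in> W \<Longrightarrow> v \<in> W"
  by (induction rule: rtranclp_induct) (auto dest: R_W)

lemma tranclp_4: "Ax4 \<in> L \<Longrightarrow> R\<^sup>+\<^sup>+ w v \<Longrightarrow> R w v"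
  by (rotate_tac, induction rule: tranclp_induct) (auto intro: model_4)

text \<open>The worlds strictly above \<open>r\<close> form a cluster: each of them sees every
  immediate successor of \<open>r\<close>, hence one such successor \<open>c\<close> sees all of
  them, and the Euclidean property at \<open>c\<close> relates any two.\<close>

lemma tranclp_5:
  assumes 5: "Ax5 \<in> L" and a: "R\<^sup>+\<^sup>+ r a" and b: "R\<^sup>+\<^sup>+ r b"
  shows "R a b"
proof -
  obtain c where c: "R r c"
    using a by (meson tranclpD)
  have to_succ: "R a u" if "R r u" "R\<^sup>+\<^sup>+ r a" for a u
    using that(2,1)
  proof (induction rule: tranclp_induct)
    case (base a)
    then show ?case by (rule model_5[OF 5])
  next
    case (step a' a)
    then show ?case using model_5[OF 5] by blast
  qed
  have from_c: "R c a" if "R\<^sup>+\<^sup>+ r a" for a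
    using that
  proof (induction rule: tranclp_induct)
    case (base a)
    then show ?case by (rule model_5[OF 5 c])
  next
    case (step a' a)
    have "R a' c" by (rule to_succ[OF c step.hyps(1)])
    then show ?case using model_5[OF 5] step.hyps(2) by blast
  qed
  show ?thesis
    using model_5[OF 5 from_c[OF a] from_c[OF b]] .
qed

lemma sat_atomic_cong:
  assumes "atomic P" "w \<in> W" "\<And>x. x \<in> fv P \<Longrightarrow> E (g x) (h x)" "sat P g w"
  shows "sat P h w"
proof (cases P)
  case (Pred i xs)
  have "list_all2 E (map g xs) (map h xs)"
    using assms(3) Pred by (simp add: list_all2_conv_all_nth)
  then show ?thesis
    using I_cong[OF assms(2)] assms(4) Pred by auto
next
  case (Eql x y)
  then show ?thesis
    using assms(3)[of x] assms(3)[of y] assms(4) by (auto intro: E_trans E_sym)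
qed (use assms in auto)

text \<open>The successors of \<open>b\<close> lie strictly above \<open>r\<close>, so
  \<open>a\<close> sees all of them. The asymmetry between the two hypotheses is why the first hole
  of \<open>R5\<close> must have positive depth while the second may be at the root.\<close>

lemma sat_5_box:
  assumes 5: "Ax5 \<in> L" and a: "R\<^sup>+\<^sup>+ r a" and b: "R\<^sup>*\<^sup>* r b" and box: "sat (Box A) g a"
  shows "sat (Box A) g b"
proof -
  have "R a v" if "R b v" for v
    using tranclp_5[OF 5 a] that b by (meson rtranclp_into_tranclp1)
  then show ?thesis
    using box by simp
qed

lemma sat_4_box:
  assumes 4: "Ax4 \<in> L" and ab: "R\<^sup>*\<^sup>* a b" and box: "sat (Box A) g a"
  shows "sat (Box A) g b"
proof -
  have "R a v" if "R b v" for v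
    using tranclp_4[OF 4] that ab by (meson rtranclp_into_tranclp1)
  then show ?thesis
    using box by simp
qed

lemma refutes_plug1_mono:
  assumes "has_holes C 1" "refutes (plug C [S]) g w" "w \<in> W"
    and "\<And>v. v \<in> W \<Longrightarrow> refutes S g v \<Longrightarrow> refutes T g v"
  shows "refutes (plug C [T]) g w"
proof -
  obtain \<omega> where \<omega>: "crefutes C g \<omega> w" "refutes S g (\<omega> 0)"
    using assms(1,2) refutes_plug1 by auto
  have "\<omega> 0 \<in> W"
    using rtranclp_W[OF crefutes_holes[OF \<omega>(1)] assms(3)] zero_in_holes[OF assms(1)] by simp
  then show ?thesis
    using \<omega> assms(1,4) refutes_plug1 by auto
qed

lemma refutes_plug2_mono:
  assumes "has_holes C 2" "refutes (plug C [S, T]) g w" "w \<in> W"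
    and "\<And>\<omega>. \<omega> 0 \<in> W \<Longrightarrow> \<omega> 1 \<in> W \<Longrightarrow> crefutes C g \<omega> w \<Longrightarrow> R\<^sup>*\<^sup>* w (\<omega> 1) \<Longrightarrow>
      refutes S g (\<omega> 0) \<Longrightarrow> refutes T g (\<omega> 1) \<Longrightarrow> refutes T' g (\<omega> 1)"
  shows "refutes (plug C [S, T']) g w"
proof -
  obtain \<omega> where \<omega>: "crefutes C g \<omega> w" "refutes S g (\<omega> 0)" "refutes T g (\<omega> 1)"
    using assms(1,2) refutes_plug2 by auto
  have R: "R\<^sup>*\<^sup>* w (\<omega> 0)" "R\<^sup>*\<^sup>* w (\<omega> 1)"
    using crefutes_holes[OF \<omega>(1)] assms(1) by (simp_all add: has_holes_2)
  then have "refutes T' g (\<omega> 1)"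
    using \<omega> assms(4)[of \<omega>] rtranclp_W[OF _ assms(3)] by blast
  then show ?thesis
    using \<omega> assms(1) refutes_plug2 by auto
qed

text \<open>Rules are read backwards, and the refutation stays at the same world. The assignment
  changes only for \<open>RForall\<close>, and it has to stay in \<open>U\<close> because
  \<open>Ref\<close> and \<open>Rui\<close> speak of variables that need not occur in a
  signature.\<close>

lemma rule_sound:
  assumes "rule_inst L Ps ys S" "refutes S g w" "w \<in> W" "range g \<subseteq> U"
  shows "\<exists>P\<in>set Ps. \<exists>g'. range g' \<subseteq> U \<and> refutes P g' w"
proof -
  note mono1 = refutes_plug1_mono[OF _ _ assms(3)]
  note mono2 = refutes_plug2_mono[OF _ _ assms(3)]
  have g_U: "g x \<in> U" for x
    using assms(4) by auto
  have single: "\<exists>P\<in>set [Q]. \<exists>g'. range g' \<subseteq> U \<and> refutes P g' w" if "refutes Q g w" for Q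
    using that assms(4) by auto
  show ?thesis
    using assms(1,2)
  proof (cases rule: rule_inst.cases)
    case (Init C P X \<Gamma> \<Delta>)
    then show ?thesis using assms(2) by (auto simp: refutes_plug1)
  next
    case (LBot C X \<Gamma> \<Delta>)
    then show ?thesis using assms(2) by (auto simp: refutes_plug1)
  next
    case (LImp C X \<Gamma> A \<Delta> B)
    then obtain \<omega> where \<omega>: "crefutes C g \<omega> w"
      "refutes (NS X (add_mset (Imp A B) \<Gamma>) \<Delta> {#}) g (\<omega> 0)"
      using assms(2) refutes_plug1 by auto
    then have "refutes (NS X \<Gamma> (add_mset A \<Delta>) {#}) g (\<omega> 0) \<or>
        refutes (NS X (add_mset B \<Gamma>) \<Delta> {#}) g (\<omega> 0)"
      by auto
    then have "\<exists>P\<in>set Ps. refutes P g w"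
      using \<omega>(1) refutes_plug1 LImp by auto
    then show ?thesis using assms(4) by blast
  next
    case (RImp C X A \<Gamma> B \<Delta>)
    show ?thesis unfolding RImp(1)
      by (rule single, rule mono1[OF _ assms(2)[unfolded RImp(3)]]) (use RImp in auto)
  next
    case (LForall C z X A x \<Gamma> \<Delta>)
    show ?thesis unfolding LForall(1)
      by (rule single, rule mono1[OF _ assms(2)[unfolded LForall(3)]])
        (use LForall in \<open>auto simp: sat_ssubst fun_upd_comp\<close>)
  next
    case (RForall C X \<Gamma> x A \<Delta> y)
    then obtain \<omega> where \<omega>: "crefutes C g \<omega> w"
      "refutes (NS X \<Gamma> (add_mset (Forall x A) \<Delta>) {#}) g (\<omega> 0)"
      using assms(2) refutes_plug1 by auto
    then obtain d where d: "d \<in> D (\<omega> 0)" "\<not> sat A (g(x := d)) (\<omega> 0)"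
      by auto
    \<comment> \<open>The eigenvariable is made to denote the counterexample \<open>d\<close>; being
      fresh for \<open>S\<close>, it does not affect the context.\<close>
    let ?g = "g(y := d)"
    have y: "y \<notin> free_vars S"
      using RForall by simp
    have eq: "g v = ?g v" if "v \<in> free_vars S" for v
      using y that by auto
    have "crefutes C ?g \<omega> w"
      by (rule crefutes_cong_vars[OF _ \<omega>(1)]) (use eq RForall in blast)
    moreover have "refutes (NS (add_mset y X) \<Gamma> (add_mset (A\<langle>y/x\<rangle>) \<Delta>) {#}) ?g (\<omega> 0)"
    proof -
      have sub: "v \<in> free_vars S" if "v \<in> free_vars (NS X \<Gamma> (add_mset (Forall x A) \<Delta>) {#})" for v
        using free_vars_plug[of 0 C "[NS X \<Gamma> (add_mset (Forall x A) \<Delta>) {#}]"] that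
          zero_in_holes[OF RForall(3)] RForall(4)
        by auto
      have "sat B g (\<omega> 0) = sat B ?g (\<omega> 0)" if "B \<in># \<Gamma> + \<Delta>" for B
        by (rule sat_cong, rule eq, rule sub) (use that in \<open>auto simp: free_vars_def\<close>)
      moreover have "y \<notin># X"
        using y sub by (auto simp: free_vars_def)
      moreover have "y \<noteq> x \<Longrightarrow> y \<notin> fv A"
        using y sub by (auto simp: free_vars_def)
      then have "sat A (?g \<circ> id(x := y)) (\<omega> 0) = sat A (g(x := d)) (\<omega> 0)"
        by (intro sat_cong) auto
      ultimately show ?thesis
        using \<omega>(2) d by (auto simp: sat_ssubst)
    qed
    ultimately have "refutes (plug C [NS (add_mset y X) \<Gamma> (add_mset (A\<langle>y/x\<rangle>) \<Delta>) {#}]) ?g w"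
      using refutes_plug1 RForall by blast
    moreover have "\<omega> 0 \<in> W"
      using rtranclp_W[OF crefutes_holes[OF \<omega>(1)] assms(3)] zero_in_holes[OF RForall(3)] by simp
    then have "range ?g \<subseteq> U"
      using d(1) D_U assms(4) by auto
    ultimately show ?thesis
      unfolding RForall(1) by (metis list.set_intros(1))
  next
    case (LBox C X A \<Gamma> \<Delta> Y \<Pi> \<Sigma> K)
    show ?thesis unfolding LBox(1)
      by (rule single, rule mono1[OF _ assms(2)[unfolded LBox(3)]]) (use LBox in auto)
  next
    case (RBox C X \<Gamma> \<Delta> A)
    show ?thesis unfolding RBox(1)
      by (rule single, rule mono1[OF _ assms(2)[unfolded RBox(3)]]) (use RBox in auto)
  next
    case (Ref C X x \<Gamma> \<Delta>)
    show ?thesis unfolding Ref(1)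
      by (rule single, rule mono1[OF _ assms(2)[unfolded Ref(3)]])
        (use Ref E_refl[OF g_U] in auto)
  next
    case (Repl C P X y z x \<Gamma> \<Delta>)
    show ?thesis unfolding Repl(1)
    proof (rule single, rule mono1[OF _ assms(2)[unfolded Repl(3)]])
      fix v
      assume v: "v \<in> W"
        and r: "refutes (NS X (add_mset (Eql x y) (add_mset (P\<langle>x/z\<rangle>) \<Gamma>)) \<Delta> {#}) g v"
      have "sat P (g \<circ> id(z := y)) v"
        by (rule sat_atomic_cong[OF Repl(5) v, of "g \<circ> id(z := x)"])
          (use r E_refl[OF g_U] in \<open>auto simp: sat_ssubst\<close>)
      then show "refutes (NS X (add_mset (P\<langle>y/z\<rangle>) (add_mset (Eql x y)
          (add_mset (P\<langle>x/z\<rangle>) \<Gamma>))) \<Delta> {#}) g v"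
        using r by (simp add: sat_ssubst)
    qed (rule Repl)
  next
    case (ReplX C x y X \<Gamma> \<Delta>)
    show ?thesis unfolding ReplX(1)
      by (rule single, rule mono1[OF _ assms(2)[unfolded ReplX(3)]])
        (use ReplX D_cong in auto)
  next
    case (Rig C X x y \<Gamma> \<Delta> Y \<Pi> \<Sigma>)
    show ?thesis unfolding Rig(1)
      by (rule single, rule mono2[OF _ assms(2)[unfolded Rig(3)]]) (use Rig in auto)
  next
    case (RD C X \<Gamma> \<Delta>)
    show ?thesis unfolding RD(1)
      by (rule single, rule mono1[OF _ assms(2)[unfolded RD(3)]]) (use RD(5) model_D[OF RD(4)] in auto)
  next
    case (RT C X A \<Gamma> \<Delta>)
    show ?thesis unfolding RT(1)
      by (rule single, rule mono1[OF _ assms(2)[unfolded RT(3)]])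
        (use RT(5) model_T[OF RT(4)] in auto)
  next
    case (RB C X A \<Gamma> \<Delta> Y \<Pi> \<Sigma> K)
    show ?thesis unfolding RB(1)
    proof (rule single, rule mono1[OF _ assms(2)[unfolded RB(3)]])
      fix v
      assume r: "refutes (NS X \<Gamma> \<Delta> {# NS Y (add_mset (Box A) \<Pi>) \<Sigma> K #}) g v"
      then obtain u where "R v u" "sat (Box A) g u"
        by auto
      then have "sat A g v"
        using model_B[OF RB(4)] by simp
      with r show "refutes (NS X (add_mset A \<Gamma>) \<Delta> {# NS Y (add_mset (Box A) \<Pi>) \<Sigma> K #}) g v"
        by simp
    qed (rule RB)
  next
    case (R4 C X A \<Gamma> \<Delta> Y \<Pi> \<Sigma> K)
    show ?thesis unfolding R4(1)
      by (rule single, rule mono1[OF _ assms(2)[unfolded R4(3)]], rule R4, simp)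
        (use model_4[OF R4(4)] in blast)
  next
    case (R5 C X A \<Gamma> \<Delta> Y \<Pi> \<Sigma>)
    show ?thesis unfolding R5(1)
    proof (rule single, rule mono2[OF _ assms(2)[unfolded R5(3)]])
      fix \<omega>
      assume "crefutes C g \<omega> w" "R\<^sup>*\<^sup>* w (\<omega> 1)"
        and r: "refutes (NS X (add_mset (Box A) \<Gamma>) \<Delta> {#}) g (\<omega> 0)"
          "refutes (NS Y \<Pi> \<Sigma> {#}) g (\<omega> 1)"
      then have "sat (Box A) g (\<omega> 1)"
        using sat_5_box[OF R5(4) crefutes_depth_ge1[OF R5(6)]] by auto
      then show "refutes (NS Y (add_mset (Box A) \<Pi>) \<Sigma> {#}) g (\<omega> 1)"
        using r by auto
    qed (rule R5)
  next
    case (Rcbf C x X \<Gamma> \<Delta> Y \<Pi> \<Sigma> K)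
    show ?thesis unfolding Rcbf(1)
      by (rule single, rule mono1[OF _ assms(2)[unfolded Rcbf(3)]], rule Rcbf, simp)
        (use model_CBF[OF Rcbf(4)] in blast)
  next
    case (Rbf C x X \<Gamma> \<Delta> Y \<Pi> \<Sigma> K)
    show ?thesis unfolding Rbf(1)
      by (rule single, rule mono1[OF _ assms(2)[unfolded Rbf(3)]], rule Rbf, simp)
        (use model_BF[OF Rbf(4)] in blast)
  next
    case (Rui C x X \<Gamma> \<Delta>)
    show ?thesis unfolding Rui(1)
      by (rule single, rule mono1[OF _ assms(2)[unfolded Rui(3)]])
        (use Rui model_UI g_U in auto)
  next
    case (R5dom C x X \<Gamma> \<Delta> Y \<Pi> \<Sigma>)
    show ?thesis unfolding R5dom(1)
    proof (rule single, rule mono2[OF _ assms(2)[unfolded R5dom(3)]])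
      fix \<omega>
      assume \<omega>: "crefutes C g \<omega> w"
        and r: "refutes (NS (add_mset x X) \<Gamma> \<Delta> {#}) g (\<omega> 0)"
          "refutes (NS Y \<Pi> \<Sigma> {#}) g (\<omega> 1)"
      have "R\<^sup>+\<^sup>+ w (\<omega> 0)" "R\<^sup>+\<^sup>+ w (\<omega> 1)"
        using crefutes_depth_ge1[OF _ \<omega>] R5dom by blast+
      \<comment> \<open>Both nodes lie off the root and hence see each other, so either of the two
        domain conditions gives the inclusion in the needed direction.\<close>
      then have "R (\<omega> 0) (\<omega> 1)" "R (\<omega> 1) (\<omega> 0)"
        using tranclp_5[OF R5dom(4)] by blast+
      then have "D (\<omega> 0) \<subseteq> D (\<omega> 1)"
        using R5dom(5) model_CBF model_BF by blast
      then show "refutes (NS (add_mset x Y) \<Pi> \<Sigma> {#}) g (\<omega> 1)"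
        using r by auto
    qed (rule R5dom)
  qed
qed

lemma derivation_sound:
  assumes "derivation PS L ys S" "w \<in> W" "range g \<subseteq> U"
  shows "\<not> refutes S g w"
  using assms(1,3)
proof (induction arbitrary: g rule: derivation.induct)
  case (step Ps ys S yss)
  show ?case
  proof
    assume "refutes S g w"
    then obtain P g' where "P \<in> set Ps" "range g' \<subseteq> U" "refutes P g' w"
      using rule_sound[OF step.hyps(1) _ assms(2) step.prems] by blast
    moreover from \<open>P \<in> set Ps\<close> have "\<forall>g. range g \<subseteq> U \<longrightarrow> \<not> refutes P g w"
      using step.IH by (auto simp: list_all2_conv_all_nth in_set_conv_nth)
    ultimately show False by blast
  qed
qed

lemma derivable_sound:
  assumes "derivable PS L S" "w \<in> W" "range g \<subseteq> U"
  shows "\<not> refutes S g w"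
proof -
  obtain S' ys where "alphabetical_variant S S'" "derivation PS L ys S'"
    using assms(1) unfolding derivable_def by blast
  moreover have "refutes S' g w" if "refutes S g w"
    using refutes_alpha[OF alphabetical_variant_sym that] calculation(1) by blast
  ultimately show ?thesis
    using derivation_sound assms by blast
qed

text \<open>The cut formula is either true or false at the world of the hole, and the refutation
  carries over to the corresponding premiss.\<close>

lemma Cut_sound:
  assumes "([P, Q], S) \<in> Cut" "refutes S g w"
  shows "refutes P g w \<or> refutes Q g w"
proof -
  obtain C X \<Gamma> \<Delta> A where C: "has_holes C 1" and
    PQ: "P = plug C [NS X \<Gamma> (add_mset A \<Delta>) {#}]" "Q = plug C [NS X (add_mset A \<Gamma>) \<Delta> {#}]"
    and S: "S = plug C [NS X \<Gamma> \<Delta> {#}]"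
    using assms(1) unfolding Cut_def by blast
  obtain \<omega> where "crefutes C g \<omega> w" "refutes (NS X \<Gamma> \<Delta> {#}) g (\<omega> 0)"
    using assms(2) unfolding S refutes_plug1[OF C] by blast
  then show ?thesis
    unfolding PQ refutes_plug1[OF C] by auto
qed

text \<open>If the boxed formula fails at the world of the first hole, the left premiss is refuted.
  If it holds there, the side conditions are what carries it to the worlds of the other holes, and
  the right premiss is refuted.\<close>

lemma LCut_sound:
  assumes "([P, Q], S) \<in> LCut L" "refutes S g w"
  shows "refutes P g w \<or> refutes Q g w"
proof -
  obtain C X \<Gamma> \<Delta> A n Y \<Pi> \<Sigma> where
    C: "has_holes C (Suc n)" and side: "LCut_side L n C" and
    P: "P = plug C (NS X \<Gamma> (add_mset (Box A) \<Delta>) {#} #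
          map (\<lambda>i. NS (Y i) (\<Pi> i) (\<Sigma> i) {#}) [1..<Suc n])" and
    Q: "Q = plug C (NS X (add_mset (Box A) \<Gamma>) \<Delta> {#} #
          map (\<lambda>i. NS (Y i) (add_mset (Box A) (\<Pi> i)) (\<Sigma> i) {#}) [1..<Suc n])" and
    S: "S = plug C (NS X \<Gamma> \<Delta> {#} # map (\<lambda>i. NS (Y i) (\<Pi> i) (\<Sigma> i) {#}) [1..<Suc n])"
    using assms(1) unfolding LCut_def by blast
  have plug: "refutes (plug C (N # map f [1..<Suc n])) g w \<longleftrightarrow>
      (\<exists>\<omega>. crefutes C g \<omega> w \<and> refutes N g (\<omega> 0) \<and> (\<forall>i\<in>{1..n}. refutes (f i) g (\<omega> i)))" for N f
  proof -
    have "(\<forall>h\<in>#holes C. refutes ((N # map f [1..<Suc n]) ! h) g (\<omega> h)) \<longleftrightarrow>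
        refutes N g (\<omega> 0) \<and> (\<forall>i\<in>{1..n}. refutes (f i) g (\<omega> i))" for \<omega>
    proof -
      have "set_mset (holes C) = insert 0 {1..n}"
        unfolding set_mset_holes[OF C] by auto
      moreover have "(N # map f [1..<Suc n]) ! i = f i" if "i \<in> {1..n}" for i
        using that by (cases i) (simp_all del: upt_Suc)
      ultimately show ?thesis
        by (simp del: upt_Suc)
    qed
    then show ?thesis
      by (simp only: refutes_plug[OF count_holes[OF C]])
  qed
  obtain \<omega> where \<omega>: "crefutes C g \<omega> w" "refutes (NS X \<Gamma> \<Delta> {#}) g (\<omega> 0)"
    "\<forall>i\<in>{1..n}. refutes (NS (Y i) (\<Pi> i) (\<Sigma> i) {#}) g (\<omega> i)"
    using assms(2) unfolding S plug by blast
  show ?thesis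
  proof (cases "sat (Box A) g (\<omega> 0)")
    case False
    then have "refutes P g w"
      unfolding P plug using \<omega> by auto
    then show ?thesis ..
  next
    case True
    have reach: "R\<^sup>*\<^sup>* w (\<omega> i)" if "i \<in> {0..n}" for i
      using crefutes_holes[OF \<omega>(1)] set_mset_holes[OF C] that by auto
    have box: "sat (Box A) g (\<omega> i)" if i: "i \<in> {1..n}" for i
    proof (cases "Ax5 \<in> L")
      case 5: True
      show ?thesis
      proof (cases "R\<^sup>+\<^sup>+ w (\<omega> 0)")
        case True
        then show ?thesis
          using sat_5_box[OF 5 _ _ \<open>sat (Box A) g (\<omega> 0)\<close>] reach i by auto
      next
        case False
        \<comment> \<open>Without a strict path the first hole is interpreted at \<open>w\<close>
          itself; the side condition then yields \<open>Ax4\<close>, and transitivity takes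
          over.\<close>
        then have "\<omega> 0 = w"
          using reach[of 0] by (auto dest: rtranclpD)
        moreover have "Ax4 \<in> L"
          using False side 5 crefutes_depth_ge1[OF _ \<omega>(1)] unfolding LCut_side_def by blast
        ultimately show ?thesis
          using sat_4_box[OF _ _ \<open>sat (Box A) g (\<omega> 0)\<close>] reach i by auto
      qed
    next
      case False
      with side i have 4: "Ax4 \<in> L" "hole_at_or_below C 0 i"
        unfolding LCut_side_def by auto
      then show ?thesis
        using sat_4_box[OF 4(1) _ True] crefutes_at_or_below[OF 4(2) \<omega>(1)] by blast
    qed
    have "refutes Q g w"
      unfolding Q plug using \<omega> True box by (intro exI[of _ \<omega>]) auto
    then show ?thesis ..
  qed
qed

end

subsection \<open>Positions in nested sequents\<close>

type_synonym pos = "nat list"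

text \<open>The children of a nested sequent form a multiset, so its nodes have no addresses. A
  shape fixes an order of the children, which \<open>ns\<close> forgets again; positions then stay
  meaningful while the sequent grows.\<close>

datatype shape = Shape "shape list"

lemma size_nth_shape: "i < length ks \<Longrightarrow> size (ks ! i) < Suc (size_list size ks)"
  using size_list_estimation'[of "ks ! i" ks "size (ks ! i)" size] by simp

function nodes :: "shape \<Rightarrow> pos set" where
  "nodes (Shape ks) = insert [] (\<Union>i<length ks. (#) i ` nodes (ks ! i))"
  by pat_completeness auto
termination
  by (relation "measure size") (auto simp: size_nth_shape)

text \<open>The labels of a tree are total functions; their values outside of the tree are junk.\<close>

function ns :: "shape \<Rightarrow> (pos \<Rightarrow> var multiset) \<Rightarrow> (pos \<Rightarrow> 'p fm multiset) \<Rightarrow> (pos \<Rightarrow> 'p fm multiset) \<Rightarrow>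
    'p nsequent" where
  "ns (Shape ks) X \<Gamma> \<Delta> = NS (X []) (\<Gamma> []) (\<Delta> [])
     (image_mset (\<lambda>i. ns (ks ! i) (\<lambda>p. X (i # p)) (\<lambda>p. \<Gamma> (i # p)) (\<lambda>p. \<Delta> (i # p)))
       (mset_set {..<length ks}))"
  by pat_completeness auto
termination
  by (relation "measure (\<lambda>(s, _). size s)") (auto simp: size_nth_shape)

function ctx_of :: "shape \<Rightarrow> (pos \<Rightarrow> var multiset) \<Rightarrow> (pos \<Rightarrow> 'p fm multiset) \<Rightarrow>
    (pos \<Rightarrow> 'p fm multiset) \<Rightarrow> (pos \<Rightarrow> nat multiset) \<Rightarrow> 'p ctx" where
  "ctx_of (Shape ks) X \<Gamma> \<Delta> H = Ctx (X []) (\<Gamma> []) (\<Delta> []) (H [])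
     (image_mset (\<lambda>i. ctx_of (ks ! i) (\<lambda>p. X (i # p)) (\<lambda>p. \<Gamma> (i # p)) (\<lambda>p. \<Delta> (i # p)) (\<lambda>p. H (i # p)))
       (mset_set {..<length ks}))"
  by pat_completeness auto
termination
  by (relation "measure (\<lambda>(s, _). size s)") (auto simp: size_nth_shape)

lemma Nil_in_nodes [simp]: "[] \<in> nodes s"
  by (cases s) simp

lemma Cons_in_nodes [simp]: "i # p \<in> nodes (Shape ks) \<longleftrightarrow> i < length ks \<and> p \<in> nodes (ks ! i)"
  by auto

declare nodes.simps [simp del]

lemma finite_nodes [simp]: "finite (nodes s)"
  by (induction s) (auto simp: nodes.simps)

lemma append_in_nodes: "p @ q \<in> nodes s \<Longrightarrow> p \<in> nodes s"
proof (induction p arbitrary: s)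
  case (Cons i p)
  then show ?case by (cases s) auto
qed auto

lemma ns_cong:
  "(\<And>p. p \<in> nodes s \<Longrightarrow> X p = X' p \<and> \<Gamma> p = \<Gamma>' p \<and> \<Delta> p = \<Delta>' p) \<Longrightarrow> ns s X \<Gamma> \<Delta> = ns s X' \<Gamma>' \<Delta>'"
proof (induction s X \<Gamma> \<Delta> arbitrary: X' \<Gamma>' \<Delta>' rule: ns.induct)
  case (1 ks X \<Gamma> \<Delta>)
  have "ns (ks ! i) (\<lambda>p. X (i # p)) (\<lambda>p. \<Gamma> (i # p)) (\<lambda>p. \<Delta> (i # p)) =
      ns (ks ! i) (\<lambda>p. X' (i # p)) (\<lambda>p. \<Gamma>' (i # p)) (\<lambda>p. \<Delta>' (i # p))" if "i < length ks" for i
    by (rule 1(1)) (use that 1(2) in auto)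
  then show ?case
    using 1(2)[of "[]"] by (auto intro!: image_mset_cong)
qed

lemma fms_ns: "fms (ns s X \<Gamma> \<Delta>) = (\<Union>p\<in>nodes s. set_mset (\<Gamma> p) \<union> set_mset (\<Delta> p))"
proof (induction s X \<Gamma> \<Delta> rule: ns.induct)
  case (1 ks X \<Gamma> \<Delta>)
  then show ?case
    by (simp add: nodes.simps)
qed

lemma sigvars_ns: "sigvars (ns s X \<Gamma> \<Delta>) = (\<Union>p\<in>nodes s. set_mset (X p))"
proof (induction s X \<Gamma> \<Delta> rule: ns.induct)
  case (1 ks X \<Gamma> \<Delta>)
  then show ?case
    by (simp add: nodes.simps)
qed

lemma ns_surj: "\<exists>s X \<Gamma> \<Delta>. ns s X \<Gamma> \<Delta> = S"
proof (induction S)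
  case (NS X0 \<Gamma>0 \<Delta>0 K)
  then obtain s X \<Gamma> \<Delta> where *: "\<And>k. k \<in># K \<Longrightarrow> ns (s k) (X k) (\<Gamma> k) (\<Delta> k) = k"
    by metis
  obtain ks where ks: "mset ks = K"
    using ex_mset by blast
  let ?X = "\<lambda>p. case p of [] \<Rightarrow> X0 | i # q \<Rightarrow> X (ks ! i) q"
  let ?\<Gamma> = "\<lambda>p. case p of [] \<Rightarrow> \<Gamma>0 | i # q \<Rightarrow> \<Gamma> (ks ! i) q"
  let ?\<Delta> = "\<lambda>p. case p of [] \<Rightarrow> \<Delta>0 | i # q \<Rightarrow> \<Delta> (ks ! i) q"
  have "image_mset (\<lambda>i. ns (map s ks ! i) (X (ks ! i)) (\<Gamma> (ks ! i)) (\<Delta> (ks ! i))) (mset_set {..<length ks})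
      = image_mset (\<lambda>i. ks ! i) (mset_set {..<length ks})"
    by (rule image_mset_cong) (use *[OF nth_mem_mset[of _ ks, unfolded ks]] in simp)
  also have "\<dots> = mset (map ((!) ks) [0..<length ks])"
    by (simp add: lessThan_atLeast0)
  also have "\<dots> = K"
    by (simp add: map_nth ks)
  finally have "ns (Shape (map s ks)) ?X ?\<Gamma> ?\<Delta> = NS X0 \<Gamma>0 \<Delta>0 K"
    by simp
  then show ?case by blast
qed

lemma sum_nodes:
  fixes f :: "pos \<Rightarrow> 'a :: comm_monoid_add"
  shows "(\<Sum>p\<in>nodes (Shape ks). f p) = f [] + (\<Sum>i<length ks. \<Sum>p\<in>nodes (ks ! i). f (i # p))"
proof -
  have "(\<Sum>p\<in>(\<Union>i<length ks. (#) i ` nodes (ks ! i)). f p)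
      = (\<Sum>i<length ks. \<Sum>p\<in>(#) i ` nodes (ks ! i). f p)"
    by (rule sum.UNION_disjoint) auto
  also have "\<dots> = (\<Sum>i<length ks. \<Sum>p\<in>nodes (ks ! i). f (i # p))"
    by (simp add: sum.reindex)
  finally show ?thesis
    by (subst nodes.simps, subst sum.insert) auto
qed

lemma holes_ctx_of: "holes (ctx_of s X \<Gamma> \<Delta> H) = (\<Sum>p\<in>nodes s. H p)"
proof (induction s X \<Gamma> \<Delta> H rule: ctx_of.induct)
  case (1 ks X \<Gamma> \<Delta> H)
  have "(\<Sum>\<^sub># (image_mset holes (image_mset
      (\<lambda>i. ctx_of (ks ! i) (\<lambda>p. X (i # p)) (\<lambda>p. \<Gamma> (i # p)) (\<lambda>p. \<Delta> (i # p)) (\<lambda>p. H (i # p)))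
        (mset_set {..<length ks})))) = (\<Sum>i<length ks. \<Sum>p\<in>nodes (ks ! i). H (i # p))"
    using 1 by (simp add: image_mset.compositionality comp_def flip: sum_unfold_sum_mset)
  then show ?case
    by (simp add: sum_nodes)
qed

lemma sum_mset_leaves:
  "(\<Sum>h\<in>#H. NS (x h) (g h) (d h) {#}) = NS (\<Sum>h\<in>#H. x h) (\<Sum>h\<in>#H. g h) (\<Sum>h\<in>#H. d h) {#}"
  by (induction H) (auto simp: zero_nseq_def)

text \<open>Only leaves are plugged here, so plugging changes labels but not the tree. Rules that
  display or create a child need separate contexts.\<close>

lemma plug_ctx_of:
  "(\<And>p h. h \<in># H p \<Longrightarrow> Ss ! h = NS (x h) (g h) (d h) {#}) \<Longrightarrow>
    plug (ctx_of s X \<Gamma> \<Delta> H) Ss =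
      ns s (\<lambda>p. X p + (\<Sum>h\<in>#H p. x h)) (\<lambda>p. \<Gamma> p + (\<Sum>h\<in>#H p. g h)) (\<lambda>p. \<Delta> p + (\<Sum>h\<in>#H p. d h))"
proof (induction s X \<Gamma> \<Delta> H rule: ctx_of.induct)
  case (1 ks X \<Gamma> \<Delta> H)
  have root: "(\<Sum>h\<in>#H []. Ss ! h) = (\<Sum>h\<in>#H []. NS (x h) (g h) (d h) {#})"
    by (rule arg_cong[where f = sum_mset], rule image_mset_cong) (use 1(2) in auto)
  have kids: "plug (ctx_of (ks ! i) (\<lambda>p. X (i # p)) (\<lambda>p. \<Gamma> (i # p)) (\<lambda>p. \<Delta> (i # p)) (\<lambda>p. H (i # p))) Ss =
      ns (ks ! i) (\<lambda>p. X (i # p) + (\<Sum>h\<in>#H (i # p). x h))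
        (\<lambda>p. \<Gamma> (i # p) + (\<Sum>h\<in>#H (i # p). g h)) (\<lambda>p. \<Delta> (i # p) + (\<Sum>h\<in>#H (i # p). d h))"
    if "i < length ks" for i
    by (rule 1(1)) (use that 1(2) in auto)
  show ?case
    using kids
    by (auto simp: root sum_mset_leaves image_mset.compositionality comp_def intro!: image_mset_cong)
qed

lemma node_at_ctx_of:
  "p \<in> nodes s \<Longrightarrow> \<exists>N. node_at (ctx_of s X \<Gamma> \<Delta> H) (length p) N \<and> holes_here N = H p"
proof (induction p arbitrary: s X \<Gamma> \<Delta> H)
  case Nil
  have "holes_here (ctx_of s X \<Gamma> \<Delta> H) = H []"
    by (cases s) simp
  then show ?case
    using node_at.root by fastforce
next
  case (Cons i p)
  obtain ks where s: "s = Shape ks" by (cases s)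
  have i: "i < length ks" "p \<in> nodes (ks ! i)"
    using Cons.prems by (auto simp: s)
  let ?C = "ctx_of (ks ! i) (\<lambda>p. X (i # p)) (\<lambda>p. \<Gamma> (i # p)) (\<lambda>p. \<Delta> (i # p)) (\<lambda>p. H (i # p))"
  obtain N where "node_at ?C (length p) N" "holes_here N = H (i # p)"
    using Cons.IH[OF i(2)] by blast
  moreover have "?C \<in># subctxs (ctx_of s X \<Gamma> \<Delta> H)"
    using i(1) by (auto simp: s)
  ultimately show ?case
    using node_at.child by fastforce
qed

text \<open>The labels are sums because the two holes may be at the same node.\<close>

lemma two_holes_exist:
  assumes "p \<in> nodes s" "q \<in> nodes s"
  obtains C where "has_holes C 2" "p \<noteq> [] \<Longrightarrow> hole_depth_ge1 C 0" "q \<noteq> [] \<Longrightarrow> hole_depth_ge1 C 1"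
    "\<And>x g d x' g' d'. plug C [NS x g d {#}, NS x' g' d' {#}] =
      ns s (\<lambda>r. X r + (if r = p then x else {#}) + (if r = q then x' else {#}))
        (\<lambda>r. \<Gamma> r + (if r = p then g else {#}) + (if r = q then g' else {#}))
        (\<lambda>r. \<Delta> r + (if r = p then d else {#}) + (if r = q then d' else {#}))"
proof
  let ?H = "\<lambda>r. (if r = p then {#0#} else {#}) + (if r = q then {#1#} else {#}) :: nat multiset"
  let ?C = "ctx_of s X \<Gamma> \<Delta> ?H"
  show "has_holes ?C 2"
    unfolding has_holes_2 holes_ctx_of sum.distrib using assms by (simp)
  show "hole_depth_ge1 ?C 0" if "p \<noteq> []"
  proof -
    obtain N where "node_at ?C (length p) N" "holes_here N = ?H p"
      using node_at_ctx_of[OF assms(1)] by blast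
    then show ?thesis
      unfolding hole_depth_ge1_def
      by (intro exI[of _ "length p"] exI[of _ N]) (use that in \<open>auto simp: Suc_le_eq\<close>)
  qed
  show "hole_depth_ge1 ?C 1" if "q \<noteq> []"
  proof -
    obtain N where "node_at ?C (length q) N" "holes_here N = ?H q"
      using node_at_ctx_of[OF assms(2)] by blast
    then show ?thesis
      unfolding hole_depth_ge1_def
      by (intro exI[of _ "length q"] exI[of _ N]) (use that in \<open>auto simp: Suc_le_eq\<close>)
  qed
  show "plug ?C [NS x g d {#}, NS x' g' d' {#}] =
      ns s (\<lambda>r. X r + (if r = p then x else {#}) + (if r = q then x' else {#}))
        (\<lambda>r. \<Gamma> r + (if r = p then g else {#}) + (if r = q then g' else {#}))
        (\<lambda>r. \<Delta> r + (if r = p then d else {#}) + (if r = q then d' else {#}))" for x g d x' g' d'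
  proof -
    let ?sel = "\<lambda>a b h :: nat. if h = 0 then a else b"
    have "plug ?C [NS x g d {#}, NS x' g' d' {#}] =
        ns s (\<lambda>r. X r + (\<Sum>h\<in>#?H r. ?sel x x' h)) (\<lambda>r. \<Gamma> r + (\<Sum>h\<in>#?H r. ?sel g g' h))
          (\<lambda>r. \<Delta> r + (\<Sum>h\<in>#?H r. ?sel d d' h))"
      by (rule plug_ctx_of) (auto split: if_splits)
    also have "\<dots> = ns s (\<lambda>r. X r + (if r = p then x else {#}) + (if r = q then x' else {#}))
        (\<lambda>r. \<Gamma> r + (if r = p then g else {#}) + (if r = q then g' else {#}))
        (\<lambda>r. \<Delta> r + (if r = p then d else {#}) + (if r = q then d' else {#}))"
      by (rule ns_cong) (simp add: add.assoc)
    finally show ?thesis .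
  qed
qed

lemma one_hole_exists:
  assumes "p \<in> nodes s"
  obtains C where "has_holes C 1"
    "\<And>x g d. plug C [NS x g d {#}] = ns s (X(p := x)) (\<Gamma>(p := g)) (\<Delta>(p := d))"
proof
  let ?H = "\<lambda>r. (if r = p then {#0#} else {#}) :: nat multiset"
  let ?C = "ctx_of s (X(p := {#})) (\<Gamma>(p := {#})) (\<Delta>(p := {#})) ?H"
  show "has_holes ?C 1"
    unfolding has_holes_1 holes_ctx_of using assms by (simp)
  show "plug ?C [NS x g d {#}] = ns s (X(p := x)) (\<Gamma>(p := g)) (\<Delta>(p := d))" for x g d
  proof -
    have "plug ?C [NS x g d {#}] =
        ns s (\<lambda>r. (X(p := {#})) r + (\<Sum>h\<in>#?H r. x)) (\<lambda>r. (\<Gamma>(p := {#})) r + (\<Sum>h\<in>#?H r. g))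
          (\<lambda>r. (\<Delta>(p := {#})) r + (\<Sum>h\<in>#?H r. d))"
      by (rule plug_ctx_of) (auto split: if_splits)
    also have "\<dots> = ns s (X(p := x)) (\<Gamma>(p := g)) (\<Delta>(p := d))"
      by (rule ns_cong) simp
    finally show ?thesis .
  qed
qed

lemma ns_split:
  assumes "j < length ks"
  shows "ns (Shape ks) X \<Gamma> \<Delta> = NS (X []) (\<Gamma> []) (\<Delta> [])
     (add_mset (ns (ks ! j) (\<lambda>p. X (j # p)) (\<lambda>p. \<Gamma> (j # p)) (\<lambda>p. \<Delta> (j # p)))
       (image_mset (\<lambda>i. ns (ks ! i) (\<lambda>p. X (i # p)) (\<lambda>p. \<Gamma> (i # p)) (\<lambda>p. \<Delta> (i # p)))
         (mset_set ({..<length ks} - {j}))))"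
proof -
  have "mset_set {..<length ks} = add_mset j (mset_set ({..<length ks} - {j}))"
    using assms by (simp add: mset_set.remove)
  then show ?thesis by simp
qed

text \<open>Moves a context one level down below a new root, the siblings being turned into contexts
  without holes. This is the inductive step for holes at deeper positions.\<close>

lemma one_hole_lift:
  assumes "has_holes C 1"
  obtains C' where "has_holes C' 1"
    "\<And>S. plug C' [S] = NS X \<Gamma> \<Delta> (add_mset (plug C [S])
      (image_mset (\<lambda>i. ns (s i) (f i) (g i) (h i)) M))"
proof
  let ?C = "Ctx X \<Gamma> \<Delta> {#} (add_mset C (image_mset (\<lambda>i. ctx_of (s i) (f i) (g i) (h i) (\<lambda>_. {#})) M))"
  have "\<Sum>\<^sub># (image_mset holes (image_mset (\<lambda>i. ctx_of (s i) (f i) (g i) (h i) (\<lambda>_. {#})) M)) = {#}"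
    by (induction M) (auto simp: holes_ctx_of)
  then show "has_holes ?C 1"
    using assms unfolding has_holes_1 by simp
  have "plug (ctx_of (s i) (f i) (g i) (h i) (\<lambda>_. {#})) Ss = ns (s i) (f i) (g i) (h i)" for i Ss
    using plug_ctx_of[where H = "\<lambda>_. {#}"] by simp
  then show "plug ?C [S] = NS X \<Gamma> \<Delta> (add_mset (plug C [S])
      (image_mset (\<lambda>i. ns (s i) (f i) (g i) (h i)) M))" for S
    by (simp add: image_mset.compositionality comp_def)
qed

text \<open>One context \<open>C\<close> and one multiset \<open>K\<close> of further children must
  serve premiss and conclusion alike, so both are chosen before the labels, which may vary at the
  two displayed nodes only.\<close>

lemma parent_child_hole_exists:
  assumes "p @ [i] \<in> nodes s"
  shows "\<exists>C K. has_holes C 1 \<and>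
    (\<forall>X' \<Gamma>' \<Delta>'. (\<forall>r. r \<noteq> p \<longrightarrow> r \<noteq> p @ [i] \<longrightarrow> X' r = X r \<and> \<Gamma>' r = \<Gamma> r \<and> \<Delta>' r = \<Delta> r) \<longrightarrow>
      ns s X' \<Gamma>' \<Delta>' = plug C [NS (X' p) (\<Gamma>' p) (\<Delta>' p)
        {# NS (X' (p @ [i])) (\<Gamma>' (p @ [i])) (\<Delta>' (p @ [i])) K #}])"
  using assms
proof (induction p arbitrary: s X \<Gamma> \<Delta>)
  case Nil
  obtain ks where s: "s = Shape ks" by (cases s)
  obtain ks' where ks': "ks ! i = Shape ks'" by (cases "ks ! i")
  have i: "i < length ks"
    using Nil by (simp add: s)
  let ?M = "image_mset (\<lambda>j. ctx_of (ks ! j) (\<lambda>p. X (j # p)) (\<lambda>p. \<Gamma> (j # p)) (\<lambda>p. \<Delta> (j # p)) (\<lambda>_. {#}))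
      (mset_set ({..<length ks} - {i}))"
  let ?C = "Ctx {#} {#} {#} {#0#} ?M"
  let ?K = "image_mset (\<lambda>j. ns (ks' ! j) (\<lambda>p. X (i # j # p)) (\<lambda>p. \<Gamma> (i # j # p)) (\<lambda>p. \<Delta> (i # j # p)))
      (mset_set {..<length ks'})"
  have "\<Sum>\<^sub># (image_mset holes ?M) = {#}"
    by (simp add: image_mset.compositionality comp_def holes_ctx_of)
  then have C: "has_holes ?C 1"
    unfolding has_holes_1 by simp
  have hf: "plug (ctx_of s X \<Gamma> \<Delta> (\<lambda>_. {#})) Ss = ns s X \<Gamma> \<Delta>" for s X \<Gamma> \<Delta> Ss
    using plug_ctx_of[where H = "\<lambda>_. {#}"] by simp
  have "ns s X' \<Gamma>' \<Delta>' = plug ?C [NS (X' []) (\<Gamma>' []) (\<Delta>' []) {# NS (X' [i]) (\<Gamma>' [i]) (\<Delta>' [i]) ?K #}]"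
    if *: "\<forall>r. r \<noteq> [] \<longrightarrow> r \<noteq> [i] \<longrightarrow> X' r = X r \<and> \<Gamma>' r = \<Gamma> r \<and> \<Delta>' r = \<Delta> r" for X' \<Gamma>' \<Delta>'
  proof -
    have "ns (ks ! j) (\<lambda>p. X' (j # p)) (\<lambda>p. \<Gamma>' (j # p)) (\<lambda>p. \<Delta>' (j # p)) =
        ns (ks ! j) (\<lambda>p. X (j # p)) (\<lambda>p. \<Gamma> (j # p)) (\<lambda>p. \<Delta> (j # p))" if "j \<noteq> i" for j
      using * that by simp
    then have "image_mset (\<lambda>j. ns (ks ! j) (\<lambda>p. X' (j # p)) (\<lambda>p. \<Gamma>' (j # p)) (\<lambda>p. \<Delta>' (j # p)))
          (mset_set ({..<length ks} - {i})) = image_mset (\<lambda>C. plug C Ss) ?M" for Ss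
      by (auto simp: image_mset.compositionality comp_def hf intro!: image_mset_cong)
    moreover have "ns (ks ! i) (\<lambda>p. X' (i # p)) (\<lambda>p. \<Gamma>' (i # p)) (\<lambda>p. \<Delta>' (i # p)) =
        NS (X' [i]) (\<Gamma>' [i]) (\<Delta>' [i]) ?K"
      using * by (simp add: ks')
    ultimately show ?thesis
      unfolding s ns_split[OF i] by simp
  qed
  then show ?case
    using C by (intro exI[of _ ?C] exI[of _ ?K]) simp
next
  case (Cons j p)
  obtain ks where s: "s = Shape ks" by (cases s)
  have j: "j < length ks" "p @ [i] \<in> nodes (ks ! j)"
    using Cons.prems by (simp_all add: s)
  obtain C K where C: "has_holes C 1" and plug:
    "\<forall>X' \<Gamma>' \<Delta>'. (\<forall>r. r \<noteq> p \<longrightarrow> r \<noteq> p @ [i] \<longrightarrow> X' r = X (j # r) \<and> \<Gamma>' r = \<Gamma> (j # r) \<and> \<Delta>' r = \<Delta> (j # r)) \<longrightarrow>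
      ns (ks ! j) X' \<Gamma>' \<Delta>' = plug C [NS (X' p) (\<Gamma>' p) (\<Delta>' p)
        {# NS (X' (p @ [i])) (\<Gamma>' (p @ [i])) (\<Delta>' (p @ [i])) K #}]"
    using Cons.IH[OF j(2), of "\<lambda>r. X (j # r)" "\<lambda>r. \<Gamma> (j # r)" "\<lambda>r. \<Delta> (j # r)"]
    by (elim exE conjE) (rule that)
  obtain C' where C': "has_holes C' 1" and plug':
    "\<And>S. plug C' [S] = NS (X []) (\<Gamma> []) (\<Delta> []) (add_mset (plug C [S])
      (image_mset (\<lambda>i. ns (ks ! i) (\<lambda>p. X (i # p)) (\<lambda>p. \<Gamma> (i # p)) (\<lambda>p. \<Delta> (i # p)))
         (mset_set ({..<length ks} - {j}))))"
    by (rule one_hole_lift[OF C, where X = "X []" and \<Gamma> = "\<Gamma> []" and \<Delta> = "\<Delta> []" and s = "(!) ks"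
          and f = "\<lambda>i p. X (i # p)" and g = "\<lambda>i p. \<Gamma> (i # p)" and h = "\<lambda>i p. \<Delta> (i # p)"
          and M = "mset_set ({..<length ks} - {j})"]) (rule that)
  have "ns s X' \<Gamma>' \<Delta>' = plug C' [NS (X' (j # p)) (\<Gamma>' (j # p)) (\<Delta>' (j # p))
        {# NS (X' (j # p @ [i])) (\<Gamma>' (j # p @ [i])) (\<Delta>' (j # p @ [i])) K #}]"
    if *: "\<forall>r. r \<noteq> j # p \<longrightarrow> r \<noteq> j # p @ [i] \<longrightarrow> X' r = X r \<and> \<Gamma>' r = \<Gamma> r \<and> \<Delta>' r = \<Delta> r" for X' \<Gamma>' \<Delta>'
  proof -
    have "ns (ks ! k) (\<lambda>p. X' (k # p)) (\<lambda>p. \<Gamma>' (k # p)) (\<lambda>p. \<Delta>' (k # p)) =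
        ns (ks ! k) (\<lambda>p. X (k # p)) (\<lambda>p. \<Gamma> (k # p)) (\<lambda>p. \<Delta> (k # p))" if "k \<noteq> j" for k
      using * that by simp
    then have "image_mset (\<lambda>k. ns (ks ! k) (\<lambda>p. X' (k # p)) (\<lambda>p. \<Gamma>' (k # p)) (\<lambda>p. \<Delta>' (k # p)))
          (mset_set ({..<length ks} - {j})) =
        image_mset (\<lambda>k. ns (ks ! k) (\<lambda>p. X (k # p)) (\<lambda>p. \<Gamma> (k # p)) (\<lambda>p. \<Delta> (k # p)))
          (mset_set ({..<length ks} - {j}))"
      by (auto intro!: image_mset_cong)
    moreover have "ns (ks ! j) (\<lambda>p. X' (j # p)) (\<lambda>p. \<Gamma>' (j # p)) (\<lambda>p. \<Delta>' (j # p)) =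
        plug C [NS (X' (j # p)) (\<Gamma>' (j # p)) (\<Delta>' (j # p))
          {# NS (X' (j # p @ [i])) (\<Gamma>' (j # p @ [i])) (\<Delta>' (j # p @ [i])) K #}]"
      by (rule plug[rule_format]) (use * in auto)
    moreover have "X' [] = X []" "\<Gamma>' [] = \<Gamma> []" "\<Delta>' [] = \<Delta> []"
      using * by auto
    ultimately show ?thesis
      unfolding s ns_split[OF j(1)] plug' by simp
  qed
  then show ?case
    using C' by (intro exI[of _ C'] exI[of _ K]) simp
qed

text \<open>Again the context is chosen before the labels; it serves the tree without and with the
  new leaf. All old nodes keep their positions, so their labels carry over unchanged.\<close>

lemma add_child_exists:
  assumes "p \<in> nodes s"
  shows "\<exists>s' n C. p @ [n] \<notin> nodes s \<and> nodes s' = insert (p @ [n]) (nodes s) \<and> has_holes C 1 \<and>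
    (\<forall>X' \<Gamma>' \<Delta>'. (\<forall>r. r \<noteq> p \<longrightarrow> r \<noteq> p @ [n] \<longrightarrow> X' r = X r \<and> \<Gamma>' r = \<Gamma> r \<and> \<Delta>' r = \<Delta> r) \<longrightarrow>
      ns s X' \<Gamma>' \<Delta>' = plug C [NS (X' p) (\<Gamma>' p) (\<Delta>' p) {#}] \<and>
      ns s' X' \<Gamma>' \<Delta>' = plug C [NS (X' p) (\<Gamma>' p) (\<Delta>' p)
        {# NS (X' (p @ [n])) (\<Gamma>' (p @ [n])) (\<Delta>' (p @ [n])) {#} #}])"
  using assms
proof (induction p arbitrary: s X \<Gamma> \<Delta>)
  case Nil
  obtain ks where s: "s = Shape ks" by (cases s)
  let ?n = "length ks"
  \<comment> \<open>The new leaf becomes the last child, which leaves all existing addresses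
    intact.\<close>
  let ?s' = "Shape (ks @ [Shape []])"
  have nodes: "[?n] \<notin> nodes s" "nodes ?s' = insert [?n] (nodes s)"
    by (auto simp: s nodes.simps nth_append less_Suc_eq split: if_splits)
  let ?M = "image_mset (\<lambda>j. ctx_of (ks ! j) (\<lambda>p. X (j # p)) (\<lambda>p. \<Gamma> (j # p)) (\<lambda>p. \<Delta> (j # p)) (\<lambda>_. {#}))
      (mset_set {..<?n})"
  let ?C = "Ctx {#} {#} {#} {#0#} ?M"
  have "\<Sum>\<^sub># (image_mset holes ?M) = {#}"
    by (simp add: image_mset.compositionality comp_def holes_ctx_of)
  then have C: "has_holes ?C 1"
    unfolding has_holes_1 by simp
  have hf: "plug (ctx_of s X \<Gamma> \<Delta> (\<lambda>_. {#})) Ss = ns s X \<Gamma> \<Delta>" for s X \<Gamma> \<Delta> Ss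
    using plug_ctx_of[where H = "\<lambda>_. {#}"] by simp
  have "ns s X' \<Gamma>' \<Delta>' = plug ?C [NS (X' []) (\<Gamma>' []) (\<Delta>' []) {#}] \<and>
      ns ?s' X' \<Gamma>' \<Delta>' = plug ?C [NS (X' []) (\<Gamma>' []) (\<Delta>' [])
        {# NS (X' [?n]) (\<Gamma>' [?n]) (\<Delta>' [?n]) {#} #}]"
    if *: "\<forall>r. r \<noteq> [] \<longrightarrow> r \<noteq> [?n] \<longrightarrow> X' r = X r \<and> \<Gamma>' r = \<Gamma> r \<and> \<Delta>' r = \<Delta> r" for X' \<Gamma>' \<Delta>'
  proof -
    have kids: "ns (ks ! j) (\<lambda>p. X' (j # p)) (\<lambda>p. \<Gamma>' (j # p)) (\<lambda>p. \<Delta>' (j # p)) =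
        ns (ks ! j) (\<lambda>p. X (j # p)) (\<lambda>p. \<Gamma> (j # p)) (\<lambda>p. \<Delta> (j # p))" if "j < ?n" for j
      using * that by simp
    then have M: "image_mset (\<lambda>j. ns (ks ! j) (\<lambda>p. X' (j # p)) (\<lambda>p. \<Gamma>' (j # p)) (\<lambda>p. \<Delta>' (j # p)))
          (mset_set {..<?n}) = image_mset (\<lambda>C. plug C Ss) ?M" for Ss
      by (auto simp: image_mset.compositionality comp_def hf intro!: image_mset_cong)
    have "{..<Suc ?n} - {?n} = {..<?n}"
      by auto
    moreover have "image_mset (\<lambda>j. ns ((ks @ [Shape []]) ! j) (\<lambda>p. X' (j # p)) (\<lambda>p. \<Gamma>' (j # p)) (\<lambda>p. \<Delta>' (j # p)))
          (mset_set {..<?n}) =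
        image_mset (\<lambda>j. ns (ks ! j) (\<lambda>p. X' (j # p)) (\<lambda>p. \<Gamma>' (j # p)) (\<lambda>p. \<Delta>' (j # p)))
          (mset_set {..<?n})"
      by (rule image_mset_cong) (simp add: nth_append)
    moreover have n: "?n < length (ks @ [Shape []])"
      by simp
    ultimately have "ns ?s' X' \<Gamma>' \<Delta>' = plug ?C [NS (X' []) (\<Gamma>' []) (\<Delta>' [])
        {# NS (X' [?n]) (\<Gamma>' [?n]) (\<Delta>' [?n]) {#} #}]"
      unfolding ns_split[OF n] using M by simp
    moreover have "ns s X' \<Gamma>' \<Delta>' = plug ?C [NS (X' []) (\<Gamma>' []) (\<Delta>' []) {#}]"
      unfolding s using M by simp
    ultimately show ?thesis by blast
  qed
  then show ?case
    using C nodes by (intro exI[of _ ?s'] exI[of _ ?n] exI[of _ ?C]) simp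
next
  case (Cons j p)
  obtain ks where s: "s = Shape ks" by (cases s)
  have j: "j < length ks" "p \<in> nodes (ks ! j)"
    using Cons.prems by (simp_all add: s)
  obtain t n C where n: "p @ [n] \<notin> nodes (ks ! j)" and t: "nodes t = insert (p @ [n]) (nodes (ks ! j))"
    and C: "has_holes C 1" and plug:
    "\<forall>X' \<Gamma>' \<Delta>'. (\<forall>r. r \<noteq> p \<longrightarrow> r \<noteq> p @ [n] \<longrightarrow> X' r = X (j # r) \<and> \<Gamma>' r = \<Gamma> (j # r) \<and> \<Delta>' r = \<Delta> (j # r)) \<longrightarrow>
      ns (ks ! j) X' \<Gamma>' \<Delta>' = plug C [NS (X' p) (\<Gamma>' p) (\<Delta>' p) {#}] \<and>
      ns t X' \<Gamma>' \<Delta>' = plug C [NS (X' p) (\<Gamma>' p) (\<Delta>' p)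
        {# NS (X' (p @ [n])) (\<Gamma>' (p @ [n])) (\<Delta>' (p @ [n])) {#} #}]"
    using Cons.IH[OF j(2), of "\<lambda>r. X (j # r)" "\<lambda>r. \<Gamma> (j # r)" "\<lambda>r. \<Delta> (j # r)"]
    by (elim exE conjE) (rule that)
  obtain C' where C': "has_holes C' 1" and plug':
    "\<And>S. plug C' [S] = NS (X []) (\<Gamma> []) (\<Delta> []) (add_mset (plug C [S])
      (image_mset (\<lambda>i. ns (ks ! i) (\<lambda>p. X (i # p)) (\<lambda>p. \<Gamma> (i # p)) (\<lambda>p. \<Delta> (i # p)))
         (mset_set ({..<length ks} - {j}))))"
    by (rule one_hole_lift[OF C, where X = "X []" and \<Gamma> = "\<Gamma> []" and \<Delta> = "\<Delta> []" and s = "(!) ks"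
          and f = "\<lambda>i p. X (i # p)" and g = "\<lambda>i p. \<Gamma> (i # p)" and h = "\<lambda>i p. \<Delta> (i # p)"
          and M = "mset_set ({..<length ks} - {j})"]) (rule that)
  let ?s' = "Shape (ks[j := t])"
  have "q \<in> nodes ?s' \<longleftrightarrow> q \<in> insert (j # p @ [n]) (nodes s)" for q
    using j t by (cases q) (auto simp: s nth_list_update)
  then have nodes: "j # p @ [n] \<notin> nodes s" "nodes ?s' = insert (j # p @ [n]) (nodes s)"
    using n by (auto simp: s)
  have "ns s X' \<Gamma>' \<Delta>' = plug C' [NS (X' (j # p)) (\<Gamma>' (j # p)) (\<Delta>' (j # p)) {#}] \<and>
      ns ?s' X' \<Gamma>' \<Delta>' = plug C' [NS (X' (j # p)) (\<Gamma>' (j # p)) (\<Delta>' (j # p))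
        {# NS (X' (j # p @ [n])) (\<Gamma>' (j # p @ [n])) (\<Delta>' (j # p @ [n])) {#} #}]"
    if *: "\<forall>r. r \<noteq> j # p \<longrightarrow> r \<noteq> j # p @ [n] \<longrightarrow> X' r = X r \<and> \<Gamma>' r = \<Gamma> r \<and> \<Delta>' r = \<Delta> r" for X' \<Gamma>' \<Delta>'
  proof -
    have kids: "ns (ks ! k) (\<lambda>p. X' (k # p)) (\<lambda>p. \<Gamma>' (k # p)) (\<lambda>p. \<Delta>' (k # p)) =
        ns (ks ! k) (\<lambda>p. X (k # p)) (\<lambda>p. \<Gamma> (k # p)) (\<lambda>p. \<Delta> (k # p))" if "k \<noteq> j" for k
      using * that by simp
    have M: "image_mset (\<lambda>k. ns (ks ! k) (\<lambda>p. X' (k # p)) (\<lambda>p. \<Gamma>' (k # p)) (\<lambda>p. \<Delta>' (k # p)))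
          (mset_set ({..<length ks} - {j})) =
        image_mset (\<lambda>k. ns (ks ! k) (\<lambda>p. X (k # p)) (\<lambda>p. \<Gamma> (k # p)) (\<lambda>p. \<Delta> (k # p)))
          (mset_set ({..<length ks} - {j}))"
      using kids by (auto intro!: image_mset_cong)
    have M': "image_mset (\<lambda>k. ns (ks[j := t] ! k) (\<lambda>p. X' (k # p)) (\<lambda>p. \<Gamma>' (k # p)) (\<lambda>p. \<Delta>' (k # p)))
          (mset_set ({..<length ks} - {j})) =
        image_mset (\<lambda>k. ns (ks ! k) (\<lambda>p. X (k # p)) (\<lambda>p. \<Gamma> (k # p)) (\<lambda>p. \<Delta> (k # p)))
          (mset_set ({..<length ks} - {j}))"
      using kids by (auto intro!: image_mset_cong)
    have root: "X' [] = X []" "\<Gamma>' [] = \<Gamma> []" "\<Delta>' [] = \<Delta> []"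
      using * by auto
    have sub: "ns (ks ! j) (\<lambda>p. X' (j # p)) (\<lambda>p. \<Gamma>' (j # p)) (\<lambda>p. \<Delta>' (j # p)) =
          plug C [NS (X' (j # p)) (\<Gamma>' (j # p)) (\<Delta>' (j # p)) {#}] \<and>
        ns t (\<lambda>p. X' (j # p)) (\<lambda>p. \<Gamma>' (j # p)) (\<lambda>p. \<Delta>' (j # p)) =
          plug C [NS (X' (j # p)) (\<Gamma>' (j # p)) (\<Delta>' (j # p))
            {# NS (X' (j # p @ [n])) (\<Gamma>' (j # p @ [n])) (\<Delta>' (j # p @ [n])) {#} #}]"
      by (rule plug[rule_format]) (use * in auto)
    have j': "j < length (ks[j := t])"
      using j by simp
    show ?thesis
      unfolding s ns_split[OF j(1)] ns_split[OF j'] plug' using sub M M' root j(1) by simp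
  qed
  then show ?case
    using C' nodes by (intro exI[of _ ?s'] exI[of _ n] exI[of _ C']) simp
qed

subsection \<open>Countermodels from saturated trees\<close>

text \<open>Invariant of the search: free variables stay outside and bound variables inside one
  fixed set \<open>F\<close>. Together with signatures outside \<open>F\<close> this gives purity of
  every sequent that is reached.\<close>

definition good_fm :: "(nat \<Rightarrow> 'p set) \<Rightarrow> var set \<Rightarrow> 'p fm \<Rightarrow> bool" where
  "good_fm PS F A \<longleftrightarrow> wff PS A \<and> fv A \<inter> F = {} \<and> bv A \<subseteq> F"

text \<open>\<open>F\<close> contains the bound variables, \<open>T\<close> the nodes of an infinite tree with labels \<open>X\<close>,
  \<open>G\<close> and \<open>H\<close>.\<close>

locale saturated =
  fixes PS :: "nat \<Rightarrow> 'p set" and L :: "ax set" and F :: "var set" and T :: "pos set"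
    and X :: "pos \<Rightarrow> var set" and G H :: "pos \<Rightarrow> 'p fm set"
  assumes finite_F: "finite F"
    and T_4: "AxT \<in> L \<Longrightarrow> Ax5 \<in> L \<Longrightarrow> Ax4 \<in> L"
    and B_4: "AxB \<in> L \<Longrightarrow> Ax5 \<in> L \<Longrightarrow> Ax4 \<in> L"
    and B_5: "AxB \<in> L \<Longrightarrow> Ax4 \<in> L \<Longrightarrow> Ax5 \<in> L"
    and B_dom: "AxB \<in> L \<Longrightarrow> AxCBF \<in> L \<longleftrightarrow> AxBF \<in> L"
    and T5_dom: "AxT \<in> L \<Longrightarrow> Ax5 \<in> L \<Longrightarrow> AxCBF \<in> L \<longleftrightarrow> AxBF \<in> L"
    and root: "[] \<in> T"
    and prefix: "p @ [i] \<in> T \<Longrightarrow> p \<in> T"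
    and X_T: "x \<in> X p \<Longrightarrow> p \<in> T \<and> x \<notin> F"
    and G_T: "A \<in> G p \<Longrightarrow> p \<in> T \<and> good_fm PS F A"
    and H_T: "A \<in> H p \<Longrightarrow> p \<in> T \<and> good_fm PS F A"
    and init: "atomic P \<Longrightarrow> P \<in> G p \<Longrightarrow> P \<notin> H p"
    and bot: "Falsum \<notin> G p"
    and impL: "Imp A B \<in> G p \<Longrightarrow> A \<in> H p \<or> B \<in> G p"
    and impR: "Imp A B \<in> H p \<Longrightarrow> A \<in> G p \<and> B \<in> H p"
    and allL: "Forall x A \<in> G p \<Longrightarrow> z \<in> X p \<Longrightarrow> A\<langle>z/x\<rangle> \<in> G p"
    and allR: "Forall x A \<in> H p \<Longrightarrow> \<exists>z\<in>X p. A\<langle>z/x\<rangle> \<in> H p"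
    and boxL: "Box A \<in> G p \<Longrightarrow> p @ [i] \<in> T \<Longrightarrow> A \<in> G (p @ [i])"
    and boxR: "Box A \<in> H p \<Longrightarrow> \<exists>i. p @ [i] \<in> T \<and> A \<in> H (p @ [i])"
    and ref: "p \<in> T \<Longrightarrow> x \<notin> F \<Longrightarrow> Eql x x \<in> G p"
    and repl: "atomic P \<Longrightarrow> Eql x y \<in> G p \<Longrightarrow> P\<langle>x/z\<rangle> \<in> G p \<Longrightarrow> Eql x y \<noteq> P\<langle>x/z\<rangle> \<Longrightarrow>
      P\<langle>y/z\<rangle> \<in> G p"
    and replX: "Eql x y \<in> G p \<Longrightarrow> x \<in> X p \<Longrightarrow> y \<in> X p"
    and rig: "Eql x y \<in> G p \<Longrightarrow> q \<in> T \<Longrightarrow> Eql x y \<in> G q"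
    and ruleD: "AxD \<in> L \<Longrightarrow> p \<in> T \<Longrightarrow> \<exists>i. p @ [i] \<in> T"
    and ruleT: "AxT \<in> L \<Longrightarrow> Box A \<in> G p \<Longrightarrow> A \<in> G p"
    and ruleB: "AxB \<in> L \<Longrightarrow> Box A \<in> G (p @ [i]) \<Longrightarrow> A \<in> G p"
    and rule4: "Ax4 \<in> L \<Longrightarrow> Box A \<in> G p \<Longrightarrow> p @ [i] \<in> T \<Longrightarrow> Box A \<in> G (p @ [i])"
    and rule5: "Ax5 \<in> L \<Longrightarrow> Box A \<in> G p \<Longrightarrow> p \<noteq> [] \<Longrightarrow> q \<in> T \<Longrightarrow> Box A \<in> G q"
    and ruleCBF: "AxCBF \<in> L \<Longrightarrow> x \<in> X p \<Longrightarrow> p @ [i] \<in> T \<Longrightarrow> x \<in> X (p @ [i])"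
    and ruleBF: "AxBF \<in> L \<Longrightarrow> x \<in> X (p @ [i]) \<Longrightarrow> x \<in> X p"
    and ruleUI: "AxUI \<in> L \<Longrightarrow> p \<in> T \<Longrightarrow> x \<notin> F \<Longrightarrow> x \<in> X p"
    and rule5dom: "Ax5 \<in> L \<Longrightarrow> AxCBF \<in> L \<or> AxBF \<in> L \<Longrightarrow> p \<noteq> [] \<Longrightarrow> q \<noteq> [] \<Longrightarrow> x \<in> X p \<Longrightarrow>
      q \<in> T \<Longrightarrow> x \<in> X q"
begin

definition boxes :: "pos \<Rightarrow> 'p fm set" where
  "boxes p = {A. Box A \<in> G p}"

text \<open>The first clause is what truth of boxed formulas needs. The clause for
  \<open>Ax4\<close> makes the relation transitive, and the last two put the domain axioms into the
  definition.\<close>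

definition sees :: "pos \<Rightarrow> pos \<Rightarrow> bool" where
  "sees p q \<longleftrightarrow> boxes p \<subseteq> G q \<and> (Ax4 \<in> L \<longrightarrow> boxes p \<subseteq> boxes q) \<and>
     (AxCBF \<in> L \<longrightarrow> X p \<subseteq> X q) \<and> (AxBF \<in> L \<longrightarrow> X q \<subseteq> X p)"

text \<open>The canonical accessibility relation is kept off the root for Euclidean logics that are
  neither reflexive nor symmetric, since there the root has boxed formulas which the other nodes
  need not have.\<close>

definition acc :: "pos \<Rightarrow> pos \<Rightarrow> bool" where
  "acc p q \<longleftrightarrow> p \<in> T \<and> q \<in> T \<and> sees p q \<and> (AxB \<in> L \<longrightarrow> sees q p) \<and>
     (Ax5 \<in> L \<and> AxT \<notin> L \<and> AxB \<notin> L \<longrightarrow> q \<noteq> [])"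

lemma sees_trans: "Ax4 \<in> L \<Longrightarrow> sees p q \<Longrightarrow> sees q r \<Longrightarrow> sees p r"
  by (auto simp: sees_def)

lemma boxes_from_nonroot: "Ax5 \<in> L \<Longrightarrow> p \<noteq> [] \<Longrightarrow> q \<in> T \<Longrightarrow> boxes p \<subseteq> boxes q"
  using rule5 by (auto simp: boxes_def)

lemma boxes_from_root: "Ax4 \<in> L \<Longrightarrow> q \<in> T \<Longrightarrow> boxes [] \<subseteq> boxes q"
proof (induction q rule: rev_induct)
  case (snoc i q)
  then show ?case
    using rule4 prefix unfolding boxes_def by blast
qed simp

text \<open>\<open>rule5\<close> copies boxes from every node except the root, and
  \<open>rule4\<close> supplies the missing case by descent from the root.\<close>

lemma boxes_eq:
  assumes "Ax4 \<in> L" "Ax5 \<in> L" "p \<in> T" "q \<in> T"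
  shows "boxes p = boxes q"
proof -
  have "boxes p \<subseteq> boxes q" if "p \<in> T" "q \<in> T" for p q
    using boxes_from_nonroot[OF assms(2)] boxes_from_root[OF assms(1)] that by (cases "p = []") auto
  then show ?thesis
    using assms by blast
qed

text \<open>The forward half is saturation under the rules. In symmetric logics the backward half
  also needs consequences of proper closure: under \<open>Ax4\<close> boxes have to travel upwards,
  which \<open>Ax5\<close> provides, and each domain axiom has to come with its converse.\<close>

lemma acc_child:
  assumes "p @ [i] \<in> T"
  shows "acc p (p @ [i])"
proof -
  have "sees p (p @ [i])"
    using assms boxL rule4 ruleCBF ruleBF unfolding sees_def boxes_def by blast
  moreover have "sees (p @ [i]) p" if B: "AxB \<in> L"
  proof -
    have "Ax4 \<in> L \<longrightarrow> boxes (p @ [i]) \<subseteq> boxes p"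
      using B_5[OF B] boxes_from_nonroot[of "p @ [i]" p] prefix[OF assms] by simp
    then show ?thesis
      using assms ruleB[OF B] ruleCBF ruleBF B_dom[OF B] unfolding sees_def boxes_def by blast
  qed
  ultimately show ?thesis
    using assms prefix by (auto simp: acc_def)
qed

text \<open>In reflexive or symmetric logics proper closure gives \<open>Ax4\<close>, so all nodes
  share their boxes and, under a domain axiom, related nodes share their domain. Otherwise
  \<open>v\<close> and \<open>u\<close> are off the root: the boxes of \<open>v\<close> reach the
  parent of \<open>u\<close>, from where they are opened into \<open>u\<close>, and
  \<open>rule5dom\<close> takes care of the domains.\<close>

lemma acc_euclidean:
  assumes 5: "Ax5 \<in> L" and wv: "acc w v" and wu: "acc w u"
  shows "acc v u"
proof (cases "AxT \<in> L \<or> AxB \<in> L")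
  case True
  then have 4: "Ax4 \<in> L"
    using T_4 B_4 5 by blast
  have dom: "AxCBF \<in> L \<longleftrightarrow> AxBF \<in> L"
    using True B_dom T5_dom 5 by blast
  have T: "w \<in> T" "v \<in> T" "u \<in> T"
    using wv wu by (auto simp: acc_def)
  have "boxes v = boxes w" "boxes u = boxes w"
    using boxes_eq[OF 4 5] T by blast+
  moreover have "sees w v" "sees w u"
    using wv wu by (auto simp: acc_def)
  ultimately have "sees v u" "sees u v"
    using dom unfolding sees_def by blast+
  then show ?thesis
    using T True by (auto simp: acc_def)
next
  case False
  then have T: "v \<in> T" "v \<noteq> []" "u \<in> T" "u \<noteq> []"
    using wv wu 5 by (auto simp: acc_def)
  obtain p i where u: "u = p @ [i]"
    using T(4) by (meson rev_exhaust)
  have "boxes v \<subseteq> boxes u" "boxes v \<subseteq> boxes p"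
    using boxes_from_nonroot[OF 5 T(2)] T(3) prefix u by blast+
  then have "sees v u"
    using boxL[of _ p i] T u rule5dom[OF 5] unfolding sees_def boxes_def by blast
  then show ?thesis
    using T False by (auto simp: acc_def)
qed

section \<open>Equality as a congruence on the variables\<close>

definition eqv :: "var \<Rightarrow> var \<Rightarrow> bool" where
  "eqv x y \<longleftrightarrow> Eql x y \<in> G []"

lemma eqv_G: "p \<in> T \<Longrightarrow> eqv x y \<longleftrightarrow> Eql x y \<in> G p"
  unfolding eqv_def using rig root by blast

lemma eqv_F: "eqv x y \<Longrightarrow> x \<notin> F \<and> y \<notin> F"
  using G_T[of "Eql x y" "[]"] by (auto simp: eqv_def good_fm_def)

text \<open>The equation rewrites only the left occurrence of \<open>x\<close> in
  \<open>Eql x x\<close>, which \<open>z\<close> marks in the pattern \<open>Eql z x\<close>. The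
  case \<open>x = y\<close> is separate because \<open>repl\<close> requires the rewritten formula
  to differ from the equation.\<close>

lemma eqv_sym: "eqv x y \<Longrightarrow> eqv y x"
proof (cases "x = y")
  case False
  assume xy: "eqv x y"
  obtain z where z: "z \<noteq> x"
    by (metis n_not_Suc_n)
  have "Eql x x \<in> G []"
    using ref[OF root] eqv_F[OF xy] by blast
  then show ?thesis
    using repl[of "Eql z x" x y "[]" z] xy z False by (simp add: eqv_def)
qed simp

text \<open>The first equation, turned round by symmetry, rewrites the left side of the second one;
  \<open>u\<close> marks that place in the pattern.\<close>

lemma eqv_trans:
  assumes "eqv x y" "eqv y z"
  shows "eqv x z"
proof (cases "x = z")
  case True
  then show ?thesis
    using assms ref[OF root] eqv_F by (auto simp: eqv_def)
next
  case False
  obtain u where u: "u \<noteq> z"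
    by (metis n_not_Suc_n)
  show ?thesis
    using repl[of "Eql u z" y x "[]" u] eqv_sym[OF assms(1)] assms(2) u False by (simp add: eqv_def)
qed

lemma Pred_replace1:
  assumes "eqv x y" "Pred i (as @ x # bs) \<in> G p"
  shows "Pred i (as @ y # bs) \<in> G p"
proof -
  obtain z where z: "z \<notin> set (as @ bs)"
    using ex_new_if_finite[OF infinite_UNIV_nat] by (metis List.finite_set)
  have subst: "(Pred i (as @ z # bs))\<langle>v/z\<rangle> = Pred i (as @ v # bs)" for v
  proof -
    have "map (id(z := v)) as = as" "map (id(z := v)) bs = bs"
      using z by (auto intro!: map_idI)
    then show ?thesis by simp
  qed
  have "Eql x y \<in> G p"
    using assms eqv_G G_T by blast
  then show ?thesis
    using repl[of "Pred i (as @ z # bs)" x y p z] assms(2) by (simp add: subst del: ssubst.simps)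
qed

text \<open>Arguments are exchanged one by one; the generalised prefix \<open>as\<close> holds those
  already done.\<close>

lemma Pred_replace:
  "list_all2 eqv xs ys \<Longrightarrow> Pred i (as @ xs) \<in> G p \<Longrightarrow> Pred i (as @ ys) \<in> G p"
proof (induction arbitrary: as rule: list_all2_induct)
  case (Cons x xs y ys)
  then show ?case
    using Pred_replace1[of x y i as xs p] Cons.IH[of "as @ [y]"] by simp
qed

sublocale model acc X eqv "\<lambda>p i xs. Pred i xs \<in> G p" L T "- F"
proof
  show "w \<in> T \<and> v \<in> T" if "acc w v" for w v
    using that by (simp add: acc_def)
  show "X w \<subseteq> - F" for w
    using X_T by blast
  show "eqv d d" if "d \<in> - F" for d
    using that ref[OF root] by (simp add: eqv_def)
  show "eqv e d" if "eqv d e" for d e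
    using that by (rule eqv_sym)
  show "eqv d e'" if "eqv d e" "eqv e e'" for d e e'
    using that by (rule eqv_trans)
  show "Pred i es \<in> G w" if "list_all2 eqv ds es" "Pred i ds \<in> G w" for w i ds es
    using Pred_replace[OF that(1), of i "[]"] that(2) by simp
  show "e \<in> X w" if "w \<in> T" "eqv d e" "d \<in> X w" for w d e
    using replX that eqv_G by blast
  show "\<exists>v. acc w v" if "AxD \<in> L" "w \<in> T" for w
    using ruleD[OF that] acc_child by blast
  show "acc w w" if "AxT \<in> L" "w \<in> T" for w
    using ruleT that by (auto simp: acc_def sees_def boxes_def)
  show "acc v w" if "AxB \<in> L" "acc w v" for w v
    using that by (auto simp: acc_def)
  show "acc w u" if "Ax4 \<in> L" "acc w v" "acc v u" for w v u
    using that(2,3) sees_trans[OF that(1)] unfolding acc_def by meson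
  show "acc v u" if "Ax5 \<in> L" "acc w v" "acc w u" for w v u
    using that by (rule acc_euclidean)
  show "X w \<subseteq> X v" if "AxCBF \<in> L" "acc w v" for w v
    using that by (simp add: acc_def sees_def)
  show "X v \<subseteq> X w" if "AxBF \<in> L" "acc w v" for w v
    using that by (simp add: acc_def sees_def)
  show "X w = - F" if "AxUI \<in> L" "w \<in> T" for w
    using ruleUI[OF that] X_T by blast
qed

text \<open>Every variable outside \<open>F\<close> denotes itself. Those in \<open>F\<close> get an
  arbitrary value outside \<open>F\<close>, because soundness asks for assignments with all values
  in the outer domain.\<close>

definition assign :: "var \<Rightarrow> var" where
  "assign x = (if x \<in> F then SOME y. y \<notin> F else x)"

lemma range_assign: "range assign \<subseteq> - F"
  using someI_ex[OF ex_new_if_finite[OF infinite_UNIV_nat finite_F]] by (auto simp: assign_def)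

lemma assign_id: "x \<notin> F \<Longrightarrow> assign x = x"
  by (simp add: assign_def)

text \<open>Induction on the depth covers the quantifier instances. For a boxed formula on the left,
  accessibility itself places the immediate subformula at every accessible node; on the right the
  witness is a child, which \<open>acc_child\<close> makes accessible.\<close>

lemma truth: "(A \<in> G p \<longrightarrow> sat A assign p) \<and> (A \<in> H p \<longrightarrow> \<not> sat A assign p)"
proof (induction "fm_depth A" arbitrary: A p rule: less_induct)
  case less
  show ?case
  proof (cases A)
    case (Pred i xs)
    have "map assign xs = xs" if "A \<in> G p \<union> H p"
      by (rule map_idI) (use that G_T[of A p] H_T[of A p] Pred assign_id in \<open>auto simp: good_fm_def\<close>)
    then show ?thesis
      using init[of A p] Pred by auto
  next
    case (Eql x y)
    have "p \<in> T \<and> assign x = x \<and> assign y = y" if "A \<in> G p \<union> H p"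
      using that G_T[of A p] H_T[of A p] Eql assign_id by (auto simp: good_fm_def)
    then show ?thesis
      using init[of A p] Eql eqv_G by auto
  next
    case Falsum
    then show ?thesis using bot by simp
  next
    case (Imp B C)
    then show ?thesis
      using less[of B p] less[of C p] impL[of B C p] impR[of B C p] by auto
  next
    case (Forall x B)
    have IH: "(B\<langle>z/x\<rangle> \<in> G p \<longrightarrow> sat B (assign(x := z)) p) \<and> (B\<langle>z/x\<rangle> \<in> H p \<longrightarrow> \<not> sat B (assign(x := z)) p)"
      if "z \<in> X p" for z
    proof -
      have "assign \<circ> id(x := z) = assign(x := z)"
        using X_T[OF that] assign_id by (auto simp: fun_eq_iff)
      then show ?thesis
        using less[of "B\<langle>z/x\<rangle>" p] Forall by (simp add: sat_ssubst)
    qed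
    show ?thesis
      using IH allL[of x B p] allR[of x B p] Forall by auto
  next
    case (Box B)
    have IH: "(B \<in> G q \<longrightarrow> sat B assign q) \<and> (B \<in> H q \<longrightarrow> \<not> sat B assign q)" for q
      using less[of B q] Box by simp
    have "B \<in> G q" if "Box B \<in> G p" "acc p q" for q
      using that by (auto simp: acc_def sees_def boxes_def)
    moreover have "\<exists>q. acc p q \<and> B \<in> H q" if "Box B \<in> H p"
      using boxR[OF that] acc_child by blast
    ultimately show ?thesis
      using IH Box by auto
  qed
qed

lemma refutes_ns:
  "(\<And>q. q \<in> nodes s \<Longrightarrow> p @ q \<in> T \<and> set_mset (Y q) \<subseteq> X (p @ q) \<and> set_mset (\<Gamma> q) \<subseteq> G (p @ q) \<and>
      set_mset (\<Delta> q) \<subseteq> H (p @ q)) \<Longrightarrow> refutes (ns s Y \<Gamma> \<Delta>) assign p"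
proof (induction s Y \<Gamma> \<Delta> arbitrary: p rule: ns.induct)
  case (1 ks Y \<Gamma> \<Delta>)
  note root = 1(2)[of "[]", simplified]
  have "\<exists>v. acc p v \<and> refutes (ns (ks ! i) (\<lambda>p. Y (i # p)) (\<lambda>p. \<Gamma> (i # p)) (\<lambda>p. \<Delta> (i # p))) assign v"
    if i: "i < length ks" for i
  proof (intro exI conjI)
    show "acc p (p @ [i])"
      using acc_child 1(2)[of "[i]"] i by simp
    show "refutes (ns (ks ! i) (\<lambda>p. Y (i # p)) (\<lambda>p. \<Gamma> (i # p)) (\<lambda>p. \<Delta> (i # p))) assign (p @ [i])"
    proof (rule 1(1))
      fix q
      assume "q \<in> nodes (ks ! i)"
      then show "(p @ [i]) @ q \<in> T \<and> set_mset (Y (i # q)) \<subseteq> X ((p @ [i]) @ q) \<and>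
          set_mset (\<Gamma> (i # q)) \<subseteq> G ((p @ [i]) @ q) \<and> set_mset (\<Delta> (i # q)) \<subseteq> H ((p @ [i]) @ q)"
        using 1(2)[of "i # q"] i by simp
    qed (use i in simp)
  qed
  moreover have "assign x \<in> X p" if "x \<in># Y []" for x
    using root that X_T assign_id by auto
  ultimately show ?case
    using root truth by auto
qed

end

subsection \<open>Rules at positions\<close>

lemma one_hole_rule:
  assumes p: "p \<in> nodes s"
    and rule: "\<And>C. has_holes C 1 \<Longrightarrow>
      rule_inst L [plug C [NS x g d {#}]] ys (plug C [NS (X p) (\<Gamma> p) (\<Delta> p) {#}])"
  shows "rule_inst L [ns s (X(p := x)) (\<Gamma>(p := g)) (\<Delta>(p := d))] ys (ns s X \<Gamma> \<Delta>)"
proof -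
  obtain C where C: "has_holes C 1"
    and plug: "\<And>x g d. plug C [NS x g d {#}] = ns s (X(p := x)) (\<Gamma>(p := g)) (\<Delta>(p := d))"
    by (rule one_hole_exists[OF p, where X = X and \<Gamma> = \<Gamma> and \<Delta> = \<Delta>]) (rule that)
  show ?thesis
    using rule[OF C] unfolding plug by simp
qed

text \<open>The displayed parts are first removed from the labels of \<open>p\<close> to form the
  context, and plugging adds them back. As labels are added up, this also works if both holes sit at
  one node.\<close>

lemma two_hole_rule:
  assumes p: "p \<in> nodes s" and q: "q \<in> nodes s" and "x \<subseteq># X p" "g \<subseteq># \<Gamma> p"
    and rule: "\<And>C. has_holes C 2 \<Longrightarrow> (p \<noteq> [] \<Longrightarrow> hole_depth_ge1 C 0) \<Longrightarrow>
      (q \<noteq> [] \<Longrightarrow> hole_depth_ge1 C 1) \<Longrightarrow>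
      rule_inst L [plug C [NS x g {#} {#}, NS x' g' {#} {#}]] []
        (plug C [NS x g {#} {#}, NS {#} {#} {#} {#}])"
  shows "rule_inst L [ns s (X(q := x' + X q)) (\<Gamma>(q := g' + \<Gamma> q)) \<Delta>] [] (ns s X \<Gamma> \<Delta>)"
proof -
  let ?X = "X(p := X p - x)" and ?\<Gamma> = "\<Gamma>(p := \<Gamma> p - g)"
  obtain C where C: "has_holes C 2" "p \<noteq> [] \<Longrightarrow> hole_depth_ge1 C 0" "q \<noteq> [] \<Longrightarrow> hole_depth_ge1 C 1"
    and plug: "\<And>x g d x' g' d'. plug C [NS x g d {#}, NS x' g' d' {#}] =
      ns s (\<lambda>r. ?X r + (if r = p then x else {#}) + (if r = q then x' else {#}))
        (\<lambda>r. ?\<Gamma> r + (if r = p then g else {#}) + (if r = q then g' else {#}))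
        (\<lambda>r. \<Delta> r + (if r = p then d else {#}) + (if r = q then d' else {#}))"
    by (rule two_holes_exist[OF p q, where X = ?X and \<Gamma> = ?\<Gamma> and \<Delta> = \<Delta>]) (rule that)
  have 1: "plug C [NS x g {#} {#}, NS x' g' {#} {#}] = ns s (X(q := x' + X q)) (\<Gamma>(q := g' + \<Gamma> q)) \<Delta>"
    unfolding plug by (rule ns_cong) (use assms(3,4) in auto)
  have 2: "plug C [NS x g {#} {#}, NS {#} {#} {#} {#}] = ns s X \<Gamma> \<Delta>"
    unfolding plug by (rule ns_cong) (use assms(3,4) in auto)
  show ?thesis
    using rule[OF C] unfolding 1 2 .
qed

lemma child_rule:
  assumes child: "p @ [i] \<in> nodes s"
    and rule: "\<And>C K. has_holes C 1 \<Longrightarrow> rule_inst L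
      [plug C [NS (X' p) (\<Gamma>' p) (\<Delta> p) {# NS (X' (p @ [i])) (\<Gamma>' (p @ [i])) (\<Delta> (p @ [i])) K #}]] []
      (plug C [NS (X p) (\<Gamma> p) (\<Delta> p) {# NS (X (p @ [i])) (\<Gamma> (p @ [i])) (\<Delta> (p @ [i])) K #}])"
    and off: "\<And>r. r \<noteq> p \<Longrightarrow> r \<noteq> p @ [i] \<Longrightarrow> X' r = X r \<and> \<Gamma>' r = \<Gamma> r"
  shows "rule_inst L [ns s X' \<Gamma>' \<Delta>] [] (ns s X \<Gamma> \<Delta>)"
proof -
  obtain C K where C: "has_holes C 1" and
    plug: "\<forall>X' \<Gamma>' \<Delta>'. (\<forall>r. r \<noteq> p \<longrightarrow> r \<noteq> p @ [i] \<longrightarrow> X' r = X r \<and> \<Gamma>' r = \<Gamma> r \<and> \<Delta>' r = \<Delta> r) \<longrightarrow>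
      ns s X' \<Gamma>' \<Delta>' = plug C [NS (X' p) (\<Gamma>' p) (\<Delta>' p)
        {# NS (X' (p @ [i])) (\<Gamma>' (p @ [i])) (\<Delta>' (p @ [i])) K #}]"
    using parent_child_hole_exists[OF child, of X \<Gamma> \<Delta>] by (elim exE conjE) (rule that)
  have "ns s X \<Gamma> \<Delta> = plug C [NS (X p) (\<Gamma> p) (\<Delta> p) {# NS (X (p @ [i])) (\<Gamma> (p @ [i])) (\<Delta> (p @ [i])) K #}]"
    by (rule plug[rule_format]) simp
  moreover have "ns s X' \<Gamma>' \<Delta> =
      plug C [NS (X' p) (\<Gamma>' p) (\<Delta> p) {# NS (X' (p @ [i])) (\<Gamma>' (p @ [i])) (\<Delta> (p @ [i])) K #}]"
    by (rule plug[rule_format]) (simp add: off)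
  ultimately show ?thesis
    using rule[OF C] by simp
qed

text \<open>Captures every rule whose only effect, read backwards, is one more antecedent formula at
  one node. The search can then schedule these rules as a single kind of task.\<close>

definition adds_fm where
  "adds_fm L s X \<Gamma> \<Delta> q B \<longleftrightarrow>
     rule_inst L [ns s X (\<Gamma>(q := add_mset B (\<Gamma> q))) \<Delta>] [] (ns s X \<Gamma> \<Delta>)"

definition adds_var where
  "adds_var L s X \<Gamma> \<Delta> q x \<longleftrightarrow>
     rule_inst L [ns s (X(q := add_mset x (X q))) \<Gamma> \<Delta>] [] (ns s X \<Gamma> \<Delta>)"

lemma adds_fm_one_hole:
  assumes "p \<in> nodes s" and "\<And>C. has_holes C 1 \<Longrightarrow>
      rule_inst L [plug C [NS (X p) (add_mset B (\<Gamma> p)) (\<Delta> p) {#}]] [] (plug C [NS (X p) (\<Gamma> p) (\<Delta> p) {#}])"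
  shows "adds_fm L s X \<Gamma> \<Delta> p B"
  using one_hole_rule[where X = X and \<Gamma> = \<Gamma> and \<Delta> = \<Delta>, OF assms] by (simp add: adds_fm_def)

lemma adds_var_one_hole:
  assumes "p \<in> nodes s" and "\<And>C. has_holes C 1 \<Longrightarrow>
      rule_inst L [plug C [NS (add_mset x (X p)) (\<Gamma> p) (\<Delta> p) {#}]] [] (plug C [NS (X p) (\<Gamma> p) (\<Delta> p) {#}])"
  shows "adds_var L s X \<Gamma> \<Delta> p x"
  using one_hole_rule[where X = X and \<Gamma> = \<Gamma> and \<Delta> = \<Delta>, OF assms] by (simp add: adds_var_def)

lemma adds_LForall:
  assumes "p \<in> nodes s" "z \<in># X p" "Forall x A \<in># \<Gamma> p"
  shows "adds_fm L s X \<Gamma> \<Delta> p (A\<langle>z/x\<rangle>)"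
proof (rule adds_fm_one_hole[OF assms(1)])
  obtain X0 \<Gamma>0 where eq: "X p = add_mset z X0" "\<Gamma> p = add_mset (Forall x A) \<Gamma>0"
    using assms by (metis insert_DiffM)
  fix C :: "'a ctx"
  assume "has_holes C 1"
  then show "rule_inst L [plug C [NS (X p) (add_mset A\<langle>z/x\<rangle> (\<Gamma> p)) (\<Delta> p) {#}]] []
      (plug C [NS (X p) (\<Gamma> p) (\<Delta> p) {#}])"
    unfolding eq by (rule rule_inst.LForall)
qed

lemma adds_Ref: "p \<in> nodes s \<Longrightarrow> adds_fm L s X \<Gamma> \<Delta> p (Eql x x)"
  by (rule adds_fm_one_hole) (auto intro: rule_inst.Ref)

text \<open>The last hypothesis secures two separate occurrences in the antecedent multiset, as the
  rule demands.\<close>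

lemma adds_Repl:
  assumes "p \<in> nodes s" "atomic P" "Eql x y \<in># \<Gamma> p" "P\<langle>x/z\<rangle> \<in># \<Gamma> p" "Eql x y \<noteq> P\<langle>x/z\<rangle>"
  shows "adds_fm L s X \<Gamma> \<Delta> p (P\<langle>y/z\<rangle>)"
proof (rule adds_fm_one_hole[OF assms(1)])
  obtain \<Gamma>0 where eq: "\<Gamma> p = add_mset (Eql x y) (add_mset (P\<langle>x/z\<rangle>) \<Gamma>0)"
    using assms(3-5) by (metis insert_DiffM insert_noteq_member)
  fix C :: "'a ctx"
  assume "has_holes C 1"
  then show "rule_inst L [plug C [NS (X p) (add_mset P\<langle>y/z\<rangle> (\<Gamma> p)) (\<Delta> p) {#}]] []
      (plug C [NS (X p) (\<Gamma> p) (\<Delta> p) {#}])"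
    unfolding eq using assms(2) by (rule rule_inst.Repl)
qed

lemma adds_ReplX:
  assumes "p \<in> nodes s" "Eql x y \<in># \<Gamma> p" "x \<in># X p"
  shows "adds_var L s X \<Gamma> \<Delta> p y"
proof (rule adds_var_one_hole[OF assms(1)])
  obtain X0 \<Gamma>0 where eq: "X p = add_mset x X0" "\<Gamma> p = add_mset (Eql x y) \<Gamma>0"
    using assms by (metis insert_DiffM)
  fix C :: "'a ctx"
  assume "has_holes C 1"
  then show "rule_inst L [plug C [NS (add_mset y (X p)) (\<Gamma> p) (\<Delta> p) {#}]] []
      (plug C [NS (X p) (\<Gamma> p) (\<Delta> p) {#}])"
    unfolding eq add_mset_commute[of y] by (rule rule_inst.ReplX)
qed

lemma adds_RT:
  assumes "AxT \<in> L" "p \<in> nodes s" "Box A \<in># \<Gamma> p"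
  shows "adds_fm L s X \<Gamma> \<Delta> p A"
proof (rule adds_fm_one_hole[OF assms(2)])
  obtain \<Gamma>0 where eq: "\<Gamma> p = add_mset (Box A) \<Gamma>0"
    using assms by (metis insert_DiffM)
  fix C :: "'a ctx"
  assume "has_holes C 1"
  then show "rule_inst L [plug C [NS (X p) (add_mset A (\<Gamma> p)) (\<Delta> p) {#}]] []
      (plug C [NS (X p) (\<Gamma> p) (\<Delta> p) {#}])"
    unfolding eq by (rule rule_inst.RT[OF assms(1)])
qed

lemma adds_Rui: "AxUI \<in> L \<Longrightarrow> p \<in> nodes s \<Longrightarrow> adds_var L s X \<Gamma> \<Delta> p x"
  by (rule adds_var_one_hole) (auto intro: rule_inst.Rui)

lemma adds_Rig:
  assumes "p \<in> nodes s" "q \<in> nodes s" "Eql x y \<in># \<Gamma> p"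
  shows "adds_fm L s X \<Gamma> \<Delta> q (Eql x y)"
proof -
  have "rule_inst L [ns s (X(q := {#} + X q)) (\<Gamma>(q := {#Eql x y#} + \<Gamma> q)) \<Delta>] [] (ns s X \<Gamma> \<Delta>)"
    by (rule two_hole_rule[OF assms(1,2), where x = "{#}" and g = "{#Eql x y#}"])
      (use assms in \<open>auto intro: rule_inst.Rig\<close>)
  then show ?thesis
    by (simp add: adds_fm_def)
qed

lemma adds_R5:
  assumes "Ax5 \<in> L" "p \<in> nodes s" "q \<in> nodes s" "Box A \<in># \<Gamma> p" "p \<noteq> []"
  shows "adds_fm L s X \<Gamma> \<Delta> q (Box A)"
proof -
  have "rule_inst L [ns s (X(q := {#} + X q)) (\<Gamma>(q := {#Box A#} + \<Gamma> q)) \<Delta>] [] (ns s X \<Gamma> \<Delta>)"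
    by (rule two_hole_rule[OF assms(2,3), where x = "{#}" and g = "{#Box A#}"])
      (use assms in \<open>auto intro: rule_inst.R5\<close>)
  then show ?thesis
    by (simp add: adds_fm_def)
qed

lemma adds_R5dom:
  assumes "Ax5 \<in> L" "{AxCBF, AxBF} \<inter> L \<noteq> {}" "p \<in> nodes s" "q \<in> nodes s" "x \<in># X p" "p \<noteq> []" "q \<noteq> []"
  shows "adds_var L s X \<Gamma> \<Delta> q x"
proof -
  have "rule_inst L [ns s (X(q := {#x#} + X q)) (\<Gamma>(q := {#} + \<Gamma> q)) \<Delta>] [] (ns s X \<Gamma> \<Delta>)"
    by (rule two_hole_rule[OF assms(3,4), where x = "{#x#}" and g = "{#}"])
      (use assms in \<open>auto intro: rule_inst.R5dom[OF assms(1,2)]\<close>)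
  then show ?thesis
    by (simp add: adds_var_def)
qed

lemma adds_LBox:
  assumes "p @ [i] \<in> nodes s" "Box A \<in># \<Gamma> p"
  shows "adds_fm L s X \<Gamma> \<Delta> (p @ [i]) A"
  unfolding adds_fm_def
proof (rule child_rule[OF assms(1)])
  obtain \<Gamma>0 where eq: "\<Gamma> p = add_mset (Box A) \<Gamma>0"
    using assms by (metis insert_DiffM)
  fix C :: "'a ctx" and K
  assume "has_holes C 1"
  then show "rule_inst L [plug C [NS (X p) ((\<Gamma>(p @ [i] := add_mset A (\<Gamma> (p @ [i])))) p) (\<Delta> p)
        {#NS (X (p @ [i])) ((\<Gamma>(p @ [i] := add_mset A (\<Gamma> (p @ [i])))) (p @ [i])) (\<Delta> (p @ [i])) K#}]] []
      (plug C [NS (X p) (\<Gamma> p) (\<Delta> p) {#NS (X (p @ [i])) (\<Gamma> (p @ [i])) (\<Delta> (p @ [i])) K#}])"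
    by (simp add: eq rule_inst.LBox)
qed auto

lemma adds_R4:
  assumes "Ax4 \<in> L" "p @ [i] \<in> nodes s" "Box A \<in># \<Gamma> p"
  shows "adds_fm L s X \<Gamma> \<Delta> (p @ [i]) (Box A)"
  unfolding adds_fm_def
proof (rule child_rule[OF assms(2)])
  obtain \<Gamma>0 where eq: "\<Gamma> p = add_mset (Box A) \<Gamma>0"
    using assms by (metis insert_DiffM)
  fix C :: "'a ctx" and K
  assume "has_holes C 1"
  then show "rule_inst L [plug C [NS (X p) ((\<Gamma>(p @ [i] := add_mset (Box A) (\<Gamma> (p @ [i])))) p) (\<Delta> p)
        {#NS (X (p @ [i])) ((\<Gamma>(p @ [i] := add_mset (Box A) (\<Gamma> (p @ [i])))) (p @ [i])) (\<Delta> (p @ [i])) K#}]] []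
      (plug C [NS (X p) (\<Gamma> p) (\<Delta> p) {#NS (X (p @ [i])) (\<Gamma> (p @ [i])) (\<Delta> (p @ [i])) K#}])"
    by (simp add: eq rule_inst.R4 assms(1))
qed auto

lemma adds_RB:
  assumes "AxB \<in> L" "p @ [i] \<in> nodes s" "Box A \<in># \<Gamma> (p @ [i])"
  shows "adds_fm L s X \<Gamma> \<Delta> p A"
  unfolding adds_fm_def
proof (rule child_rule[OF assms(2)])
  obtain \<Gamma>0 where eq: "\<Gamma> (p @ [i]) = add_mset (Box A) \<Gamma>0"
    using assms by (metis insert_DiffM)
  fix C :: "'a ctx" and K
  assume "has_holes C 1"
  then show "rule_inst L [plug C [NS (X p) ((\<Gamma>(p := add_mset A (\<Gamma> p))) p) (\<Delta> p)
        {#NS (X (p @ [i])) ((\<Gamma>(p := add_mset A (\<Gamma> p))) (p @ [i])) (\<Delta> (p @ [i])) K#}]] []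
      (plug C [NS (X p) (\<Gamma> p) (\<Delta> p) {#NS (X (p @ [i])) (\<Gamma> (p @ [i])) (\<Delta> (p @ [i])) K#}])"
    by (simp add: eq rule_inst.RB assms(1))
qed auto

lemma adds_Rcbf:
  assumes "AxCBF \<in> L" "p @ [i] \<in> nodes s" "x \<in># X p"
  shows "adds_var L s X \<Gamma> \<Delta> (p @ [i]) x"
  unfolding adds_var_def
proof (rule child_rule[OF assms(2)])
  obtain X0 where eq: "X p = add_mset x X0"
    using assms by (metis insert_DiffM)
  fix C :: "'a ctx" and K
  assume "has_holes C 1"
  then show "rule_inst L [plug C [NS ((X(p @ [i] := add_mset x (X (p @ [i])))) p) (\<Gamma> p) (\<Delta> p)
        {#NS ((X(p @ [i] := add_mset x (X (p @ [i])))) (p @ [i])) (\<Gamma> (p @ [i])) (\<Delta> (p @ [i])) K#}]] []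
      (plug C [NS (X p) (\<Gamma> p) (\<Delta> p) {#NS (X (p @ [i])) (\<Gamma> (p @ [i])) (\<Delta> (p @ [i])) K#}])"
    by (simp add: eq rule_inst.Rcbf assms(1))
qed auto

lemma adds_Rbf:
  assumes "AxBF \<in> L" "p @ [i] \<in> nodes s" "x \<in># X (p @ [i])"
  shows "adds_var L s X \<Gamma> \<Delta> p x"
  unfolding adds_var_def
proof (rule child_rule[OF assms(2)])
  obtain X0 where eq: "X (p @ [i]) = add_mset x X0"
    using assms by (metis insert_DiffM)
  fix C :: "'a ctx" and K
  assume "has_holes C 1"
  then show "rule_inst L [plug C [NS ((X(p := add_mset x (X p))) p) (\<Gamma> p) (\<Delta> p)
        {#NS ((X(p := add_mset x (X p))) (p @ [i])) (\<Gamma> (p @ [i])) (\<Delta> (p @ [i])) K#}]] []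
      (plug C [NS (X p) (\<Gamma> p) (\<Delta> p) {#NS (X (p @ [i])) (\<Gamma> (p @ [i])) (\<Delta> (p @ [i])) K#}])"
    by (simp add: eq rule_inst.Rbf assms(1))
qed auto

subsection \<open>Proof search\<close>

text \<open>Giving each premiss of \<open>L\<supset>\<close> its own infinite supply \<open>V\<close> of eigenvariables makes the
  eigenvariables of a derivation pairwise distinct.\<close>

definition derivable_from :: "(nat \<Rightarrow> 'p set) \<Rightarrow> ax set \<Rightarrow> var set \<Rightarrow> 'p nsequent \<Rightarrow> bool" where
  "derivable_from PS L V S \<longleftrightarrow> (\<exists>ys. derivation PS L ys S \<and> distinct ys \<and> set ys \<subseteq> V)"

lemma derivable_from_axiom:
  assumes "rule_inst L [] [] S" "wf_nsequent PS S" "pure S"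
  shows "derivable_from PS L V S"
  using derivation.step[OF assms, of "[]"] by (auto simp: derivable_from_def)

lemma derivable_from_unary:
  assumes "rule_inst L [P] [] S" "wf_nsequent PS S" "pure S" "derivable_from PS L V P"
  shows "derivable_from PS L V S"
proof -
  obtain ys where ys: "derivation PS L ys P" "distinct ys" "set ys \<subseteq> V"
    using assms(4) by (auto simp: derivable_from_def)
  then show ?thesis
    using derivation.step[OF assms(1-3), of "[ys]"] by (auto simp: derivable_from_def)
qed

lemma derivable_from_eigen:
  assumes "rule_inst L [P] [y] S" "wf_nsequent PS S" "pure S" "derivable_from PS L (V - {y}) P" "y \<in> V"
  shows "derivable_from PS L V S"
proof -
  obtain ys where ys: "derivation PS L ys P" "distinct ys" "set ys \<subseteq> V - {y}"
    using assms(4) by (auto simp: derivable_from_def)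
  then have "derivation PS L (y # ys) S"
    using derivation.step[OF assms(1-3), of "[ys]"] by simp
  moreover have "distinct (y # ys)" "set (y # ys) \<subseteq> V"
    using ys assms(5) by auto
  ultimately show ?thesis
    unfolding derivable_from_def by blast
qed

lemma derivable_from_binary:
  assumes "rule_inst L [P, Q] [] S" "wf_nsequent PS S" "pure S"
    "derivable_from PS L V P" "derivable_from PS L V' Q" "V \<inter> V' = {}"
  shows "derivable_from PS L (V \<union> V') S"
proof -
  obtain ys zs where ys: "derivation PS L ys P" "distinct ys" "set ys \<subseteq> V"
    and zs: "derivation PS L zs Q" "distinct zs" "set zs \<subseteq> V'"
    using assms(4,5) by (auto simp: derivable_from_def)
  then have "derivation PS L (ys @ zs) S"
    using derivation.step[OF assms(1-3), of "[ys, zs]"] by simp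
  moreover have "distinct (ys @ zs)" "set (ys @ zs) \<subseteq> V \<union> V'"
    using ys zs assms(6) by auto
  ultimately show ?thesis
    unfolding derivable_from_def by blast
qed

lemma derivable_from_mono: "derivable_from PS L V S \<Longrightarrow> V \<subseteq> V' \<Longrightarrow> derivable_from PS L V' S"
  by (auto simp: derivable_from_def)

text \<open>The two parts are the even and the odd places in the increasing enumeration of
  \<open>V\<close>.\<close>

lemma infinite_split:
  fixes V :: "nat set"
  assumes "infinite V"
  obtains V1 V2 where "infinite V1" "infinite V2" "V1 \<inter> V2 = {}" "V1 \<union> V2 \<subseteq> V"
proof
  let ?e = "enumerate V"
  have inj: "inj ?e"
    using strict_mono_enumerate[OF assms] by (rule strict_mono_imp_inj_on)
  have inj2: "inj (\<lambda>n. ?e (2 * n))" "inj (\<lambda>n. ?e (2 * n + 1))"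
    using inj_eq[OF inj] by (simp_all add: inj_def)
  show "infinite (range (\<lambda>n. ?e (2 * n)))" "infinite (range (\<lambda>n. ?e (2 * n + 1)))"
    using inj2 range_inj_infinite by blast+
  have "2 * m \<noteq> 2 * n + (1 :: nat)" for m n
    by presburger
  then show "range (\<lambda>n. ?e (2 * n)) \<inter> range (\<lambda>n. ?e (2 * n + 1)) = {}"
    using inj by (auto simp: inj_eq)
  show "range (\<lambda>n. ?e (2 * n)) \<union> range (\<lambda>n. ?e (2 * n + 1)) \<subseteq> V"
    using enumerate_in_set[OF assms] by auto
qed

section \<open>Stages of the search and single backward steps\<close>

datatype 'p stage =
  Stage (shp: shape) (sig: "pos \<Rightarrow> var multiset") (ant: "pos \<Rightarrow> 'p fm multiset")
    (suc: "pos \<Rightarrow> 'p fm multiset") (pool: "var set")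

definition good_labels where
  "good_labels PS F s X \<Gamma> \<Delta> \<longleftrightarrow> (\<forall>p\<in>nodes s. set_mset (X p) \<inter> F = {} \<and>
     (\<forall>A. A \<in># \<Gamma> p \<or> A \<in># \<Delta> p \<longrightarrow> good_fm PS F A))"

lemma good_labels_ns:
  assumes "good_labels PS F s X \<Gamma> \<Delta>"
  shows "wf_nsequent PS (ns s X \<Gamma> \<Delta>)" "pure (ns s X \<Gamma> \<Delta>)" "bound_vars (ns s X \<Gamma> \<Delta>) \<subseteq> F"
    "free_vars (ns s X \<Gamma> \<Delta>) \<inter> F = {}"
proof -
  have fms: "good_fm PS F A" if "A \<in> fms (ns s X \<Gamma> \<Delta>)" for A
    using that assms by (auto simp: fms_ns good_labels_def)
  have sig: "sigvars (ns s X \<Gamma> \<Delta>) \<inter> F = {}"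
    using assms by (auto simp: sigvars_ns good_labels_def)
  show "wf_nsequent PS (ns s X \<Gamma> \<Delta>)"
    using fms by (auto simp: wf_nsequent_def good_fm_def)
  show b: "bound_vars (ns s X \<Gamma> \<Delta>) \<subseteq> F"
    using fms by (auto simp: bound_vars_def good_fm_def)
  show f: "free_vars (ns s X \<Gamma> \<Delta>) \<inter> F = {}"
    using fms sig by (fastforce simp: free_vars_def good_fm_def)
  show "pure (ns s X \<Gamma> \<Delta>)"
    using b f by (auto simp: pure_def)
qed

text \<open>The pool may share variables with the sequent: being infinite, it always contains one
  that is fresh for the finitely many in use.\<close>

definition open_stage where
  "open_stage PS L F \<sigma> \<longleftrightarrow> infinite (pool \<sigma>) \<and> good_labels PS F (shp \<sigma>) (sig \<sigma>) (ant \<sigma>) (suc \<sigma>) \<and>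
     \<not> derivable_from PS L (pool \<sigma>) (ns (shp \<sigma>) (sig \<sigma>) (ant \<sigma>) (suc \<sigma>))"

text \<open>Vacuously true for formulas of any other shape: among the left rules with premisses,
  only the one for implication consumes its principal formula.\<close>

definition handledL :: "'p fm \<Rightarrow> pos \<Rightarrow> 'p stage \<Rightarrow> bool" where
  "handledL C p \<sigma> \<longleftrightarrow> (\<forall>A B. C = Imp A B \<longrightarrow> A \<in># suc \<sigma> p \<or> B \<in># ant \<sigma> p)"

definition handledR :: "'p fm \<Rightarrow> pos \<Rightarrow> 'p stage \<Rightarrow> bool" where
  "handledR C p \<sigma> \<longleftrightarrow> (\<forall>A B. C = Imp A B \<longrightarrow> A \<in># ant \<sigma> p \<and> B \<in># suc \<sigma> p) \<and>
     (\<forall>x A. C = Forall x A \<longrightarrow> (\<exists>y. y \<in># sig \<sigma> p \<and> A\<langle>y/x\<rangle> \<in># suc \<sigma> p)) \<and>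
     (\<forall>A. C = Box A \<longrightarrow> (\<exists>i. p @ [i] \<in> nodes (shp \<sigma>) \<and> A \<in># suc \<sigma> (p @ [i])))"

text \<open>This relation is not transitive: what a decomposition yields may be decomposed later.\<close>

definition ext :: "'p stage \<Rightarrow> 'p stage \<Rightarrow> bool" where
  "ext \<sigma> \<sigma>' \<longleftrightarrow> nodes (shp \<sigma>) \<subseteq> nodes (shp \<sigma>') \<and> (\<forall>p\<in>nodes (shp \<sigma>).
     set_mset (sig \<sigma> p) \<subseteq> set_mset (sig \<sigma>' p) \<and>
     (\<forall>C. C \<in># ant \<sigma> p \<longrightarrow> C \<in># ant \<sigma>' p \<or> (\<exists>A B. C = Imp A B) \<and> handledL C p \<sigma>') \<and>
     (\<forall>C. C \<in># suc \<sigma> p \<longrightarrow> C \<in># suc \<sigma>' p \<or> \<not> atomic C \<and> handledR C p \<sigma>'))"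

lemma ext_refl: "ext \<sigma> \<sigma>"
  by (simp add: ext_def)

text \<open>\<open>k\<close> is the kind of a task. The preconditions turn a task that does not
  apply into a vacuous one, so any task may be scheduled at any stage.\<close>

definition fulfils where
  "fulfils PS L F k q C x \<sigma> \<sigma>' \<longleftrightarrow>
     (k = (0 :: nat) \<longrightarrow> q \<in> nodes (shp \<sigma>) \<longrightarrow> good_fm PS F C \<longrightarrow>
        adds_fm L (shp \<sigma>) (sig \<sigma>) (ant \<sigma>) (suc \<sigma>) q C \<longrightarrow> C \<in># ant \<sigma>' q) \<and>
     (k = 1 \<longrightarrow> q \<in> nodes (shp \<sigma>) \<longrightarrow> x \<notin> F \<longrightarrow>
        adds_var L (shp \<sigma>) (sig \<sigma>) (ant \<sigma>) (suc \<sigma>) q x \<longrightarrow> x \<in># sig \<sigma>' q) \<and>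
     (k = 2 \<longrightarrow> q \<in> nodes (shp \<sigma>) \<longrightarrow> C \<in># ant \<sigma> q \<longrightarrow> handledL C q \<sigma>') \<and>
     (k = 3 \<longrightarrow> q \<in> nodes (shp \<sigma>) \<longrightarrow> C \<in># suc \<sigma> q \<longrightarrow> handledR C q \<sigma>') \<and>
     (k = 4 \<longrightarrow> q \<in> nodes (shp \<sigma>) \<longrightarrow> AxD \<in> L \<longrightarrow> (\<exists>i. q @ [i] \<in> nodes (shp \<sigma>')))"

lemma good_fm_simps [simp]:
  "good_fm PS F (Imp A B) \<longleftrightarrow> good_fm PS F A \<and> good_fm PS F B"
  "good_fm PS F (Box A) \<longleftrightarrow> good_fm PS F A"
  "good_fm PS F (Eql x y) \<longleftrightarrow> x \<notin> F \<and> y \<notin> F"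
  by (auto simp: good_fm_def)

lemma good_fm_subst:
  "good_fm PS F (Forall x A) \<Longrightarrow> y \<notin> F \<Longrightarrow> good_fm PS F (A\<langle>y/x\<rangle>)"
  using bv_subst1[of y A x] by (auto simp: good_fm_def)

lemma step_adds_fm:
  assumes "open_stage PS L F \<sigma>" "q \<in> nodes (shp \<sigma>)" "good_fm PS F C"
    "adds_fm L (shp \<sigma>) (sig \<sigma>) (ant \<sigma>) (suc \<sigma>) q C"
  shows "\<exists>\<sigma>'. open_stage PS L F \<sigma>' \<and> ext \<sigma> \<sigma>' \<and> C \<in># ant \<sigma>' q"
proof -
  obtain s X \<Gamma> \<Delta> V where \<sigma>: "\<sigma> = Stage s X \<Gamma> \<Delta> V" by (cases \<sigma>)
  let ?\<sigma>' = "Stage s X (\<Gamma>(q := add_mset C (\<Gamma> q))) \<Delta> V"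
  have good: "good_labels PS F s X \<Gamma> \<Delta>"
    using assms(1) by (simp add: \<sigma> open_stage_def)
  have "good_labels PS F s X (\<Gamma>(q := add_mset C (\<Gamma> q))) \<Delta>"
    using good assms(3) by (auto simp: good_labels_def)
  moreover have "\<not> derivable_from PS L V (ns s X (\<Gamma>(q := add_mset C (\<Gamma> q))) \<Delta>)"
    using assms(1,4) derivable_from_unary[OF _ good_labels_ns(1,2)[OF good]]
    unfolding \<sigma> open_stage_def adds_fm_def by auto
  ultimately have "open_stage PS L F ?\<sigma>'"
    using assms(1) by (simp add: \<sigma> open_stage_def)
  moreover have "ext \<sigma> ?\<sigma>'"
    by (auto simp: \<sigma> ext_def)
  ultimately show ?thesis
    by (intro exI[of _ ?\<sigma>']) simp
qed

lemma step_adds_var: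
  assumes "open_stage PS L F \<sigma>" "q \<in> nodes (shp \<sigma>)" "x \<notin> F"
    "adds_var L (shp \<sigma>) (sig \<sigma>) (ant \<sigma>) (suc \<sigma>) q x"
  shows "\<exists>\<sigma>'. open_stage PS L F \<sigma>' \<and> ext \<sigma> \<sigma>' \<and> x \<in># sig \<sigma>' q"
proof -
  obtain s X \<Gamma> \<Delta> V where \<sigma>: "\<sigma> = Stage s X \<Gamma> \<Delta> V" by (cases \<sigma>)
  let ?\<sigma>' = "Stage s (X(q := add_mset x (X q))) \<Gamma> \<Delta> V"
  have good: "good_labels PS F s X \<Gamma> \<Delta>"
    using assms(1) by (simp add: \<sigma> open_stage_def)
  have "good_labels PS F s (X(q := add_mset x (X q))) \<Gamma> \<Delta>"
    using good assms(3) by (auto simp: good_labels_def)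
  moreover have "\<not> derivable_from PS L V (ns s (X(q := add_mset x (X q))) \<Gamma> \<Delta>)"
    using assms(1,4) derivable_from_unary[OF _ good_labels_ns(1,2)[OF good]]
    unfolding \<sigma> open_stage_def adds_var_def by auto
  ultimately have "open_stage PS L F ?\<sigma>'"
    using assms(1) by (simp add: \<sigma> open_stage_def)
  moreover have "ext \<sigma> ?\<sigma>'"
    by (auto simp: \<sigma> ext_def)
  ultimately show ?thesis
    by (intro exI[of _ ?\<sigma>']) simp
qed

text \<open>If both premisses were derivable from disjoint parts of the pool, the conclusion would
  be derivable from the whole pool. So one premiss stays open, and the search continues with it and
  its part.\<close>

lemma step_LImp:
  assumes "open_stage PS L F \<sigma>" "q \<in> nodes (shp \<sigma>)" "Imp A B \<in># ant \<sigma> q"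
  shows "\<exists>\<sigma>'. open_stage PS L F \<sigma>' \<and> ext \<sigma> \<sigma>' \<and> handledL (Imp A B) q \<sigma>'"
proof -
  obtain s X \<Gamma> \<Delta> V where \<sigma>: "\<sigma> = Stage s X \<Gamma> \<Delta> V" by (cases \<sigma>)
  have q: "q \<in> nodes s"
    using assms(2) by (simp add: \<sigma>)
  obtain \<Gamma>0 where \<Gamma>0: "\<Gamma> q = add_mset (Imp A B) \<Gamma>0"
    using assms(3) by (metis \<sigma> insert_DiffM stage.sel(3))
  have good: "good_labels PS F s X \<Gamma> \<Delta>" and V: "infinite V"
    and open_\<sigma>: "\<not> derivable_from PS L V (ns s X \<Gamma> \<Delta>)"
    using assms(1) by (auto simp: \<sigma> open_stage_def)
  have AB: "good_fm PS F A" "good_fm PS F B"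
    using good q \<Gamma>0 by (auto simp: good_labels_def dest!: bspec[of _ _ q])
  obtain V1 V2 where V12: "infinite V1" "infinite V2" "V1 \<inter> V2 = {}" "V1 \<union> V2 \<subseteq> V"
    by (rule infinite_split[OF V])
  let ?\<sigma>1 = "Stage s X (\<Gamma>(q := \<Gamma>0)) (\<Delta>(q := add_mset A (\<Delta> q))) V1"
  let ?\<sigma>2 = "Stage s X (\<Gamma>(q := add_mset B \<Gamma>0)) \<Delta> V2"
  obtain C where C: "has_holes C 1"
    and plug: "\<And>x g d. plug C [NS x g d {#}] = ns s (X(q := x)) (\<Gamma>(q := g)) (\<Delta>(q := d))"
    by (rule one_hole_exists[OF q, where X = X and \<Gamma> = \<Gamma> and \<Delta> = \<Delta>]) (rule that)
  have "rule_inst L [ns s X (\<Gamma>(q := \<Gamma>0)) (\<Delta>(q := add_mset A (\<Delta> q))), ns s X (\<Gamma>(q := add_mset B \<Gamma>0)) \<Delta>] []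
      (ns s X \<Gamma> \<Delta>)"
    using rule_inst.LImp[OF C, of L "X q" \<Gamma>0 A "\<Delta> q" B] by (simp add: plug flip: \<Gamma>0)
  then have "\<not> (derivable_from PS L V1 (ns s X (\<Gamma>(q := \<Gamma>0)) (\<Delta>(q := add_mset A (\<Delta> q)))) \<and>
      derivable_from PS L V2 (ns s X (\<Gamma>(q := add_mset B \<Gamma>0)) \<Delta>))"
    using derivable_from_binary[OF _ good_labels_ns(1,2)[OF good] _ _ V12(3)] open_\<sigma>
      derivable_from_mono[OF _ V12(4)] by blast
  moreover have "good_labels PS F s X (\<Gamma>(q := \<Gamma>0)) (\<Delta>(q := add_mset A (\<Delta> q)))"
    "good_labels PS F s X (\<Gamma>(q := add_mset B \<Gamma>0)) \<Delta>"
    using good AB \<Gamma>0 by (auto simp: good_labels_def)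
  ultimately have "open_stage PS L F ?\<sigma>1 \<or> open_stage PS L F ?\<sigma>2"
    using V12 by (auto simp: open_stage_def)
  moreover have "ext \<sigma> ?\<sigma>1" "ext \<sigma> ?\<sigma>2"
    using \<Gamma>0 by (auto simp: \<sigma> ext_def handledL_def)
  moreover have "handledL (Imp A B) q ?\<sigma>1" "handledL (Imp A B) q ?\<sigma>2"
    by (auto simp: handledL_def)
  ultimately show ?thesis by blast
qed

lemma step_RImp:
  assumes "open_stage PS L F \<sigma>" "q \<in> nodes (shp \<sigma>)" "Imp A B \<in># suc \<sigma> q"
  shows "\<exists>\<sigma>'. open_stage PS L F \<sigma>' \<and> ext \<sigma> \<sigma>' \<and> handledR (Imp A B) q \<sigma>'"
proof -
  obtain s X \<Gamma> \<Delta> V where \<sigma>: "\<sigma> = Stage s X \<Gamma> \<Delta> V" by (cases \<sigma>)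
  have q: "q \<in> nodes s"
    using assms(2) by (simp add: \<sigma>)
  obtain \<Delta>0 where \<Delta>0: "\<Delta> q = add_mset (Imp A B) \<Delta>0"
    using assms(3) by (metis \<sigma> insert_DiffM stage.sel(4))
  have good: "good_labels PS F s X \<Gamma> \<Delta>" and V: "infinite V"
    and open_\<sigma>: "\<not> derivable_from PS L V (ns s X \<Gamma> \<Delta>)"
    using assms(1) by (auto simp: \<sigma> open_stage_def)
  have AB: "good_fm PS F A" "good_fm PS F B"
    using good q \<Delta>0 by (auto simp: good_labels_def dest!: bspec[of _ _ q])
  let ?\<sigma>' = "Stage s X (\<Gamma>(q := add_mset A (\<Gamma> q))) (\<Delta>(q := add_mset B \<Delta>0)) V"
  have "rule_inst L [ns s (X(q := X q)) (\<Gamma>(q := add_mset A (\<Gamma> q))) (\<Delta>(q := add_mset B \<Delta>0))] []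
      (ns s X \<Gamma> \<Delta>)"
    by (rule one_hole_rule[OF q]) (simp add: \<Delta>0 rule_inst.RImp)
  then have "\<not> derivable_from PS L V (ns s X (\<Gamma>(q := add_mset A (\<Gamma> q))) (\<Delta>(q := add_mset B \<Delta>0)))"
    using derivable_from_unary[OF _ good_labels_ns(1,2)[OF good]] open_\<sigma> by auto
  moreover have "good_labels PS F s X (\<Gamma>(q := add_mset A (\<Gamma> q))) (\<Delta>(q := add_mset B \<Delta>0))"
    using good AB \<Delta>0 by (auto simp: good_labels_def)
  ultimately have "open_stage PS L F ?\<sigma>'"
    using V by (auto simp: open_stage_def)
  moreover have "ext \<sigma> ?\<sigma>'"
    using \<Delta>0 by (auto simp: \<sigma> ext_def handledR_def)
  moreover have "handledR (Imp A B) q ?\<sigma>'"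
    by (auto simp: handledR_def)
  ultimately show ?thesis by blast
qed

lemma step_RForall:
  assumes "open_stage PS L F \<sigma>" "finite F" "q \<in> nodes (shp \<sigma>)" "Forall x A \<in># suc \<sigma> q"
  shows "\<exists>\<sigma>'. open_stage PS L F \<sigma>' \<and> ext \<sigma> \<sigma>' \<and> handledR (Forall x A) q \<sigma>'"
proof -
  obtain s X \<Gamma> \<Delta> V where \<sigma>: "\<sigma> = Stage s X \<Gamma> \<Delta> V" by (cases \<sigma>)
  have q: "q \<in> nodes s"
    using assms(3) by (simp add: \<sigma>)
  obtain \<Delta>0 where \<Delta>0: "\<Delta> q = add_mset (Forall x A) \<Delta>0"
    using assms(4) by (metis \<sigma> insert_DiffM stage.sel(4))
  have good: "good_labels PS F s X \<Gamma> \<Delta>" and V: "infinite V"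
    and open_\<sigma>: "\<not> derivable_from PS L V (ns s X \<Gamma> \<Delta>)"
    using assms(1) by (auto simp: \<sigma> open_stage_def)
  have "finite (free_vars (ns s X \<Gamma> \<Delta>) \<union> F)"
    using assms(2) by (simp add: free_vars_def)
  \<comment> \<open>Avoiding \<open>F\<close> keeps the premiss pure and \<open>y\<close> distinct
    from the bound variables; avoiding the free variables as well gives the eigenvariable
    condition.\<close>
  then obtain y where y: "y \<in> V" "y \<notin> free_vars (ns s X \<Gamma> \<Delta>)" "y \<notin> F"
    using V by (metis UnCI infinite_super subsetI)
  have fresh: "y \<notin> free_vars (ns s X \<Gamma> \<Delta>) \<union> bound_vars (ns s X \<Gamma> \<Delta>)"
    using y good_labels_ns(3)[OF good] by auto
  have A: "good_fm PS F (A\<langle>y/x\<rangle>)"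
    by (rule good_fm_subst) (use good q \<Delta>0 y in \<open>auto simp: good_labels_def\<close>)
  let ?X = "X(q := add_mset y (X q))" and ?\<Delta> = "\<Delta>(q := add_mset (A\<langle>y/x\<rangle>) \<Delta>0)"
  let ?\<sigma>' = "Stage s ?X \<Gamma> ?\<Delta> (V - {y})"
  obtain C where C: "has_holes C 1"
    and plug: "\<And>x g d. plug C [NS x g d {#}] = ns s (X(q := x)) (\<Gamma>(q := g)) (\<Delta>(q := d))"
    by (rule one_hole_exists[OF q, where X = X and \<Gamma> = \<Gamma> and \<Delta> = \<Delta>]) (rule that)
  have "ns s X \<Gamma> \<Delta> = plug C [NS (X q) (\<Gamma> q) (add_mset (Forall x A) \<Delta>0) {#}]"
    by (simp add: plug flip: \<Delta>0)
  from rule_inst.RForall[OF C this fresh, of L]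
  have "rule_inst L [ns s ?X \<Gamma> ?\<Delta>] [y] (ns s X \<Gamma> \<Delta>)"
    by (simp add: plug)
  then have "\<not> derivable_from PS L (V - {y}) (ns s ?X \<Gamma> ?\<Delta>)"
    using derivable_from_eigen[OF _ good_labels_ns(1,2)[OF good] _ y(1)] open_\<sigma> by auto
  moreover have "good_labels PS F s ?X \<Gamma> ?\<Delta>"
    using good A y \<Delta>0 by (auto simp: good_labels_def)
  ultimately have "open_stage PS L F ?\<sigma>'"
    using V by (auto simp: open_stage_def)
  moreover have "ext \<sigma> ?\<sigma>'"
    using \<Delta>0 by (auto simp: \<sigma> ext_def handledR_def)
  moreover have "handledR (Forall x A) q ?\<sigma>'"
    by (auto simp: handledR_def)
  ultimately show ?thesis by blast
qed

text \<open>The two rules that create a node: \<open>\<Delta>0\<close> is what remains of the succedent of its parent.\<close>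

lemma step_new_child:
  assumes "open_stage PS L F \<sigma>" "q \<in> nodes (shp \<sigma>)" "\<And>A. A \<in># d \<Longrightarrow> good_fm PS F A" "\<Delta>0 \<subseteq># suc \<sigma> q"
    and rule: "\<And>C. has_holes C 1 \<Longrightarrow> rule_inst L
      [plug C [NS (sig \<sigma> q) (ant \<sigma> q) \<Delta>0 {# NS {#} {#} d {#} #}]] []
      (plug C [NS (sig \<sigma> q) (ant \<sigma> q) (suc \<sigma> q) {#}])"
    and keep: "\<And>A. A \<in># suc \<sigma> q \<Longrightarrow> A \<in># \<Delta>0 \<or> (\<exists>B. A = Box B \<and> B \<in># d)"
  shows "\<exists>\<sigma>' i. open_stage PS L F \<sigma>' \<and> ext \<sigma> \<sigma>' \<and> q @ [i] \<in> nodes (shp \<sigma>') \<and> suc \<sigma>' (q @ [i]) = d"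
proof -
  obtain s X \<Gamma> \<Delta> V where \<sigma>: "\<sigma> = Stage s X \<Gamma> \<Delta> V" by (cases \<sigma>)
  have q: "q \<in> nodes s"
    using assms(2) by (simp add: \<sigma>)
  have good: "good_labels PS F s X \<Gamma> \<Delta>" and V: "infinite V"
    and open_\<sigma>: "\<not> derivable_from PS L V (ns s X \<Gamma> \<Delta>)"
    using assms(1) by (auto simp: \<sigma> open_stage_def)
  obtain s' n C where n: "q @ [n] \<notin> nodes s" and s': "nodes s' = insert (q @ [n]) (nodes s)"
    and C: "has_holes C 1" and plug:
    "\<forall>X' \<Gamma>' \<Delta>'. (\<forall>r. r \<noteq> q \<longrightarrow> r \<noteq> q @ [n] \<longrightarrow> X' r = X r \<and> \<Gamma>' r = \<Gamma> r \<and> \<Delta>' r = \<Delta> r) \<longrightarrow>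
      ns s X' \<Gamma>' \<Delta>' = plug C [NS (X' q) (\<Gamma>' q) (\<Delta>' q) {#}] \<and>
      ns s' X' \<Gamma>' \<Delta>' = plug C [NS (X' q) (\<Gamma>' q) (\<Delta>' q)
        {# NS (X' (q @ [n])) (\<Gamma>' (q @ [n])) (\<Delta>' (q @ [n])) {#} #}]"
    using add_child_exists[OF q, of X \<Gamma> \<Delta>] by (elim exE conjE) (rule that)
  let ?X = "X(q @ [n] := {#})" and ?\<Gamma> = "\<Gamma>(q @ [n] := {#})" and ?\<Delta> = "\<Delta>(q := \<Delta>0, q @ [n] := d)"
  let ?\<sigma>' = "Stage s' ?X ?\<Gamma> ?\<Delta> V"
  have "ns s X \<Gamma> \<Delta> = plug C [NS (X q) (\<Gamma> q) (\<Delta> q) {#}]"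
    by (rule plug[rule_format, THEN conjunct1]) simp
  moreover have "ns s' ?X ?\<Gamma> ?\<Delta> = plug C [NS (?X q) (?\<Gamma> q) (?\<Delta> q)
        {# NS (?X (q @ [n])) (?\<Gamma> (q @ [n])) (?\<Delta> (q @ [n])) {#} #}]"
    by (rule plug[rule_format, THEN conjunct2]) simp
  ultimately have "rule_inst L [ns s' ?X ?\<Gamma> ?\<Delta>] [] (ns s X \<Gamma> \<Delta>)"
    using rule[OF C] by (simp add: \<sigma>)
  then have "\<not> derivable_from PS L V (ns s' ?X ?\<Gamma> ?\<Delta>)"
    using derivable_from_unary[OF _ good_labels_ns(1,2)[OF good]] open_\<sigma> by auto
  moreover have "good_labels PS F s' ?X ?\<Gamma> ?\<Delta>"
    using good assms(3,4) s' q by (auto simp: good_labels_def \<sigma> dest: mset_subset_eqD)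
  ultimately have "open_stage PS L F ?\<sigma>'"
    using V by (auto simp: open_stage_def)
  moreover have "A \<in># suc ?\<sigma>' p \<or> \<not> atomic A \<and> handledR A p ?\<sigma>'"
    if "p \<in> nodes s" "A \<in># \<Delta> p" for p A
  proof (cases "p = q")
    case True
    then have "A \<in># \<Delta>0 \<or> (\<exists>B. A = Box B \<and> B \<in># d)"
      using keep that(2) by (simp add: \<sigma>)
    then show ?thesis
      using s' True by (auto simp: handledR_def)
  next
    case False
    moreover have "p \<noteq> q @ [n]"
      using n that(1) by blast
    ultimately show ?thesis
      using that(2) by simp
  qed
  then have "ext \<sigma> ?\<sigma>'"
    using n s' by (auto simp: \<sigma> ext_def)
  moreover have "q @ [n] \<in> nodes (shp ?\<sigma>')" "suc ?\<sigma>' (q @ [n]) = d"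
    using s' by auto
  ultimately show ?thesis by blast
qed

lemma step_RBox:
  assumes "open_stage PS L F \<sigma>" "q \<in> nodes (shp \<sigma>)" "Box A \<in># suc \<sigma> q"
  shows "\<exists>\<sigma>'. open_stage PS L F \<sigma>' \<and> ext \<sigma> \<sigma>' \<and> handledR (Box A) q \<sigma>'"
proof -
  obtain \<Delta>0 where \<Delta>0: "suc \<sigma> q = add_mset (Box A) \<Delta>0"
    using assms(3) by (metis insert_DiffM)
  have "good_fm PS F (Box A)"
    using assms unfolding open_stage_def good_labels_def by blast
  then have "\<exists>\<sigma>' i. open_stage PS L F \<sigma>' \<and> ext \<sigma> \<sigma>' \<and> q @ [i] \<in> nodes (shp \<sigma>') \<and> suc \<sigma>' (q @ [i]) = {#A#}"
    by (intro step_new_child[OF assms(1,2), of _ \<Delta>0]) (auto simp: \<Delta>0 intro: rule_inst.RBox)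
  then show ?thesis
    by (force simp: handledR_def)
qed

lemma step_RD:
  assumes "open_stage PS L F \<sigma>" "q \<in> nodes (shp \<sigma>)" "AxD \<in> L"
  shows "\<exists>\<sigma>' i. open_stage PS L F \<sigma>' \<and> ext \<sigma> \<sigma>' \<and> q @ [i] \<in> nodes (shp \<sigma>')"
proof -
  have "\<exists>\<sigma>' i. open_stage PS L F \<sigma>' \<and> ext \<sigma> \<sigma>' \<and> q @ [i] \<in> nodes (shp \<sigma>') \<and> suc \<sigma>' (q @ [i]) = {#}"
    by (rule step_new_child[OF assms(1,2), of "{#}" "suc \<sigma> q"]) (auto intro: rule_inst.RD[OF assms(3)])
  then show ?thesis by blast
qed

lemma step_exists:
  assumes "open_stage PS L F \<sigma>" "finite F"
  shows "\<exists>\<sigma>'. open_stage PS L F \<sigma>' \<and> ext \<sigma> \<sigma>' \<and> fulfils PS L F k q C x \<sigma> \<sigma>'"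
proof (cases "q \<in> nodes (shp \<sigma>)")
  case False
  then show ?thesis
    using assms(1) ext_refl by (auto simp: fulfils_def)
next
  case q: True
  note * = step_adds_fm[OF assms(1) q] step_adds_var[OF assms(1) q] step_LImp[OF assms(1) q]
    step_RImp[OF assms(1) q] step_RForall[OF assms q] step_RBox[OF assms(1) q] step_RD[OF assms(1) q]
  consider "k = 0" | "k = 1" | "k = 2" | "k = 3" | "k = 4" | "k > 4"
    by linarith
  then show ?thesis
  proof cases
    case 1
    then show ?thesis
      using *(1)[of C] assms(1) ext_refl
      by (cases "good_fm PS F C \<and> adds_fm L (shp \<sigma>) (sig \<sigma>) (ant \<sigma>) (suc \<sigma>) q C")
        (auto simp: fulfils_def)
  next
    case 2
    then show ?thesis
      using *(2)[of x] assms(1) ext_refl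
      by (cases "x \<notin> F \<and> adds_var L (shp \<sigma>) (sig \<sigma>) (ant \<sigma>) (suc \<sigma>) q x") (auto simp: fulfils_def)
  next
    case 3
    show ?thesis
    proof (cases "C \<in># ant \<sigma> q \<and> (\<exists>A B. C = Imp A B)")
      case True
      then show ?thesis
        using *(3) 3 by (auto simp: fulfils_def)
    next
      case False
      then show ?thesis
        using assms(1) ext_refl 3 by (auto simp: fulfils_def handledL_def)
    qed
  next
    case 4
    have "\<exists>\<sigma>'. open_stage PS L F \<sigma>' \<and> ext \<sigma> \<sigma>' \<and> handledR C q \<sigma>'" if "C \<in># suc \<sigma> q"
    proof (cases C)
      case (Imp A B)
      then show ?thesis using *(4) that by simp
    next
      case (Forall y A)
      then show ?thesis using *(5) that by simp
    next
      case (Box A)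
      then show ?thesis using *(6) that by simp
    qed (use assms(1) ext_refl in \<open>auto simp: handledR_def\<close>)
    then show ?thesis
      using assms(1) ext_refl 4 by (cases "C \<in># suc \<sigma> q") (auto simp: fulfils_def)
  next
    case 5
    then show ?thesis
      using *(7) assms(1) ext_refl by (cases "AxD \<in> L") (auto simp: fulfils_def)
  next
    case 6
    then show ?thesis
      using assms(1) ext_refl by (auto simp: fulfils_def)
  qed
qed

section \<open>The limit of a fair search\<close>

locale search_run =
  fixes PS :: "nat \<Rightarrow> 'p set" and L :: "ax set" and F :: "var set" and \<sigma> :: "nat \<Rightarrow> 'p stage"
  assumes finite_F: "finite F"
    and open_stages: "open_stage PS L F (\<sigma> n)"
    and ext_stages: "ext (\<sigma> n) (\<sigma> (Suc n))"
    and fair: "wff PS C \<Longrightarrow> \<exists>m\<ge>n. fulfils PS L F k q C x (\<sigma> m) (\<sigma> (Suc m))"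
begin

definition T where "T = (\<Union>n. nodes (shp (\<sigma> n)))"
definition X where "X p = {x. \<exists>n. p \<in> nodes (shp (\<sigma> n)) \<and> x \<in># sig (\<sigma> n) p}"
definition G where "G p = {A. \<exists>n. p \<in> nodes (shp (\<sigma> n)) \<and> A \<in># ant (\<sigma> n) p}"
definition H where "H p = {A. \<exists>n. p \<in> nodes (shp (\<sigma> n)) \<and> A \<in># suc (\<sigma> n) p}"

lemma nodes_mono: "n \<le> m \<Longrightarrow> p \<in> nodes (shp (\<sigma> n)) \<Longrightarrow> p \<in> nodes (shp (\<sigma> m))"
  by (induction rule: dec_induct) (use ext_stages in \<open>auto simp: ext_def\<close>)

lemma sig_mono:
  assumes "n \<le> m" "p \<in> nodes (shp (\<sigma> n))" "x \<in># sig (\<sigma> n) p"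
  shows "x \<in># sig (\<sigma> m) p"
  using assms(1)
proof (induction rule: dec_induct)
  case base
  then show ?case using assms by simp
next
  case (step m)
  then show ?case
    using ext_stages[of m] nodes_mono[OF _ assms(2)] unfolding ext_def by blast
qed

text \<open>A formula disappears only through its own decomposition. The stage \<open>k\<close> of
  that decomposition is kept apart from \<open>m\<close>, since its results may have been decomposed
  in turn by then.\<close>

lemma ant_mono:
  assumes "n \<le> m" "p \<in> nodes (shp (\<sigma> n))" "C \<in># ant (\<sigma> n) p"
  shows "C \<in># ant (\<sigma> m) p \<or> (\<exists>A B. C = Imp A B) \<and> (\<exists>k. p \<in> nodes (shp (\<sigma> k)) \<and> handledL C p (\<sigma> k))"
  using assms(1)
proof (induction rule: dec_induct)
  case base
  then show ?case using assms by simp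
next
  case (step m)
  then show ?case
    using ext_stages[of m] nodes_mono[OF _ assms(2)] unfolding ext_def
    by (meson le_SucI)
qed

lemma suc_mono:
  assumes "n \<le> m" "p \<in> nodes (shp (\<sigma> n))" "C \<in># suc (\<sigma> n) p"
  shows "C \<in># suc (\<sigma> m) p \<or> \<not> atomic C \<and> (\<exists>k. p \<in> nodes (shp (\<sigma> k)) \<and> handledR C p (\<sigma> k))"
  using assms(1)
proof (induction rule: dec_induct)
  case base
  then show ?case using assms by simp
next
  case (step m)
  then show ?case
    using ext_stages[of m] nodes_mono[OF _ assms(2)] unfolding ext_def
    by (meson le_SucI)
qed

lemma eventually_T: "p \<in> T \<Longrightarrow> eventually (\<lambda>n. p \<in> nodes (shp (\<sigma> n))) sequentially"
  unfolding T_def eventually_sequentially using nodes_mono by blast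

lemma eventually_X: "x \<in> X p \<Longrightarrow> eventually (\<lambda>n. x \<in># sig (\<sigma> n) p) sequentially"
  unfolding X_def eventually_sequentially using sig_mono by blast

text \<open>Rules with several displayed parts need them all in one stage, whereas \<open>G\<close>,
  \<open>H\<close> and \<open>X\<close> only record that each occurs in some stage. Persistence from
  some stage on brings them together.\<close>

lemma eventually_G: "C \<in> G p \<Longrightarrow> (\<And>A B. C \<noteq> Imp A B) \<Longrightarrow> eventually (\<lambda>n. C \<in># ant (\<sigma> n) p) sequentially"
  unfolding G_def eventually_sequentially using ant_mono by blast

lemma eventually_H: "C \<in> H p \<Longrightarrow> atomic C \<Longrightarrow> eventually (\<lambda>n. C \<in># suc (\<sigma> n) p) sequentially"
  unfolding H_def eventually_sequentially using suc_mono by blast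

lemma good_stages: "good_labels PS F (shp (\<sigma> n)) (sig (\<sigma> n)) (ant (\<sigma> n)) (suc (\<sigma> n))"
  using open_stages[of n] by (simp add: open_stage_def)

lemma not_axiom: "\<not> rule_inst L [] [] (ns (shp (\<sigma> n)) (sig (\<sigma> n)) (ant (\<sigma> n)) (suc (\<sigma> n)))"
  using open_stages[of n] derivable_from_axiom[OF _ good_labels_ns(1,2)[OF good_stages]]
  unfolding open_stage_def by blast

lemma XT: "x \<in> X p \<Longrightarrow> p \<in> T \<and> x \<notin> F"
  using good_stages unfolding X_def T_def good_labels_def by blast

lemma GT: "A \<in> G p \<Longrightarrow> p \<in> T \<and> good_fm PS F A"
  using good_stages unfolding G_def T_def good_labels_def by blast

lemma HT: "A \<in> H p \<Longrightarrow> p \<in> T \<and> good_fm PS F A"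
  using good_stages unfolding H_def T_def good_labels_def by blast

lemma wff_good: "good_fm PS F A \<Longrightarrow> wff PS A"
  by (simp add: good_fm_def)

text \<open>Once the rule is applicable for good, it is applied at some later stage, because
  fairness reaches beyond every \<open>n\<close>.\<close>

lemma adds_fm_limit:
  assumes "q \<in> T" "good_fm PS F C"
    "eventually (\<lambda>n. adds_fm L (shp (\<sigma> n)) (sig (\<sigma> n)) (ant (\<sigma> n)) (suc (\<sigma> n)) q C) sequentially"
  shows "C \<in> G q"
proof -
  obtain n where n: "\<And>m. m \<ge> n \<Longrightarrow> q \<in> nodes (shp (\<sigma> m)) \<and>
      adds_fm L (shp (\<sigma> m)) (sig (\<sigma> m)) (ant (\<sigma> m)) (suc (\<sigma> m)) q C"
    using eventually_conj[OF eventually_T[OF assms(1)] assms(3)] unfolding eventually_sequentially by blast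
  obtain m where m: "m \<ge> n" "fulfils PS L F 0 q C x (\<sigma> m) (\<sigma> (Suc m))" for x
    using fair[OF wff_good[OF assms(2)], of n 0 q] by (auto simp: fulfils_def)
  then have "C \<in># ant (\<sigma> (Suc m)) q"
    using n[OF m(1)] assms(2) unfolding fulfils_def by blast
  moreover have "q \<in> nodes (shp (\<sigma> (Suc m)))"
    using n[of "Suc m"] m(1) by simp
  ultimately show ?thesis
    unfolding G_def by blast
qed

lemma adds_var_limit:
  assumes "q \<in> T" "x \<notin> F"
    "eventually (\<lambda>n. adds_var L (shp (\<sigma> n)) (sig (\<sigma> n)) (ant (\<sigma> n)) (suc (\<sigma> n)) q x) sequentially"
  shows "x \<in> X q"
proof -
  obtain n where n: "\<And>m. m \<ge> n \<Longrightarrow> q \<in> nodes (shp (\<sigma> m)) \<and>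
      adds_var L (shp (\<sigma> m)) (sig (\<sigma> m)) (ant (\<sigma> m)) (suc (\<sigma> m)) q x"
    using eventually_conj[OF eventually_T[OF assms(1)] assms(3)] unfolding eventually_sequentially by blast
  obtain m where m: "m \<ge> n" "fulfils PS L F 1 q Falsum x (\<sigma> m) (\<sigma> (Suc m))"
    using fair[of Falsum n 1 q x] by auto
  then have "x \<in># sig (\<sigma> (Suc m)) q"
    using n[OF m(1)] assms(2) unfolding fulfils_def by blast
  moreover have "q \<in> nodes (shp (\<sigma> (Suc m)))"
    using n[of "Suc m"] m(1) by simp
  ultimately show ?thesis
    unfolding X_def by blast
qed

text \<open>Fairness schedules the formula at some stage \<open>m\<close>. Either it is still
  present and gets decomposed then, or it has already vanished through its decomposition.\<close>

lemma handledL_limit: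
  assumes "C \<in> G p" "C = Imp A B"
  shows "\<exists>k. p \<in> nodes (shp (\<sigma> k)) \<and> handledL C p (\<sigma> k)"
proof -
  obtain n where n: "p \<in> nodes (shp (\<sigma> n))" "C \<in># ant (\<sigma> n) p"
    using assms by (auto simp: G_def)
  obtain m where m: "m \<ge> n" "fulfils PS L F 2 p C 0 (\<sigma> m) (\<sigma> (Suc m))"
    using fair[of C n 2 p 0] GT[OF assms(1)] wff_good by blast
  have p: "p \<in> nodes (shp (\<sigma> m))" "p \<in> nodes (shp (\<sigma> (Suc m)))"
    using nodes_mono[OF _ n(1)] m(1) by simp_all
  show ?thesis
  proof (cases "C \<in># ant (\<sigma> m) p")
    case True
    then have "handledL C p (\<sigma> (Suc m))"
      using m(2) p(1) by (simp add: fulfils_def)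
    then show ?thesis using p(2) by blast
  next
    case False
    then show ?thesis using ant_mono[OF m(1) n] by blast
  qed
qed

lemma handledR_limit:
  assumes "C \<in> H p"
  shows "\<exists>k. p \<in> nodes (shp (\<sigma> k)) \<and> handledR C p (\<sigma> k)"
proof -
  obtain n where n: "p \<in> nodes (shp (\<sigma> n))" "C \<in># suc (\<sigma> n) p"
    using assms by (auto simp: H_def)
  obtain m where m: "m \<ge> n" "fulfils PS L F 3 p C 0 (\<sigma> m) (\<sigma> (Suc m))"
    using fair[of C n 3 p 0] HT[OF assms(1)] wff_good by blast
  have p: "p \<in> nodes (shp (\<sigma> m))" "p \<in> nodes (shp (\<sigma> (Suc m)))"
    using nodes_mono[OF _ n(1)] m(1) by simp_all
  show ?thesis
  proof (cases "C \<in># suc (\<sigma> m) p")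
    case True
    then have "handledR C p (\<sigma> (Suc m))"
      using m(2) p(1) by (simp add: fulfils_def)
    then show ?thesis using p(2) by blast
  next
    case False
    then show ?thesis using suc_mono[OF m(1) n] by blast
  qed
qed

text \<open>Atomic formulas are never consumed, so the occurrences on both sides meet in one stage,
  which would then be an initial sequent.\<close>

lemma no_axiom_Init:
  assumes "atomic P" "P \<in> G p"
  shows "P \<notin> H p"
proof
  assume "P \<in> H p"
  moreover have "p \<in> T" "P \<noteq> Imp A B" for A B
    using GT assms by auto
  ultimately have "eventually (\<lambda>n. p \<in> nodes (shp (\<sigma> n)) \<and> P \<in># ant (\<sigma> n) p \<and> P \<in># suc (\<sigma> n) p) sequentially"
    using assms eventually_T eventually_G eventually_H by (intro eventually_conj) auto
  then obtain n where n: "p \<in> nodes (shp (\<sigma> n))" "P \<in># ant (\<sigma> n) p" "P \<in># suc (\<sigma> n) p"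
    unfolding eventually_sequentially by blast
  obtain \<Gamma>0 \<Delta>0 where eq: "ant (\<sigma> n) p = add_mset P \<Gamma>0" "suc (\<sigma> n) p = add_mset P \<Delta>0"
    using n by (metis insert_DiffM)
  obtain C where C: "has_holes C 1" and plug: "\<And>x g d. plug C [NS x g d {#}] =
      ns (shp (\<sigma> n)) ((sig (\<sigma> n))(p := x)) ((ant (\<sigma> n))(p := g)) ((suc (\<sigma> n))(p := d))"
    by (rule one_hole_exists[OF n(1), where X = "sig (\<sigma> n)" and \<Gamma> = "ant (\<sigma> n)" and \<Delta> = "suc (\<sigma> n)"])
      (rule that)
  show False
    using rule_inst.Init[OF C assms(1), of L "sig (\<sigma> n) p" \<Gamma>0 \<Delta>0] not_axiom[of n]
    by (simp add: plug flip: eq)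
qed

lemma no_axiom_Falsum: "Falsum \<notin> G p"
proof
  assume "Falsum \<in> G p"
  then obtain n where n: "p \<in> nodes (shp (\<sigma> n))" "Falsum \<in># ant (\<sigma> n) p"
    by (auto simp: G_def)
  obtain \<Gamma>0 where eq: "ant (\<sigma> n) p = add_mset Falsum \<Gamma>0"
    using n by (metis insert_DiffM)
  obtain C where C: "has_holes C 1" and plug: "\<And>x g d. plug C [NS x g d {#}] =
      ns (shp (\<sigma> n)) ((sig (\<sigma> n))(p := x)) ((ant (\<sigma> n))(p := g)) ((suc (\<sigma> n))(p := d))"
    by (rule one_hole_exists[OF n(1), where X = "sig (\<sigma> n)" and \<Gamma> = "ant (\<sigma> n)" and \<Delta> = "suc (\<sigma> n)"])
      (rule that)
  show False
    using rule_inst.LBot[OF C, of L "sig (\<sigma> n) p" \<Gamma>0 "suc (\<sigma> n) p"] not_axiom[of n]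
    by (simp add: plug flip: eq)
qed

lemma saturated_limit:
  assumes "AxT \<in> L \<Longrightarrow> Ax5 \<in> L \<Longrightarrow> Ax4 \<in> L"
    and "AxB \<in> L \<Longrightarrow> Ax5 \<in> L \<Longrightarrow> Ax4 \<in> L"
    and "AxB \<in> L \<Longrightarrow> Ax4 \<in> L \<Longrightarrow> Ax5 \<in> L"
    and "AxB \<in> L \<Longrightarrow> AxCBF \<in> L \<longleftrightarrow> AxBF \<in> L"
    and "AxT \<in> L \<Longrightarrow> Ax5 \<in> L \<Longrightarrow> AxCBF \<in> L \<longleftrightarrow> AxBF \<in> L"
  shows "saturated PS L F T X G H"
proof
  show "finite F" by (rule finite_F)
  show "[] \<in> T"
    by (simp add: T_def)
  show prefix: "p \<in> T" if "p @ [i] \<in> T" for p i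
    using that append_in_nodes unfolding T_def by blast
  show "p \<in> T \<and> x \<notin> F" if "x \<in> X p" for x p
    using that by (rule XT)
  show "p \<in> T \<and> good_fm PS F A" if "A \<in> G p" for A p
    using that by (rule GT)
  show "p \<in> T \<and> good_fm PS F A" if "A \<in> H p" for A p
    using that by (rule HT)
  show "P \<notin> H p" if "atomic P" "P \<in> G p" for P p
    using that by (rule no_axiom_Init)
  show "Falsum \<notin> G p" for p
    by (rule no_axiom_Falsum)
  show "A \<in> H p \<or> B \<in> G p" if "Imp A B \<in> G p" for A B p
    using handledL_limit[OF that] by (auto simp: handledL_def G_def H_def)
  show "A \<in> G p \<and> B \<in> H p" if "Imp A B \<in> H p" for A B p
    using handledR_limit[OF that] by (auto simp: handledR_def G_def H_def)
  show "\<exists>z\<in>X p. A\<langle>z/x\<rangle> \<in> H p" if "Forall x A \<in> H p" for x A p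
    using handledR_limit[OF that] unfolding handledR_def X_def H_def by blast
  show "\<exists>i. p @ [i] \<in> T \<and> A \<in> H (p @ [i])" if "Box A \<in> H p" for A p
    using handledR_limit[OF that] unfolding handledR_def T_def H_def by blast
  show "A\<langle>z/x\<rangle> \<in> G p" if "Forall x A \<in> G p" "z \<in> X p" for x A p z
  proof (rule adds_fm_limit)
    show "good_fm PS F (A\<langle>z/x\<rangle>)"
      using good_fm_subst GT[OF that(1)] XT[OF that(2)] by blast
    have "eventually (\<lambda>n. p \<in> nodes (shp (\<sigma> n))) sequentially"
      "eventually (\<lambda>n. z \<in># sig (\<sigma> n) p) sequentially"
      "eventually (\<lambda>n. Forall x A \<in># ant (\<sigma> n) p) sequentially"
      using that GT eventually_T eventually_X eventually_G by auto
    then show "eventually (\<lambda>n. adds_fm L (shp (\<sigma> n)) (sig (\<sigma> n)) (ant (\<sigma> n)) (suc (\<sigma> n)) p (A\<langle>z/x\<rangle>)) sequentially"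
      by eventually_elim (rule adds_LForall)
  qed (use GT that in blast)
  show "A \<in> G (p @ [i])" if "Box A \<in> G p" "p @ [i] \<in> T" for A p i
  proof (rule adds_fm_limit[OF that(2)])
    show "good_fm PS F A"
      using GT[OF that(1)] by simp
    have "eventually (\<lambda>n. p @ [i] \<in> nodes (shp (\<sigma> n))) sequentially"
      "eventually (\<lambda>n. Box A \<in># ant (\<sigma> n) p) sequentially"
      using that eventually_T eventually_G by auto
    then show "eventually (\<lambda>n. adds_fm L (shp (\<sigma> n)) (sig (\<sigma> n)) (ant (\<sigma> n)) (suc (\<sigma> n)) (p @ [i]) A) sequentially"
      by eventually_elim (rule adds_LBox)
  qed
  show "Eql x x \<in> G p" if "p \<in> T" "x \<notin> F" for p x
  proof (rule adds_fm_limit[OF that(1)])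
    show "eventually (\<lambda>n. adds_fm L (shp (\<sigma> n)) (sig (\<sigma> n)) (ant (\<sigma> n)) (suc (\<sigma> n)) p (Eql x x)) sequentially"
      using eventually_T[OF that(1)] by eventually_elim (rule adds_Ref)
  qed (use that in simp)
  show "P\<langle>y/z\<rangle> \<in> G p"
    if "atomic P" "Eql x y \<in> G p" "P\<langle>x/z\<rangle> \<in> G p" "Eql x y \<noteq> P\<langle>x/z\<rangle>" for P x y z p
  proof (rule adds_fm_limit)
    show "p \<in> T"
      using GT that(2) by blast
    have "y \<notin> F"
      using GT[OF that(2)] by simp
    \<comment> \<open>\<open>P\<close> is only a pattern, and its place holder \<open>z\<close> may
      belong to \<open>F\<close>; goodness is therefore read off from the instance with
      \<open>x\<close>.\<close>
    then show "good_fm PS F (P\<langle>y/z\<rangle>)"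
      using GT[OF that(3)] bv_subst1 that(1) by (cases P) (auto simp: good_fm_def split: if_splits)
    have "P\<langle>x/z\<rangle> \<noteq> Imp A B" for A B
      using that(1) by (cases P) auto
    then have "eventually (\<lambda>n. p \<in> nodes (shp (\<sigma> n))) sequentially"
      "eventually (\<lambda>n. Eql x y \<in># ant (\<sigma> n) p) sequentially"
      "eventually (\<lambda>n. P\<langle>x/z\<rangle> \<in># ant (\<sigma> n) p) sequentially"
      using that GT eventually_T eventually_G by auto
    then show "eventually (\<lambda>n. adds_fm L (shp (\<sigma> n)) (sig (\<sigma> n)) (ant (\<sigma> n)) (suc (\<sigma> n)) p (P\<langle>y/z\<rangle>)) sequentially"
      by eventually_elim (rule adds_Repl[OF _ that(1) _ _ that(4)])
  qed
  show "y \<in> X p" if "Eql x y \<in> G p" "x \<in> X p" for x y p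
  proof (rule adds_var_limit)
    show "p \<in> T" "y \<notin> F"
      using GT[OF that(1)] by simp_all
    have "eventually (\<lambda>n. p \<in> nodes (shp (\<sigma> n))) sequentially"
      "eventually (\<lambda>n. Eql x y \<in># ant (\<sigma> n) p) sequentially"
      "eventually (\<lambda>n. x \<in># sig (\<sigma> n) p) sequentially"
      using that GT eventually_T eventually_G eventually_X by auto
    then show "eventually (\<lambda>n. adds_var L (shp (\<sigma> n)) (sig (\<sigma> n)) (ant (\<sigma> n)) (suc (\<sigma> n)) p y) sequentially"
      by eventually_elim (rule adds_ReplX)
  qed
  show "Eql x y \<in> G q" if "Eql x y \<in> G p" "q \<in> T" for x y p q
  proof (rule adds_fm_limit[OF that(2)])
    show "good_fm PS F (Eql x y)"
      using GT[OF that(1)] by blast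
    have "eventually (\<lambda>n. p \<in> nodes (shp (\<sigma> n))) sequentially"
      "eventually (\<lambda>n. q \<in> nodes (shp (\<sigma> n))) sequentially"
      "eventually (\<lambda>n. Eql x y \<in># ant (\<sigma> n) p) sequentially"
      using that GT eventually_T eventually_G by auto
    then show "eventually (\<lambda>n. adds_fm L (shp (\<sigma> n)) (sig (\<sigma> n)) (ant (\<sigma> n)) (suc (\<sigma> n)) q (Eql x y)) sequentially"
      by eventually_elim (rule adds_Rig)
  qed
  show "\<exists>i. p @ [i] \<in> T" if D: "AxD \<in> L" and p: "p \<in> T" for p
  proof -
    obtain n where n: "p \<in> nodes (shp (\<sigma> n))"
      using p by (auto simp: T_def)
    obtain m where m: "m \<ge> n" "fulfils PS L F 4 p Falsum 0 (\<sigma> m) (\<sigma> (Suc m))"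
      using fair[of Falsum n 4 p 0] by auto
    have "p \<in> nodes (shp (\<sigma> m))"
      using nodes_mono[OF m(1) n] .
    then obtain i where "p @ [i] \<in> nodes (shp (\<sigma> (Suc m)))"
      using m(2) D by (auto simp: fulfils_def)
    then show ?thesis
      unfolding T_def by blast
  qed
  show "A \<in> G p" if "AxT \<in> L" "Box A \<in> G p" for A p
  proof (rule adds_fm_limit)
    show "p \<in> T" "good_fm PS F A"
      using GT[OF that(2)] by simp_all
    have "eventually (\<lambda>n. p \<in> nodes (shp (\<sigma> n))) sequentially"
      "eventually (\<lambda>n. Box A \<in># ant (\<sigma> n) p) sequentially"
      using that GT eventually_T eventually_G by auto
    then show "eventually (\<lambda>n. adds_fm L (shp (\<sigma> n)) (sig (\<sigma> n)) (ant (\<sigma> n)) (suc (\<sigma> n)) p A) sequentially"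
      by eventually_elim (rule adds_RT[OF that(1)])
  qed
  show "A \<in> G p" if "AxB \<in> L" "Box A \<in> G (p @ [i])" for A p i
  proof (rule adds_fm_limit)
    show "p \<in> T" "good_fm PS F A"
      using GT[OF that(2)] prefix by auto
    have "eventually (\<lambda>n. p @ [i] \<in> nodes (shp (\<sigma> n))) sequentially"
      "eventually (\<lambda>n. Box A \<in># ant (\<sigma> n) (p @ [i])) sequentially"
      using that GT eventually_T eventually_G by auto
    then show "eventually (\<lambda>n. adds_fm L (shp (\<sigma> n)) (sig (\<sigma> n)) (ant (\<sigma> n)) (suc (\<sigma> n)) p A) sequentially"
      by eventually_elim (rule adds_RB[OF that(1)])
  qed
  show "Box A \<in> G (p @ [i])" if "Ax4 \<in> L" "Box A \<in> G p" "p @ [i] \<in> T" for A p i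
  proof (rule adds_fm_limit[OF that(3)])
    show "good_fm PS F (Box A)"
      using GT[OF that(2)] by blast
    have "eventually (\<lambda>n. p @ [i] \<in> nodes (shp (\<sigma> n))) sequentially"
      "eventually (\<lambda>n. Box A \<in># ant (\<sigma> n) p) sequentially"
      using that eventually_T eventually_G by auto
    then show "eventually (\<lambda>n. adds_fm L (shp (\<sigma> n)) (sig (\<sigma> n)) (ant (\<sigma> n)) (suc (\<sigma> n)) (p @ [i]) (Box A)) sequentially"
      by eventually_elim (rule adds_R4[OF that(1)])
  qed
  show "Box A \<in> G q" if "Ax5 \<in> L" "Box A \<in> G p" "p \<noteq> []" "q \<in> T" for A p q
  proof (rule adds_fm_limit[OF that(4)])
    show "good_fm PS F (Box A)"
      using GT[OF that(2)] by blast
    have "eventually (\<lambda>n. p \<in> nodes (shp (\<sigma> n))) sequentially"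
      "eventually (\<lambda>n. q \<in> nodes (shp (\<sigma> n))) sequentially"
      "eventually (\<lambda>n. Box A \<in># ant (\<sigma> n) p) sequentially"
      using that GT eventually_T eventually_G by auto
    then show "eventually (\<lambda>n. adds_fm L (shp (\<sigma> n)) (sig (\<sigma> n)) (ant (\<sigma> n)) (suc (\<sigma> n)) q (Box A)) sequentially"
      by eventually_elim (rule adds_R5[OF that(1) _ _ _ that(3)])
  qed
  show "x \<in> X (p @ [i])" if "AxCBF \<in> L" "x \<in> X p" "p @ [i] \<in> T" for x p i
  proof (rule adds_var_limit[OF that(3)])
    show "x \<notin> F"
      using XT[OF that(2)] by blast
    have "eventually (\<lambda>n. p @ [i] \<in> nodes (shp (\<sigma> n))) sequentially"
      "eventually (\<lambda>n. x \<in># sig (\<sigma> n) p) sequentially"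
      using that eventually_T eventually_X by auto
    then show "eventually (\<lambda>n. adds_var L (shp (\<sigma> n)) (sig (\<sigma> n)) (ant (\<sigma> n)) (suc (\<sigma> n)) (p @ [i]) x) sequentially"
      by eventually_elim (rule adds_Rcbf[OF that(1)])
  qed
  show "x \<in> X p" if "AxBF \<in> L" "x \<in> X (p @ [i])" for x p i
  proof (rule adds_var_limit)
    show "p \<in> T" "x \<notin> F"
      using XT[OF that(2)] prefix by blast+
    have "eventually (\<lambda>n. p @ [i] \<in> nodes (shp (\<sigma> n))) sequentially"
      "eventually (\<lambda>n. x \<in># sig (\<sigma> n) (p @ [i])) sequentially"
      using that XT eventually_T eventually_X by auto
    then show "eventually (\<lambda>n. adds_var L (shp (\<sigma> n)) (sig (\<sigma> n)) (ant (\<sigma> n)) (suc (\<sigma> n)) p x) sequentially"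
      by eventually_elim (rule adds_Rbf[OF that(1)])
  qed
  show "x \<in> X p" if "AxUI \<in> L" "p \<in> T" "x \<notin> F" for p x
  proof (rule adds_var_limit[OF that(2,3)])
    show "eventually (\<lambda>n. adds_var L (shp (\<sigma> n)) (sig (\<sigma> n)) (ant (\<sigma> n)) (suc (\<sigma> n)) p x) sequentially"
      using eventually_T[OF that(2)] by eventually_elim (rule adds_Rui[OF that(1)])
  qed
  show "x \<in> X q"
    if "Ax5 \<in> L" "AxCBF \<in> L \<or> AxBF \<in> L" "p \<noteq> []" "q \<noteq> []" "x \<in> X p" "q \<in> T" for p q x
  proof (rule adds_var_limit[OF that(6)])
    show "x \<notin> F"
      using XT[OF that(5)] by blast
    have dom: "{AxCBF, AxBF} \<inter> L \<noteq> {}"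
      using that(2) by blast
    have "eventually (\<lambda>n. p \<in> nodes (shp (\<sigma> n))) sequentially"
      "eventually (\<lambda>n. q \<in> nodes (shp (\<sigma> n))) sequentially"
      "eventually (\<lambda>n. x \<in># sig (\<sigma> n) p) sequentially"
      using that XT eventually_T eventually_X by auto
    then show "eventually (\<lambda>n. adds_var L (shp (\<sigma> n)) (sig (\<sigma> n)) (ant (\<sigma> n)) (suc (\<sigma> n)) q x) sequentially"
      by eventually_elim (rule adds_R5dom[OF that(1) dom _ _ _ that(3,4)])
  qed
qed (use assms in blast)+

end

subsection \<open>Completeness and cut\<close>

lemma search_run_exists:
  fixes PS :: "nat \<Rightarrow> 'p set"
  assumes "open_stage PS L F \<sigma>0" "finite F" "\<And>n. countable (PS n)"
  obtains \<sigma> where "\<sigma> 0 = \<sigma>0" "search_run PS L F \<sigma>"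
proof -
  define J :: "(nat \<times> pos \<times> 'p fm \<times> var) set" where "J = UNIV \<times> UNIV \<times> {A. wff PS A} \<times> UNIV"
  have J: "countable J" "J \<noteq> {}"
    using countable_wff[OF assms(3)] wff.simps(3)[of PS] unfolding J_def by (auto simp del: wff.simps)
  \<comment> \<open>Taking the first component of the decoded pair makes every task recur infinitely
    often.\<close>
  define task where "task n = from_nat_into J (fst (prod_decode n))" for n
  define met where "met n \<sigma> \<sigma>' = (case task n of (k, q, C, x) \<Rightarrow> fulfils PS L F k q C x \<sigma> \<sigma>')" for n \<sigma> \<sigma>'
  have "\<exists>f. \<forall>n. (open_stage PS L F (f n) \<and> (n = 0 \<longrightarrow> f n = \<sigma>0)) \<and>
      (ext (f n) (f (Suc n)) \<and> met n (f n) (f (Suc n)))"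
  proof (rule dependent_nat_choice)
    show "\<exists>\<sigma>. open_stage PS L F \<sigma> \<and> ((0 :: nat) = 0 \<longrightarrow> \<sigma> = \<sigma>0)"
      using assms(1) by blast
    show "\<exists>\<sigma>'. (open_stage PS L F \<sigma>' \<and> (Suc n = 0 \<longrightarrow> \<sigma>' = \<sigma>0)) \<and> ext \<sigma> \<sigma>' \<and> met n \<sigma> \<sigma>'"
      if "open_stage PS L F \<sigma> \<and> (n = 0 \<longrightarrow> \<sigma> = \<sigma>0)" for \<sigma> n
    proof -
      obtain k q C x where t: "task n = (k, q, C, x)"
        by (cases "task n")
      have "open_stage PS L F \<sigma>"
        using that by blast
      then show ?thesis
        using step_exists[OF _ assms(2), of PS L \<sigma> k q C x] by (auto simp: met_def t)
    qed
  qed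
  then obtain \<sigma> where \<sigma>: "\<And>n. open_stage PS L F (\<sigma> n)" "\<sigma> 0 = \<sigma>0" "\<And>n. ext (\<sigma> n) (\<sigma> (Suc n))"
    "\<And>n. met n (\<sigma> n) (\<sigma> (Suc n))"
    by blast
  have "search_run PS L F \<sigma>"
  proof
    show "\<exists>m\<ge>n. fulfils PS L F k q C x (\<sigma> m) (\<sigma> (Suc m))" if "wff PS C" for C n k q x
    proof -
      have "(k, q, C, x) \<in> J"
        using that by (simp add: J_def)
      then obtain j where "from_nat_into J j = (k, q, C, x)"
        using from_nat_into_surj[OF J(1)] by blast
      \<comment> \<open>The second component \<open>n\<close> pushes the stage number
        \<open>prod_encode (j, n)\<close> up to at least \<open>n\<close>.\<close>
      then have "task (prod_encode (j, n)) = (k, q, C, x)"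
        by (simp add: task_def)
      then have "fulfils PS L F k q C x (\<sigma> (prod_encode (j, n))) (\<sigma> (Suc (prod_encode (j, n))))"
        using \<sigma>(4)[of "prod_encode (j, n)"] by (simp add: met_def)
      then show ?thesis
        using le_prod_encode_2 by blast
    qed
  qed (use \<sigma> assms(2) in auto)
  with \<sigma>(2) show ?thesis
    by (rule that)
qed

lemma properly_closedD:
  assumes "properly_closed TYPE('w) TYPE('d) L" "Z \<in> {Ax4, Ax5, AxCBF, AxBF}"
    and "\<And>(W :: 'w set) R (D :: 'w \<Rightarrow> 'd set). R \<subseteq> W \<times> W \<Longrightarrow> (\<And>Z. Z \<in> L \<Longrightarrow> has_property Z W R D) \<Longrightarrow>
      has_property Z W R D"
  shows "Z \<in> L"
  using assms unfolding properly_closed_def QL_frame_def frame_def by meson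

text \<open>Proper closure enters the proof through these five facts alone. Reflexive Euclidean
  relations are symmetric and transitive; for symmetric relations transitivity and the Euclidean
  property coincide, and so do the two domain inclusions.\<close>

lemma properly_closed_consequences:
  assumes "properly_closed TYPE('w) TYPE('d) L"
  shows "AxT \<in> L \<Longrightarrow> Ax5 \<in> L \<Longrightarrow> Ax4 \<in> L"
    and "AxB \<in> L \<Longrightarrow> Ax5 \<in> L \<Longrightarrow> Ax4 \<in> L"
    and "AxB \<in> L \<Longrightarrow> Ax4 \<in> L \<Longrightarrow> Ax5 \<in> L"
    and "AxB \<in> L \<Longrightarrow> AxCBF \<in> L \<longleftrightarrow> AxBF \<in> L"
    and "AxT \<in> L \<Longrightarrow> Ax5 \<in> L \<Longrightarrow> AxCBF \<in> L \<longleftrightarrow> AxBF \<in> L"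
proof -
  note closed = properly_closedD[OF assms]
  have T5_sym: "(v, w) \<in> R" if "R \<subseteq> W \<times> W" "has_property AxT W R D" "has_property Ax5 W R D" "(w, v) \<in> R"
    for W :: "'w set" and R and D :: "'w \<Rightarrow> 'd set" and w v
  proof -
    have "w \<in> W"
      using that(1,4) by blast
    then have "(w, w) \<in> R"
      using that(2) by simp
    then show ?thesis
      using that(3,4) unfolding has_property.simps by blast
  qed
  have dom: "has_property AxCBF W R D \<longleftrightarrow> has_property AxBF W R D"
    if "\<And>w v. (w, v) \<in> R \<Longrightarrow> (v, w) \<in> R" for W :: "'w set" and R and D :: "'w \<Rightarrow> 'd set"
    using that unfolding has_property.simps Ball_def split_paired_All prod.case by blast
  show "Ax4 \<in> L" if "AxT \<in> L" "Ax5 \<in> L"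
  proof (rule closed)
    fix W :: "'w set" and R and D :: "'w \<Rightarrow> 'd set"
    assume R: "R \<subseteq> W \<times> W" and "\<And>Z. Z \<in> L \<Longrightarrow> has_property Z W R D"
    then have p: "has_property AxT W R D" "has_property Ax5 W R D"
      using that by blast+
    show "has_property Ax4 W R D"
      using p(2) T5_sym[OF R p] unfolding has_property.simps trans_def by blast
  qed simp
  show "Ax4 \<in> L" if "AxB \<in> L" "Ax5 \<in> L"
  proof (rule closed)
    fix W :: "'w set" and R and D :: "'w \<Rightarrow> 'd set"
    assume "\<And>Z. Z \<in> L \<Longrightarrow> has_property Z W R D"
    then have "has_property AxB W R D" "has_property Ax5 W R D"
      using that by blast+
    then show "has_property Ax4 W R D"
      unfolding has_property.simps trans_def sym_def by blast
  qed simp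
  show "Ax5 \<in> L" if "AxB \<in> L" "Ax4 \<in> L"
  proof (rule closed)
    fix W :: "'w set" and R and D :: "'w \<Rightarrow> 'd set"
    assume "\<And>Z. Z \<in> L \<Longrightarrow> has_property Z W R D"
    then have "has_property AxB W R D" "has_property Ax4 W R D"
      using that by blast+
    then show "has_property Ax5 W R D"
      unfolding has_property.simps trans_def sym_def by blast
  qed simp
  have sym_dom: "AxCBF \<in> L \<longleftrightarrow> AxBF \<in> L"
    if sym: "\<And>(W :: 'w set) R (D :: 'w \<Rightarrow> 'd set) w v. R \<subseteq> W \<times> W \<Longrightarrow>
      (\<And>Z. Z \<in> L \<Longrightarrow> has_property Z W R D) \<Longrightarrow> (w, v) \<in> R \<Longrightarrow> (v, w) \<in> R"
  proof
    assume ax: "AxCBF \<in> L"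
    show "AxBF \<in> L"
    proof (rule closed)
      fix W :: "'w set" and R and D :: "'w \<Rightarrow> 'd set"
      assume R: "R \<subseteq> W \<times> W" and p: "\<And>Z. Z \<in> L \<Longrightarrow> has_property Z W R D"
      show "has_property AxBF W R D"
        by (rule iffD1[OF dom[OF sym[OF R p]] p[OF ax]])
    qed simp
  next
    assume ax: "AxBF \<in> L"
    show "AxCBF \<in> L"
    proof (rule closed)
      fix W :: "'w set" and R and D :: "'w \<Rightarrow> 'd set"
      assume R: "R \<subseteq> W \<times> W" and p: "\<And>Z. Z \<in> L \<Longrightarrow> has_property Z W R D"
      show "has_property AxCBF W R D"
        by (rule iffD2[OF dom[OF sym[OF R p]] p[OF ax]])
    qed simp
  qed
  show "AxCBF \<in> L \<longleftrightarrow> AxBF \<in> L" if "AxB \<in> L"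
  proof (rule sym_dom)
    fix W :: "'w set" and R and D :: "'w \<Rightarrow> 'd set" and w v
    assume "\<And>Z. Z \<in> L \<Longrightarrow> has_property Z W R D" and "(w, v) \<in> R"
    then show "(v, w) \<in> R"
      using that by (metis has_property.simps(3) symD)
  qed
  show "AxCBF \<in> L \<longleftrightarrow> AxBF \<in> L" if "AxT \<in> L" "Ax5 \<in> L"
  proof (rule sym_dom)
    fix W :: "'w set" and R and D :: "'w \<Rightarrow> 'd set" and w v
    assume R: "R \<subseteq> W \<times> W" and p: "\<And>Z. Z \<in> L \<Longrightarrow> has_property Z W R D" and wv: "(w, v) \<in> R"
    show "(v, w) \<in> R"
      using T5_sym[OF R p[OF that(1)] p[OF that(2)] wv] .
  qed
qed

text \<open>Derivability disregards bound renaming, so the search can start from a pure variant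
  \<open>S'\<close>, with all variables as its pool and the bound variables of \<open>S'\<close> as
  \<open>F\<close>. The refutation of \<open>S'\<close> is carried back to \<open>S\<close>.\<close>

lemma countermodel_exists:
  fixes PS :: "nat \<Rightarrow> 'p set" and S :: "'p nsequent"
  assumes "\<And>n. countable (PS n)" "properly_closed TYPE('w) TYPE('d) L" "wf_nsequent PS S"
    and "\<not> derivable PS L S"
  obtains F T X and G H :: "pos \<Rightarrow> 'p fm set" where "saturated PS L F T X G H"
    "interp.refutes (saturated.acc L T X G) X (saturated.eqv G) (\<lambda>p i xs. Pred i xs \<in> G p) S
      (saturated.assign F) []"
proof -
  obtain S' where S': "alphabetical_variant S S'" "pure S'"
    by (rule pure_variant_exists)
  have wf: "wf_nsequent PS S'"
    using alphabetical_variant_wf[OF alphabetical_variant_sym[OF S'(1)] assms(3)] .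
  obtain s Y \<Gamma> \<Delta> where ns: "ns s Y \<Gamma> \<Delta> = S'"
    using ns_surj by blast
  let ?F = "bound_vars S'"
  have F: "finite ?F"
    by (simp add: bound_vars_def)
  have "good_labels PS ?F s Y \<Gamma> \<Delta>"
  proof -
    have "good_fm PS ?F A" if "A \<in> fms S'" for A
      using that wf S'(2) by (auto simp: good_fm_def wf_nsequent_def pure_def free_vars_def bound_vars_def)
    moreover have "sigvars S' \<inter> ?F = {}"
      using S'(2) by (auto simp: pure_def free_vars_def)
    ultimately show ?thesis
      unfolding good_labels_def ns[symmetric] fms_ns sigvars_ns by blast
  qed
  moreover have "\<not> derivable_from PS L UNIV S'"
    using assms(4) S'(1) by (auto simp: derivable_def derivable_from_def)
  ultimately have "open_stage PS L ?F (Stage s Y \<Gamma> \<Delta> UNIV)"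
    by (simp add: open_stage_def ns)
  then obtain \<sigma> where \<sigma>: "\<sigma> 0 = Stage s Y \<Gamma> \<Delta> UNIV" "search_run PS L ?F \<sigma>"
    by (rule search_run_exists[OF _ F assms(1)]) (rule that)
  interpret search_run PS L ?F \<sigma>
    by (rule \<sigma>(2))
  interpret sat: saturated PS L ?F T X G H
    by (rule saturated_limit) (use properly_closed_consequences[OF assms(2)] in blast)+
  have "sat.refutes (ns s Y \<Gamma> \<Delta>) sat.assign []"
  proof (rule sat.refutes_ns)
    fix q
    assume "q \<in> nodes s"
    then have "q \<in> nodes (shp (\<sigma> 0))"
      by (simp add: \<sigma>(1))
    moreover have "Y = sig (\<sigma> 0)" "\<Gamma> = ant (\<sigma> 0)" "\<Delta> = suc (\<sigma> 0)"
      by (simp_all add: \<sigma>(1))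
    ultimately show "[] @ q \<in> T \<and> set_mset (Y q) \<subseteq> X ([] @ q) \<and> set_mset (\<Gamma> q) \<subseteq> G ([] @ q) \<and>
        set_mset (\<Delta> q) \<subseteq> H ([] @ q)"
      unfolding T_def X_def G_def H_def append_Nil by blast
  qed
  then have "sat.refutes S sat.assign []"
    using sat.refutes_alpha[OF S'(1)] ns by simp
  then show ?thesis
    using that[OF sat.saturated_axioms] by blast
qed

text \<open>The types of worlds and objects in \<open>sound\<close> are those of the countermodels:
  positions and variables. The search treats well-formed formulas only, so by \<open>wf\<close> the
  conclusion inherits well-formedness from a premiss, which has it by being derivable.\<close>

lemma admissible_if_sound:
  fixes PS :: "nat \<Rightarrow> 'p set" and \<rho> :: "('p nsequent list \<times> 'p nsequent) set"
  assumes "\<And>n. countable (PS n)" "properly_closed TYPE('w) TYPE('d) L"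
    and wf: "\<And>Ps S. (Ps, S) \<in> \<rho> \<Longrightarrow> \<exists>P\<in>set Ps. fms S \<subseteq> fms P"
    and sound: "\<And>R D E I W U Ps S (g :: var \<Rightarrow> var) (w :: pos). model R D E I L W U \<Longrightarrow> (Ps, S) \<in> \<rho> \<Longrightarrow>
      interp.refutes R D E I S g w \<Longrightarrow> \<exists>P\<in>set Ps. interp.refutes R D E I P g w"
  shows "admissible PS L \<rho>"
  unfolding admissible_def
proof (clarify, rule ccontr)
  fix Ps S
  assume rule: "(Ps, S) \<in> \<rho>" and prems: "\<forall>P\<in>set Ps. derivable PS L P" and not: "\<not> derivable PS L S"
  have "wf_nsequent PS P" if P: "derivable PS L P" for P :: "'p nsequent"
  proof -
    obtain P' ys where "alphabetical_variant P P'" "derivation PS L ys P'"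
      using P by (auto simp: derivable_def)
    moreover from this(2) have "wf_nsequent PS P'"
      by cases
    ultimately show ?thesis
      using alphabetical_variant_wf by blast
  qed
  then have "wf_nsequent PS S"
    using wf[OF rule] prems unfolding wf_nsequent_def by blast
  then obtain F T X G H where sat: "saturated PS L F T X G H" and
    refuted: "interp.refutes (saturated.acc L T X G) X (saturated.eqv G) (\<lambda>p i xs. Pred i xs \<in> G p) S
      (saturated.assign F) []"
    by (rule countermodel_exists[OF assms(1,2) _ not])
  interpret saturated PS L F T X G H
    by (rule sat)
  obtain P where "P \<in> set Ps" "refutes P assign []"
    using sound[OF model_axioms rule refuted] by blast
  then show False
    using derivable_sound[OF _ root range_assign] prems by blast
qed

theorem theorem2:
  fixes PS :: "nat \<Rightarrow> 'p set" and L :: "ax set"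
  assumes "\<And>n. countable (PS n)"
    and "properly_closed TYPE('w) TYPE('d) L"
  shows "admissible PS L Cut \<and> admissible PS L (LCut L)"
proof
  show "admissible PS L Cut"
  proof (rule admissible_if_sound[OF assms])
    fix Ps and S :: "'p nsequent"
    assume rule: "(Ps, S) \<in> Cut"
    then obtain P Q where Ps: "Ps = [P, Q]"
      unfolding Cut_def by blast
    obtain C X \<Gamma> \<Delta> A where P: "P = plug C [NS X \<Gamma> (add_mset A \<Delta>) {#}]"
      and S: "S = plug C [NS X \<Gamma> \<Delta> {#}]"
      using rule unfolding Ps Cut_def by blast
    have "fms S \<subseteq> fms P"
      unfolding P S by (rule fms_plug_mono) (auto simp: nth_Cons')
    then show "\<exists>P\<in>set Ps. fms S \<subseteq> fms P"
      by (simp add: Ps)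
    show "\<exists>P\<in>set Ps. interp.refutes R D E I P g w"
      if "model R D E I L W U" "interp.refutes R D E I S g w"
      for R D E I W U and g :: "var \<Rightarrow> var" and w :: pos
      using model.Cut_sound[OF that(1) rule[unfolded Ps] that(2)] Ps by auto
  qed
  show "admissible PS L (LCut L)"
  proof (rule admissible_if_sound[OF assms])
    fix Ps and S :: "'p nsequent"
    assume rule: "(Ps, S) \<in> LCut L"
    then obtain P Q where Ps: "Ps = [P, Q]"
      unfolding LCut_def by blast
    obtain C X \<Gamma> \<Delta> A n Y \<Pi> \<Sigma> where 
      P: "P = plug C (NS X \<Gamma> (add_mset (Box A) \<Delta>) {#} #
        map (\<lambda>i. NS (Y i) (\<Pi> i) (\<Sigma> i) {#}) [1..<Suc n])"
      and S: "S = plug C (NS X \<Gamma> \<Delta> {#} # map (\<lambda>i. NS (Y i) (\<Pi> i) (\<Sigma> i) {#}) [1..<Suc n])"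
      using rule unfolding Ps LCut_def by blast
    have "fms S \<subseteq> fms P"
      unfolding P S by (rule fms_plug_mono) (auto simp: nth_Cons' simp del: upt_Suc)
    then show "\<exists>P\<in>set Ps. fms S \<subseteq> fms P"
      by (simp add: Ps)
    show "\<exists>P\<in>set Ps. interp.refutes R D E I P g w"
      if "model R D E I L W U" "interp.refutes R D E I S g w"
      for R D E I W U and g :: "var \<Rightarrow> var" and w :: pos
      using model.LCut_sound[OF that(1) rule[unfolded Ps] that(2)] Ps by auto
  qed
qed

end
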